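(* Let $q\in L^1(0,\pi)$ be real-valued and let $A\subseteq\mathbb{N}$. Then the Dirichlet-Dirichlet spectrum $\{a_n\}_{n\in\mathbb{N}}$ of $q$, the part $\{b_n\}_{n\in\mathbb{N}\setminus A}$ of the Neumann-Dirichlet spectrum $\{b_n\}_{n\in\mathbb{N}}$ of $q$, and the point masses $\{\gamma_n\}_{n\in A}$ of the spectral measure $\mu_{0,0}=\sum_{n\in\mathbb{N}}\gamma_n\delta_{a_n}$ of $q$ determine the potential $q$. That is: if $\widetilde q\in L^1(0,\pi)$ is real-valued, with corresponding quantities $\widetilde a_n,\widetilde b_n,\widetilde\gamma_n$, and $\widetilde a_n=a_n$ for all $n\in\mathbb{N}$, $\widetilde b_n=b_n$ for all $n\in\mathbb{N}\setminus A$, and $\widetilde\gamma_n=\gamma_n$ for all $n\in A$, then $\widetilde q=q$ almost everywhere on $(0,\pi)$.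
   Context: $\mathbb{N}=\{1,2,3,\dots\}$. For a real-valued potential $q\in L^1(0,\pi)$ consider the Schrödinger equation $-u''+qu=zu$ on $(0,\pi)$. The Dirichlet-Dirichlet spectrum $\sigma_{DD}=\{a_n\}_{n\in\mathbb{N}}$ is the set of eigenvalues for the boundary conditions $u(0)=0$, $u(\pi)=0$; the Neumann-Dirichlet spectrum $\sigma_{ND}=\{b_n\}_{n\in\mathbb{N}}$ is the set of eigenvalues for the boundary conditions $u'(0)=0$, $u(\pi)=0$. Both are discrete subsets of $\mathbb{R}$, bounded below, and are enumerated in increasing order. For each $n$ let $s_{a_n}$ be the solution of $-u''+qu=a_nu$ with $s_{a_n}(0)=0$, $s_{a_n}'(0)=1$; the point masses of the spectral measure $\mu_{0,0}=\sum_{n}\gamma_n\delta_{a_n}$ are $\gamma_n=\left(\int_0^\pi|s_{a_n}(t)|^2\,dt\right)^{-1}$. Equivalently, $\gamma_n=-\operatorname{Res}(m,a_n)$, where $m(z)=u_z'(0)/u_z(0)$ is the Weyl-Titchmarsh $m$-function and $u_z$ is the solution of $-u''+qu=zu$ with $u_z(\pi)=0$, $u_z'(\pi)=-1$. *)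

theory Defs
  imports "HOL-Analysis.Analysis"
begin

text \<open>
  \<^term>\<open>f\<close> is absolutely continuous on the interval from \<^term>\<open>a\<close> to \<^term>\<open>b\<close> with
  (almost everywhere) derivative \<^term>\<open>g\<close>, i.e. \<^term>\<open>f\<close> is an indefinite Lebesgue integral
  of the integrable function \<^term>\<open>g\<close>. Only the values on the closed interval matter.
\<close>
definition absolutely_continuous_with_derivative ::
    "real \<Rightarrow> real \<Rightarrow> (real \<Rightarrow> complex) \<Rightarrow> (real \<Rightarrow> complex) \<Rightarrow> bool" where
  "absolutely_continuous_with_derivative a b f g \<longleftrightarrow>
     g absolutely_integrable_on {a..b} \<and>
     (\<forall>x\<in>{a..b}. f x = f a + integral {a..x} g)"

text \<open>
  \<^term>\<open>u\<close>, with first derivative \<^term>\<open>u'\<close>, solves $-u'' + q u = z u$ on $(0,\pi)$ in the usual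
  sense for an integrable potential: \<^term>\<open>u\<close> is differentiable up to the (regular) endpoints,
  \<^term>\<open>u'\<close> is absolutely continuous, and the equation holds almost everywhere.
\<close>
definition schroedinger_solution ::
    "(real \<Rightarrow> real) \<Rightarrow> complex \<Rightarrow> (real \<Rightarrow> complex) \<Rightarrow> (real \<Rightarrow> complex) \<Rightarrow> bool" where
  "schroedinger_solution q z u u' \<longleftrightarrow>
     (\<forall>x\<in>{0..pi}. (u has_vector_derivative u' x) (at x within {0..pi})) \<and>
     (\<exists>u''. absolutely_continuous_with_derivative 0 pi u' u'' \<and>
        (AE x in lebesgue. x \<in> {0<..<pi} \<longrightarrow> - u'' x + of_real (q x) * u x = z * u x))"

definition DD_spectrum :: "(real \<Rightarrow> real) \<Rightarrow> complex set" where
  "DD_spectrum q = {z. \<exists>u u'. schroedinger_solution q z u u' \<and>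
     (\<exists>x\<in>{0..pi}. u x \<noteq> 0) \<and> u 0 = 0 \<and> u pi = 0}"

definition ND_spectrum :: "(real \<Rightarrow> real) \<Rightarrow> complex set" where
  "ND_spectrum q = {z. \<exists>u u'. schroedinger_solution q z u u' \<and>
     (\<exists>x\<in>{0..pi}. u x \<noteq> 0) \<and> u' 0 = 0 \<and> u pi = 0}"

text \<open>
  The (real) points of \<^term>\<open>S\<close> listed in increasing order, with indices starting from 1; the
  value of the sequence at index 0 is irrelevant.
\<close>
definition increasing_enumeration :: "(nat \<Rightarrow> real) \<Rightarrow> complex set \<Rightarrow> bool" where
  "increasing_enumeration a S \<longleftrightarrow>
     strict_mono_on {1..} a \<and> S = (\<lambda>n. complex_of_real (a n)) ` {1..}"

text \<open>
  For \<^term>\<open>q\<close> integrable on $(0,\pi)$ the initial value problem determines the solution on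
  $[0,\pi]$; its values elsewhere are arbitrary and are never used.
\<close>
definition sine_type_solution :: "(real \<Rightarrow> real) \<Rightarrow> complex \<Rightarrow> real \<Rightarrow> complex" where
  "sine_type_solution q z =
     (SOME s. \<exists>s'. schroedinger_solution q z s s' \<and> s 0 = 0 \<and> s' 0 = 1)"

text \<open>
  The mass $\gamma$ that the spectral measure $\mu_{0,0}$ assigns to a Dirichlet-Dirichlet
  eigenvalue \<^term>\<open>E\<close>.
\<close>
definition spectral_point_mass :: "(real \<Rightarrow> real) \<Rightarrow> real \<Rightarrow> real" where
  "spectral_point_mass q E =
     inverse (integral {0..pi} (\<lambda>t. (cmod (sine_type_solution q (of_real E) t))\<^sup>2))"

end

theory Submission
  imports Defs "HOL-Complex_Analysis.Complex_Analysis"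
begin

text \<open>
  Write \<open>s\<close> and \<open>c\<close> for the solutions with Dirichlet and Neumann data at \<open>0\<close>, and \<open>S\<close>, \<open>C\<close> for
  their values at \<open>\<pi>\<close>. These are entire in \<open>z\<close>, their zeros are the \<open>a n\<close> and the \<open>b n\<close>,
  and these zeros interlace. Moreover \<open>C (a n) = S' (a n) * \<gamma> n\<close>.

  Let \<open>F\<close> be entire, small compared with \<open>S\<close> on large circles, and vanish for every \<open>n\<close> at
  \<open>a n\<close> or at \<open>b n\<close>. Multiply \<open>F / S\<close> by the factors \<open>(z - a n) / (z - b n)\<close> for those \<open>n\<close> with
  \<open>a n\<close> inside the circle at which \<open>b n\<close> is the known zero. The result is holomorphic in the disc.
  By interlacing the product of the extra factors is bounded on the circle and at least 1 to the
  left of \<open>b 1\<close>, so the maximum principle gives \<open>F = 0\<close>. No infinite products and no asymptotics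
  of eigenvalues are involved.

  With a tilde for the second potential, this applies first to \<open>S - S~\<close>, all zeros being known.
  The equality \<open>S = S~\<close> forces equal means of the potentials, which makes \<open>C - C~\<close> small enough for
  a second application: it vanishes at \<open>a n\<close> for \<open>n \<in> A\<close> by the point masses and at \<open>b n\<close> otherwise.
  For fixed \<open>x\<close>, the third application is to \<open>S * (c x * s~ x - s x * c~ x) = u x * s~ x - s x * u~ x\<close>, where
  \<open>u = S c - C s\<close> vanishes at \<open>\<pi>\<close>. Hence \<open>c / s\<close> agrees for the two potentials; since
  \<open>(c / s)' = - 1 / s\<^sup>2\<close>, so do the solutions themselves, and then the potentials.
\<close>

text \<open>With \<open>z = k\<^sup>2\<close>, on the circles used here \<open>S\<close> has exact
  order \<open>exp (\<bar>Im k\<bar> * pi) / norm k\<close>, and this sets the standard of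
  smallness. \<open>S - S~\<close> is smaller by one power of \<open>k\<close>. For
  \<open>C - C~\<close> the leading correction is of the same order as \<open>S\<close>:
  \<open>sin (k * pi)\<close> times the difference of the means plus an oscillating integral, all
  divided by \<open>2 * k\<close>. Hence the means must be compared first. Even then the quotient by
  \<open>S\<close> is known to be small only where \<open>\<bar>Im k\<bar>\<close> is large and is
  merely bounded near the positive axis, which is why a factor vanishing at the rightmost point of
  each circle is carried along. The radii are \<open>(n + 1 / 2)\<^sup>2\<close>, so that the
  circles avoid the zeros of \<open>sin (k * pi)\<close>. The third application is evaluated at the
  single point \<open>z = \<i>\<close>, where \<open>S\<close> does not vanish because all
  \<open>a n\<close> are real; one parameter value suffices because \<open>s\<close> and
  \<open>c\<close> have no common zero.\<close>

section \<open>Indefinite Lebesgue integrals\<close>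

text \<open>Several Henstock-Kurzweil facts are shadowed by facts of the same name for the Bochner integral.\<close>
lemmas hk_integral_add = Henstock_Kurzweil_Integration.integral_add
  and hk_integral_cnj = Henstock_Kurzweil_Integration.integral_cnj
  and hk_integral_combine = Henstock_Kurzweil_Integration.integral_combine
  and hk_integral_cong = Henstock_Kurzweil_Integration.integral_cong
  and hk_integral_diff = Henstock_Kurzweil_Integration.integral_diff
  and hk_integral_le = Henstock_Kurzweil_Integration.integral_le
  and hk_integral_mult_right = Henstock_Kurzweil_Integration.integral_mult_right
  and hk_integral_nonneg = Henstock_Kurzweil_Integration.integral_nonneg
  and hk_integral_norm_bound_integral = Henstock_Kurzweil_Integration.integral_norm_bound_integral
  and hk_integral_subset_le = Henstock_Kurzweil_Integration.integral_subset_le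
  and hk_integral_sum = Henstock_Kurzweil_Integration.integral_sum

lemma absolutely_integrable_mult_continuous:
  fixes f g :: "real \<Rightarrow> 'a::{euclidean_space, real_normed_field}"
  assumes "f absolutely_integrable_on {a..b}" "continuous_on {a..b} g"
  shows "(\<lambda>t. f t * g t) absolutely_integrable_on {a..b}"
proof -
  have "(\<lambda>t. g t * f t) absolutely_integrable_on {a..b}"
  proof (rule absolutely_integrable_bounded_measurable_product[where h = "(*)"])
    show "bilinear ((*) :: 'a \<Rightarrow> 'a \<Rightarrow> 'a)"
      by (rule bilinear_times)
    show "g \<in> borel_measurable (lebesgue_on {a..b})"
      by (rule continuous_imp_measurable_on_sets_lebesgue[OF assms(2)]) simp
    show "bounded (g ` {a..b})"
      by (intro compact_imp_bounded compact_continuous_image assms compact_Icc)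
  qed (use assms in auto)
  then show ?thesis by (simp add: mult.commute)
qed

text \<open>Summing the local estimate over a uniform partition of mesh below \<open>d\<close>
  telescopes on both sides. In the product rule below, \<open>H\<close> is a multiple of an
  indefinite integral, and an error rate valid on short intervals is carried over to long
  ones.\<close>

lemma norm_increment_le_of_local:
  fixes F :: "real \<Rightarrow> 'a::real_normed_vector" and H :: "real \<Rightarrow> real"
  assumes "a \<le> b" "d > 0"
    and loc: "\<And>x y. \<lbrakk>a \<le> x; x \<le> y; y \<le> b; y - x < d\<rbrakk> \<Longrightarrow> norm (F y - F x) \<le> H y - H x"
  shows "norm (F b - F a) \<le> H b - H a"
proof -
  obtain n :: nat where n: "n > 0" "(b - a) / d < real n"
    using reals_Archimedean2[of "(b - a) / d"] assms
    by (metis divide_nonneg_pos diff_ge_0_iff_ge gr0I less_le_not_le of_nat_0)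
  define h where "h = (b - a) / n"
  have h: "h \<ge> 0" "h < d" "real n * h = b - a"
    using n assms by (auto simp: h_def field_simps)
  have "norm (F (a + real i * h) - F a) \<le> H (a + real i * h) - H a" if "i \<le> n" for i
    using that
  proof (induction i)
    case (Suc i)
    have le: "real (Suc i) * h \<le> real n * h"
      using Suc.prems h by (intro mult_right_mono) auto
    have "norm (F (a + real (Suc i) * h) - F (a + real i * h)) \<le> H (a + real (Suc i) * h) - H (a + real i * h)"
      by (rule loc) (use h le in \<open>auto simp: algebra_simps\<close>)
    moreover have "norm (F (a + real (Suc i) * h) - F a) \<le>
        norm (F (a + real (Suc i) * h) - F (a + real i * h)) + norm (F (a + real i * h) - F a)"
      by norm
    ultimately show ?case using Suc by linarith
  qed auto
  from this[of n] show ?thesis using h by simp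
qed

text \<open>The remainder on a short interval is an integral of \<^term>\<open>g\<close> and \<^term>\<open>k\<close> against
  oscillations of \<^term>\<open>h\<close> and \<^term>\<open>f\<close>, so uniform continuity makes the total remainder vanish.\<close>
lemma indefinite_integral_mult:
  fixes f g h k :: "real \<Rightarrow> 'a::{euclidean_space, real_normed_field}"
  assumes g: "g absolutely_integrable_on {a..b}" and k: "k absolutely_integrable_on {a..b}"
    and f: "\<And>x. x \<in> {a..b} \<Longrightarrow> f x = f a + integral {a..x} g"
    and h: "\<And>x. x \<in> {a..b} \<Longrightarrow> h x = h a + integral {a..x} k"
    and x: "x \<in> {a..b}"
  shows "f x * h x = f a * h a + integral {a..x} (\<lambda>t. g t * h t + f t * k t)"
proof -
  have gi: "g integrable_on {a..b}" and ki: "k integrable_on {a..b}"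
    using g k by (auto intro: set_lebesgue_integral_eq_integral)
  have cf: "continuous_on {a..b} f"
    by (rule continuous_on_eq[of _ "\<lambda>x. f a + integral {a..x} g"])
      (auto intro!: continuous_intros indefinite_integral_continuous_1 gi simp: f[symmetric])
  have ch: "continuous_on {a..b} h"
    by (rule continuous_on_eq[of _ "\<lambda>x. h a + integral {a..x} k"])
      (auto intro!: continuous_intros indefinite_integral_continuous_1 ki simp: h[symmetric])
  define p where "p = (\<lambda>t. g t * h t + f t * k t)"
  have p: "p absolutely_integrable_on {a..b}"
    using absolutely_integrable_mult_continuous[OF g ch] absolutely_integrable_mult_continuous[OF k cf]
    unfolding p_def by (auto simp: mult.commute intro: set_integral_add)
  then have pi: "p integrable_on {a..b}"
    by (auto intro: set_lebesgue_integral_eq_integral)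
  have ab: "a \<le> b" using x by auto
  define H where "H = (\<lambda>x. integral {a..x} (\<lambda>t. norm (g t) + norm (k t)))"
  have ni: "(\<lambda>t. norm (g t) + norm (k t)) integrable_on {a..b}"
    using g k by (intro integrable_add) (auto simp: absolutely_integrable_on_def)
  define F where "F = (\<lambda>x. f x * h x - integral {a..x} p)"
  have inc: "integral {a..v} r - integral {a..u} r = integral {u..v} r"
    if "r integrable_on {a..b}" "a \<le> u" "u \<le> v" "v \<le> b" for r :: "real \<Rightarrow> 'b::euclidean_space" and u v
  proof -
    have "integral {a..u} r + integral {u..v} r = integral {a..v} r"
      by (rule hk_integral_combine)
        (use that in \<open>auto intro: integrable_on_subinterval[OF that(1)]\<close>)
    then show ?thesis by (metis add_diff_cancel_left')
  qed
  have small: "norm (F x - F a) \<le> e * (H x - H a)" if e: "e > 0" for e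
  proof -
    have "uniformly_continuous_on {a..b} f" "uniformly_continuous_on {a..b} h"
      using cf ch compact_uniformly_continuous by auto
    then obtain d1 d2 where d: "d1 > 0" "d2 > 0"
      "\<And>u v. \<lbrakk>u \<in> {a..b}; v \<in> {a..b}; dist v u < d1\<rbrakk> \<Longrightarrow> dist (f v) (f u) < e"
      "\<And>u v. \<lbrakk>u \<in> {a..b}; v \<in> {a..b}; dist v u < d2\<rbrakk> \<Longrightarrow> dist (h v) (h u) < e"
      unfolding uniformly_continuous_on_def using e by metis
    have "norm (F x - F a) \<le> e * H x - e * H a"
    proof (rule norm_increment_le_of_local)
      show "min d1 d2 > 0" using d by auto
      fix u v assume uv: "a \<le> u" "u \<le> v" "v \<le> x" "v - u < min d1 d2"
      then have vb: "v \<le> b" using x by auto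
      have giu: "g integrable_on {u..v}" and kiu: "k integrable_on {u..v}" and piu: "p integrable_on {u..v}"
        and niu: "(\<lambda>t. norm (g t) + norm (k t)) integrable_on {u..v}"
        using uv vb
        by (auto intro: integrable_on_subinterval[OF gi] integrable_on_subinterval[OF ki]
            integrable_on_subinterval[OF ni] integrable_on_subinterval[OF pi])
      have fuv: "f v - f u = integral {u..v} g"
        using inc[OF gi, of u v] uv vb f[of u] f[of v] by simp
      have huv: "h v - h u = integral {u..v} k"
        using inc[OF ki, of u v] uv vb h[of u] h[of v] by simp
      \<comment> \<open>A discrete product rule with \<open>f\<close> frozen at the left end and
        \<open>h\<close> at the right end: it is exact, with no product of two increments left
        over.\<close>
      have "F v - F u = (f v - f u) * h v + f u * (h v - h u) - integral {u..v} p"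
        using inc[OF pi, of u v] uv vb unfolding F_def
        by (simp add: algebra_simps)
      also have "\<dots> = integral {u..v} (\<lambda>t. g t * h v + f u * k t) - integral {u..v} p"
        unfolding fuv huv using giu kiu
        by (subst hk_integral_add) (auto intro!: integrable_on_mult_left integrable_on_mult_right)
      also have "\<dots> = integral {u..v} (\<lambda>t. g t * h v + f u * k t - p t)"
        using giu kiu piu
        by (subst hk_integral_diff) (auto intro!: integrable_on_mult_left integrable_on_mult_right integrable_add)
      also have "\<dots> = integral {u..v} (\<lambda>t. g t * (h v - h t) + (f u - f t) * k t)"
        by (simp add: p_def algebra_simps)
      finally have eq: "F v - F u = integral {u..v} (\<lambda>t. g t * (h v - h t) + (f u - f t) * k t)" .
      have "norm (F v - F u) \<le> integral {u..v} (\<lambda>t. e * (norm (g t) + norm (k t)))"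
        unfolding eq
      proof (rule hk_integral_norm_bound_integral)
        have "(\<lambda>t. g t * h v + f u * k t - p t) integrable_on {u..v}"
          using giu kiu piu
          by (auto intro!: integrable_on_mult_left integrable_on_mult_right integrable_add integrable_diff)
        then show "(\<lambda>t. g t * (h v - h t) + (f u - f t) * k t) integrable_on {u..v}"
          by (simp add: p_def algebra_simps)
        show "(\<lambda>t. e * (norm (g t) + norm (k t))) integrable_on {u..v}"
          using niu by (rule integrable_on_mult_right)
        fix t assume t: "t \<in> {u..v}"
        have "norm (h v - h t) \<le> e" "norm (f u - f t) \<le> e"
          using d(3)[of t u] d(4)[of t v] t uv vb by (auto simp: dist_norm dist_commute less_imp_le)
        then have "norm (g t) * norm (h v - h t) + norm (f u - f t) * norm (k t) \<le> norm (g t) * e + e * norm (k t)"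
          by (intro add_mono mult_left_mono mult_right_mono) auto
        then show "norm (g t * (h v - h t) + (f u - f t) * k t) \<le> e * (norm (g t) + norm (k t))"
          by (intro order_trans[OF norm_triangle_ineq]) (simp add: norm_mult distrib_left mult.commute)
      qed
      also have "\<dots> = e * (H v - H u)"
        using inc[OF ni, of u v] uv vb by (simp add: H_def)
      finally show "norm (F v - F u) \<le> e * H v - e * H u"
        by (simp add: right_diff_distrib)
    qed (use x in auto)
    then show ?thesis by (simp add: algebra_simps)
  qed
  have "norm (F x - F a) \<le> 0"
  proof (rule field_le_epsilon)
    fix e :: real assume e: "e > 0"
    have "norm (F x - F a) \<le> (e / (\<bar>H x - H a\<bar> + 1)) * (H x - H a)"
      by (rule small) (use e in auto)
    also have "\<dots> \<le> e"
    proof -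
      have "e * (H x - H a) \<le> e * (\<bar>H x - H a\<bar> + 1)"
        by (rule mult_left_mono) (use e in auto)
      then show ?thesis
        by (simp add: divide_le_eq)
    qed
    finally show "norm (F x - F a) \<le> 0 + e" by simp
  qed
  then show ?thesis
    using ab by (simp add: F_def p_def algebra_simps)
qed

text \<open>Induction with the product rule for \<open>H * H ^ Suc n\<close>, where \<open>H\<close>
  is the indefinite integral of \<open>g\<close>. The denominators \<open>Suc n\<close> accumulate
  to the factorials in the Volterra series.\<close>

lemma indefinite_integral_power:
  fixes g :: "real \<Rightarrow> real"
  assumes g: "g absolutely_integrable_on {a..b}" and x: "x \<in> {a..b}"
  shows "integral {a..x} (\<lambda>t. g t * (integral {a..t} g) ^ n) = (integral {a..x} g) ^ Suc n / real (Suc n)"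
  using x
proof (induction n arbitrary: x)
  case (Suc n)
  define H where "H = (\<lambda>x. integral {a..x} g)"
  have gi: "g integrable_on {a..b}"
    using g by (auto intro: set_lebesgue_integral_eq_integral)
  have cH: "continuous_on {a..b} H"
    unfolding H_def by (rule indefinite_integral_continuous_1[OF gi])
  have "H x * H x ^ Suc n = H a * H a ^ Suc n +
     integral {a..x} (\<lambda>t. g t * H t ^ Suc n + H t * (real (Suc n) * (g t * H t ^ n)))"
  proof (rule indefinite_integral_mult[where b = b])
    show "(\<lambda>t. real (Suc n) * (g t * H t ^ n)) absolutely_integrable_on {a..b}"
      by (intro set_integrable_mult_right absolutely_integrable_mult_continuous g continuous_intros cH)
    fix y assume y: "y \<in> {a..b}"
    have "integral {a..y} (\<lambda>t. g t * H t ^ n) = H y ^ Suc n / Suc n"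
      using Suc.IH[OF y] by (simp add: H_def)
    then show "H y ^ Suc n = H a ^ Suc n + integral {a..y} (\<lambda>t. real (Suc n) * (g t * H t ^ n))"
      unfolding hk_integral_mult_right by (simp add: H_def)
  qed (use g Suc.prems in \<open>auto simp: H_def\<close>)
  also have "(\<lambda>t. g t * H t ^ Suc n + H t * (real (Suc n) * (g t * H t ^ n))) =
      (\<lambda>t. real (Suc (Suc n)) * (g t * H t ^ Suc n))"
    by (auto simp: algebra_simps)
  finally show ?case
    unfolding hk_integral_mult_right by (simp add: H_def field_simps)
qed simp

lemma absolutely_integrable_of_real:
  assumes "q absolutely_integrable_on {a..b}"
  shows "(\<lambda>t. complex_of_real (q t)) absolutely_integrable_on {a..b::real}"
  using absolutely_integrable_linear[OF assms bounded_linear_of_real[where 'a = complex]]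
  by (simp add: o_def)

lemma indefinite_integral_of_derivative:
  fixes u u' :: "real \<Rightarrow> complex"
  assumes "\<And>x. x \<in> {a..b} \<Longrightarrow> (u has_vector_derivative u' x) (at x within {a..b})" "x \<in> {a..b}"
  shows "u x = u a + integral {a..x} u'"
proof -
  have "(u' has_integral u x - u a) {a..x}"
    using assms
    by (intro fundamental_theorem_of_calculus)
      (auto intro: has_vector_derivative_within_subset[of u _ _ "{a..b}"])
  then show ?thesis by (simp add: integral_unique)
qed

section \<open>Solutions of the Schroedinger equation\<close>

text \<open>The equation is stated in integrated form, so it holds at every point and involves
  neither a second derivative nor a null set. Only the difference \<open>Q t - z\<close> enters,
  which makes a simultaneous shift of potential and parameter invisible.\<close>

definition ivp_solution ::
    "(real \<Rightarrow> complex) \<Rightarrow> complex \<Rightarrow> (real \<Rightarrow> complex) \<Rightarrow> (real \<Rightarrow> complex) \<Rightarrow> bool" where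
  "ivp_solution Q z u u' \<longleftrightarrow>
     (\<forall>x\<in>{0..pi}. (u has_vector_derivative u' x) (at x within {0..pi})) \<and>
     (\<forall>x\<in>{0..pi}. u' x = u' 0 + integral {0..x} (\<lambda>t. (Q t - z) * u t))"

lemma ivp_solution_deriv_eq:
  assumes "ivp_solution Q z u u'" "x \<in> {0..pi}"
  shows "u' x = u' 0 + integral {0..x} (\<lambda>t. (Q t - z) * u t)"
  using assms unfolding ivp_solution_def by blast

lemma ivp_solution_has_vector_derivative:
  assumes "ivp_solution Q z u u'" "x \<in> {0..pi}"
  shows "(u has_vector_derivative u' x) (at x within {0..pi})"
  using assms unfolding ivp_solution_def by blast

lemma ivp_solution_integral:
  assumes "ivp_solution Q z u u'" "x \<in> {0..pi}"
  shows "u x = u 0 + integral {0..x} u'"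
  by (rule indefinite_integral_of_derivative[OF _ assms(2)]) (rule ivp_solution_has_vector_derivative[OF assms(1)])

lemma ivp_solution_continuous:
  assumes "ivp_solution Q z u u'"
  shows "continuous_on {0..pi} u"
  using assms unfolding ivp_solution_def continuous_on_eq_continuous_within
  by (metis has_vector_derivative_continuous)

lemma potential_mult_absolutely_integrable:
  fixes Q u :: "real \<Rightarrow> complex"
  assumes "Q absolutely_integrable_on {0..pi}" "continuous_on {0..pi} u"
  shows "(\<lambda>t. (Q t - z) * u t) absolutely_integrable_on {0..pi}"
proof (rule absolutely_integrable_mult_continuous[OF _ assms(2)])
  show "(\<lambda>t. Q t - z) absolutely_integrable_on {0..pi}"
    using assms(1) by (rule set_integral_diff(1)) (rule absolutely_integrable_continuous_real, simp)
qed

lemma ivp_solution_continuous_deriv: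
  assumes "Q absolutely_integrable_on {0..pi}" "ivp_solution Q z u u'"
  shows "continuous_on {0..pi} u'"
proof (rule continuous_on_eq)
  show "continuous_on {0..pi} (\<lambda>x. u' 0 + integral {0..x} (\<lambda>t. (Q t - z) * u t))"
    using potential_mult_absolutely_integrable[OF assms(1) ivp_solution_continuous[OF assms(2)], of z]
    by (intro continuous_on_add continuous_on_const indefinite_integral_continuous_1
        set_lebesgue_integral_eq_integral(1))
qed (rule ivp_solution_deriv_eq[OF assms(2), symmetric])

lemma schroedinger_solution_iff:
  assumes q: "q absolutely_integrable_on {0..pi}"
  shows "schroedinger_solution q z u u' \<longleftrightarrow> ivp_solution (\<lambda>t. of_real (q t)) z u u'"
proof
  assume "schroedinger_solution q z u u'"
  then obtain w where d: "\<forall>x\<in>{0..pi}. (u has_vector_derivative u' x) (at x within {0..pi})"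
    and w: "\<And>x. x \<in> {0..pi} \<Longrightarrow> u' x = u' 0 + integral {0..x} w"
    and ae: "AE x in lebesgue. x \<in> {0<..<pi} \<longrightarrow> - w x + of_real (q x) * u x = z * u x"
    unfolding schroedinger_solution_def absolutely_continuous_with_derivative_def by blast
  obtain N where N: "N \<in> null_sets lebesgue"
      "{x \<in> space lebesgue. \<not> (x \<in> {0<..<pi} \<longrightarrow> - w x + of_real (q x) * u x = z * u x)} \<subseteq> N"
    using ae unfolding eventually_ae_filter by blast
  have eq: "integral {0..x} w = integral {0..x} (\<lambda>t. (of_real (q t) - z) * u t)" if "x \<in> {0..pi}" for x
  proof (rule integral_spike)
    \<comment> \<open>The differential equation is given on the open interval only, so the two
      endpoints join the exceptional set.\<close>
    show "negligible (N \<union> {0, pi})"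
      using N(1) by (simp add: negligible_iff_null_sets)
    fix t assume t: "t \<in> {0..x} - (N \<union> {0, pi})"
    have "- w t + of_real (q t) * u t = z * u t"
    proof (rule ccontr)
      assume "- w t + of_real (q t) * u t \<noteq> z * u t"
      then have "t \<in> N" using t that by (intro subsetD[OF N(2)]) auto
      then show False using t by blast
    qed
    then show "(of_real (q t) - z) * u t = w t"
      by (simp add: algebra_simps)
  qed
  show "ivp_solution (\<lambda>t. of_real (q t)) z u u'"
    unfolding ivp_solution_def
  proof (intro conjI ballI)
    fix x :: real assume x: "x \<in> {0..pi}"
    show "(u has_vector_derivative u' x) (at x within {0..pi})" using d x by blast
    show "u' x = u' 0 + integral {0..x} (\<lambda>t. (of_real (q t) - z) * u t)"
      unfolding eq[OF x, symmetric] by (rule w[OF x])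
  qed
next
  assume a: "ivp_solution (\<lambda>t. of_real (q t)) z u u'"
  have "absolutely_continuous_with_derivative 0 pi u' (\<lambda>t. (of_real (q t) - z) * u t)"
    unfolding absolutely_continuous_with_derivative_def
    using potential_mult_absolutely_integrable[OF absolutely_integrable_of_real[OF q] ivp_solution_continuous[OF a]]
      ivp_solution_deriv_eq[OF a] by blast
  moreover have "- ((of_real (q x) - z) * u x) + of_real (q x) * u x = z * u x" for x
    by (simp add: algebra_simps)
  ultimately show "schroedinger_solution q z u u'"
    using a unfolding schroedinger_solution_def ivp_solution_def by blast
qed

text \<open>Subtracting the product rules for \<open>u * v'\<close> and \<open>u' * v\<close>
  cancels the potential. For \<open>z = w\<close> this is constancy of the Wronskian; for different
  parameters it governs the dependence of solutions on the parameter.\<close>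

lemma wronskian_identity:
  assumes Q: "Q absolutely_integrable_on {0..pi}"
    and u: "ivp_solution Q z u u'" and v: "ivp_solution Q w v v'" and x: "x \<in> {0..pi}"
  shows "u x * v' x - u' x * v x =
    u 0 * v' 0 - u' 0 * v 0 + (z - w) * integral {0..x} (\<lambda>t. u t * v t)"
proof -
  have cu: "continuous_on {0..pi} u" and cv: "continuous_on {0..pi} v"
    and cu': "continuous_on {0..pi} u'" and cv': "continuous_on {0..pi} v'"
    using u v Q by (auto intro: ivp_solution_continuous ivp_solution_continuous_deriv)
  have au: "(\<lambda>t. (Q t - z) * u t) absolutely_integrable_on {0..pi}"
    and av: "(\<lambda>t. (Q t - w) * v t) absolutely_integrable_on {0..pi}"
    by (auto intro: potential_mult_absolutely_integrable Q cu cv)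
  let ?p = "\<lambda>t. u' t * v' t + u t * ((Q t - w) * v t)"
  let ?r = "\<lambda>t. (Q t - z) * u t * v t + u' t * v' t"
  have 1: "u x * v' x = u 0 * v' 0 + integral {0..x} ?p"
    by (rule indefinite_integral_mult[OF absolutely_integrable_continuous_real[OF cu'] av
          ivp_solution_integral[OF u] ivp_solution_deriv_eq[OF v] x])
  have 2: "u' x * v x = u' 0 * v 0 + integral {0..x} ?r"
    by (rule indefinite_integral_mult[OF au absolutely_integrable_continuous_real[OF cv']
          ivp_solution_deriv_eq[OF u] ivp_solution_integral[OF v] x])
  have m: "(\<lambda>t. u' t * v' t) absolutely_integrable_on {0..pi}"
    by (intro absolutely_integrable_continuous_real continuous_on_mult cu' cv')
  have "(\<lambda>t. u t * ((Q t - w) * v t)) absolutely_integrable_on {0..pi}"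
    using absolutely_integrable_mult_continuous[OF av cu] by (subst mult.commute)
  note set_integral_add(1)[OF m this]
    and set_integral_add(1)[OF absolutely_integrable_mult_continuous[OF au cv] m]
  from this[THEN set_lebesgue_integral_eq_integral(1)]
  have "?p integrable_on {0..pi}" "?r integrable_on {0..pi}" .
  from this[THEN integrable_on_subinterval, of 0 x] x
  have "?p integrable_on {0..x}" "?r integrable_on {0..x}"
    by simp_all
  then have "integral {0..x} ?p - integral {0..x} ?r = integral {0..x} (\<lambda>t. ?p t - ?r t)"
    by (rule hk_integral_diff[symmetric])
  also have "(\<lambda>t. ?p t - ?r t) = (\<lambda>t. (z - w) * (u t * v t))"
    by (auto simp: algebra_simps)
  finally show ?thesis
    using 1 2 hk_integral_mult_right[of "{0..x}" "z - w" "\<lambda>t. u t * v t"]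
    by (simp add: diff_eq_eq)
qed

text \<open>If \<open>c\<close>, \<open>s\<close> have Wronskian 1, then \<open>u = c (u s' - u' s) - s (u c' - u' c)\<close>.\<close>
lemma ivp_solution_variation:
  assumes Q: "Q absolutely_integrable_on {0..pi}"
    and u: "ivp_solution Q z u u'" and c: "ivp_solution Q w c c'" and s: "ivp_solution Q w s s'"
    and W: "c 0 * s' 0 - c' 0 * s 0 = 1"
    and x: "x \<in> {0..pi}"
  shows "u x = c x * (u 0 * s' 0 - u' 0 * s 0) - s x * (u 0 * c' 0 - u' 0 * c 0)
    + (z - w) * (c x * integral {0..x} (\<lambda>t. u t * s t) - s x * integral {0..x} (\<lambda>t. u t * c t))"
proof -
  have W1: "c x * s' x - c' x * s x = 1"
    using wronskian_identity[OF Q c s x] W by simp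
  have "u x = u x * (c x * s' x - c' x * s x)" by (simp add: W1)
  also have "\<dots> = c x * (u x * s' x - u' x * s x) - s x * (u x * c' x - u' x * c x)"
    by (simp add: algebra_simps)
  finally show ?thesis
    unfolding wronskian_identity[OF Q u s x] wronskian_identity[OF Q u c x]
    by (simp add: algebra_simps)
qed

lemma ivp_solution_deriv_unique:
  assumes "ivp_solution Q z u u'" "ivp_solution R w v v'" "\<And>x. x \<in> {0..pi} \<Longrightarrow> u x = v x" "x \<in> {0..pi}"
  shows "u' x = v' x"
proof -
  have "(u has_vector_derivative u' x) (at x within {0..pi})" "(v has_vector_derivative v' x) (at x within {0..pi})"
    using assms ivp_solution_has_vector_derivative by blast+
  moreover from this(2) have "(u has_vector_derivative v' x) (at x within {0..pi})"
    by (rule has_vector_derivative_transform[rotated 2]) (use assms(3,4) in auto)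
  ultimately show ?thesis
    using assms(4) vector_derivative_unique_within_closed_interval[of 0 pi x u "u' x" "v' x"] by simp
qed

section \<open>Volterra iteration\<close>

text \<open>\<open>c\<close> and \<open>s\<close> are the solutions of the free equation with data
  \<open>(1, 0)\<close> and \<open>(0, 1)\<close>; since \<open>s' = c\<close> and
  \<open>c' = - z * s\<close>, the assumption \<open>pythagoras\<close> is their Wronskian relation.
  \<open>\<tau>\<close> is the exponential growth rate and \<open>B\<close> the size of the kernel,
  kept apart so that the iteration preserves the exact rate.\<close>

locale volterra_equation =
  fixes Q c s :: "real \<Rightarrow> complex" and z :: complex and \<tau> B :: real
  assumes Q: "Q absolutely_integrable_on {0..pi}"
    and c_int: "\<And>x. x \<in> {0..pi} \<Longrightarrow> c x = 1 + integral {0..x} (\<lambda>t. - z * s t)"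
    and s_int: "\<And>x. x \<in> {0..pi} \<Longrightarrow> s x = integral {0..x} c"
    and c_cont: "continuous_on {0..pi} c" and s_cont: "continuous_on {0..pi} s"
    and pythagoras: "\<And>x. x \<in> {0..pi} \<Longrightarrow> c x * c x + z * (s x * s x) = 1"
    and kernel_bound: "\<And>x t. \<lbrakk>0 \<le> t; t \<le> x; x \<le> pi\<rbrakk> \<Longrightarrow> norm (s x * c t - c x * s t) \<le> B * exp (\<tau> * (x - t))"
    and tau_nonneg: "\<tau> \<ge> 0" and B_nonneg: "B \<ge> 0"
begin

text \<open>The variation of constants operator: as a function of \<open>x\<close> the kernel is the
  free solution that starts at \<open>t\<close> with value 0 and slope 1, so
  \<open>u = f + V u\<close> treats \<open>Q * u\<close> as a source term.\<close>

definition V :: "(real \<Rightarrow> complex) \<Rightarrow> real \<Rightarrow> complex" where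
  "V g x = integral {0..x} (\<lambda>t. (s x * c t - c x * s t) * (Q t * g t))"

definition L :: "real \<Rightarrow> real" where
  "L x = integral {0..x} (\<lambda>t. norm (Q t))"

lemma norm_Q: "(\<lambda>t. norm (Q t)) absolutely_integrable_on {0..pi}"
  using Q by (rule absolutely_integrable_norm[unfolded o_def])

lemma L_nonneg: "x \<in> {0..pi} \<Longrightarrow> L x \<ge> 0"
  unfolding L_def
  by (rule hk_integral_nonneg, rule integrable_on_subinterval)
    (use set_lebesgue_integral_eq_integral(1)[OF norm_Q] in auto)

lemma L_mono: "x \<in> {0..pi} \<Longrightarrow> L x \<le> L pi"
  unfolding L_def
  by (rule hk_integral_subset_le)
    (use set_lebesgue_integral_eq_integral(1)[OF norm_Q] in \<open>auto intro: integrable_on_subinterval\<close>)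

lemma L_cont: "continuous_on {0..pi} L"
  unfolding L_def
  by (rule indefinite_integral_continuous_1) (rule set_lebesgue_integral_eq_integral(1)[OF norm_Q])

lemma Q_mult:
  assumes "continuous_on {0..pi} g" "continuous_on {0..pi} h"
  shows "(\<lambda>t. h t * (Q t * g t)) absolutely_integrable_on {0..pi}"
proof -
  have "(\<lambda>t. Q t * (h t * g t)) absolutely_integrable_on {0..pi}"
    by (intro absolutely_integrable_mult_continuous Q continuous_on_mult assms)
  then show ?thesis by (simp add: mult.left_commute)
qed

lemma integrable_initial:
  fixes f :: "real \<Rightarrow> 'a::euclidean_space"
  assumes "f absolutely_integrable_on {0..pi}" "x \<in> {0..pi}"
  shows "f integrable_on {0..x}"
  using set_lebesgue_integral_eq_integral(1)[OF assms(1)] by (rule integrable_on_subinterval) (use assms(2) in auto)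

text \<open>Pulling \<open>x\<close> out of the integrand turns \<open>V g\<close> into products of
  \<open>s\<close> and \<open>c\<close> with indefinite integrals, to which continuity arguments and
  the product rule apply.\<close>

lemma V_split:
  assumes g: "continuous_on {0..pi} g" and x: "x \<in> {0..pi}"
  shows "V g x = s x * integral {0..x} (\<lambda>t. c t * (Q t * g t)) - c x * integral {0..x} (\<lambda>t. s t * (Q t * g t))"
proof -
  have "V g x = integral {0..x} (\<lambda>t. s x * (c t * (Q t * g t)) - c x * (s t * (Q t * g t)))"
    unfolding V_def by (rule arg_cong[where f = "integral {0..x}"]) (auto simp: algebra_simps)
  also have "\<dots> = integral {0..x} (\<lambda>t. s x * (c t * (Q t * g t))) - integral {0..x} (\<lambda>t. c x * (s t * (Q t * g t)))"
    by (intro hk_integral_diff integrable_on_mult_right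
        integrable_initial[OF Q_mult x] g c_cont s_cont)
  finally show ?thesis by simp
qed

lemma V_cont:
  assumes g: "continuous_on {0..pi} g"
  shows "continuous_on {0..pi} (V g)"
proof (rule continuous_on_eq)
  show "continuous_on {0..pi} (\<lambda>x. s x * integral {0..x} (\<lambda>t. c t * (Q t * g t)) - c x * integral {0..x} (\<lambda>t. s t * (Q t * g t)))"
    by (intro continuous_on_diff continuous_on_mult s_cont c_cont indefinite_integral_continuous_1
        set_lebesgue_integral_eq_integral(1)[OF Q_mult] g)
qed (simp add: V_split[OF g])

text \<open>The exponentials \<open>exp (\<tau> * (x - t))\<close> and
  \<open>exp (\<tau> * t)\<close> multiply to a factor independent of \<open>t\<close>. What remains
  is \<open>L ^ n\<close> integrated against its own density, so each application of
  \<open>V\<close> gains \<open>B * L x / Suc n\<close> and keeps the growth rate.\<close>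

lemma V_bound:
  assumes g: "continuous_on {0..pi} g" and x: "x \<in> {0..pi}" and M: "M \<ge> 0"
    and b: "\<And>t. t \<in> {0..pi} \<Longrightarrow> norm (g t) \<le> M * exp (\<tau> * t) * L t ^ n"
  shows "norm (V g x) \<le> B * M * exp (\<tau> * x) * (L x ^ Suc n / real (Suc n))"
proof -
  have "norm (V g x) \<le> integral {0..x} (\<lambda>t. (B * M * exp (\<tau> * x)) * (norm (Q t) * L t ^ n))"
    unfolding V_def
  proof (rule hk_integral_norm_bound_integral)
    show "(\<lambda>t. (s x * c t - c x * s t) * (Q t * g t)) integrable_on {0..x}"
      by (intro integrable_initial[OF Q_mult x] continuous_intros g c_cont s_cont)
    show "(\<lambda>t. (B * M * exp (\<tau> * x)) * (norm (Q t) * L t ^ n)) integrable_on {0..x}"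
      by (intro integrable_on_mult_right integrable_initial[OF _ x] absolutely_integrable_mult_continuous
          norm_Q continuous_intros L_cont)
    fix t assume t: "t \<in> {0..x}"
    have "norm ((s x * c t - c x * s t) * (Q t * g t)) =
        norm (Q t) * (norm (s x * c t - c x * s t) * norm (g t))"
      by (simp add: norm_mult)
    also have "\<dots> \<le> norm (Q t) * ((B * exp (\<tau> * (x - t))) * (M * exp (\<tau> * t) * L t ^ n))"
      using t x M B_nonneg by (intro mult_left_mono mult_mono kernel_bound b) auto
    also have "\<dots> = (B * M * (exp (\<tau> * (x - t)) * exp (\<tau> * t))) * (norm (Q t) * L t ^ n)"
      by simp
    also have "exp (\<tau> * (x - t)) * exp (\<tau> * t) = exp (\<tau> * x)"
      by (simp add: exp_add[symmetric] algebra_simps)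
    finally show "norm ((s x * c t - c x * s t) * (Q t * g t)) \<le> (B * M * exp (\<tau> * x)) * (norm (Q t) * L t ^ n)" .
  qed
  also have "\<dots> = (B * M * exp (\<tau> * x)) * (L x ^ Suc n / real (Suc n))"
    using indefinite_integral_power[OF norm_Q x, of n] unfolding L_def by simp
  finally show ?thesis .
qed

lemma V_diff:
  assumes "continuous_on {0..pi} g" "continuous_on {0..pi} h" "x \<in> {0..pi}"
  shows "V (\<lambda>t. g t - h t) x = V g x - V h x"
proof -
  have "(\<lambda>t. (s x * c t - c x * s t) * (Q t * r t)) integrable_on {0..x}" if "continuous_on {0..pi} r" for r
    by (intro integrable_initial[OF Q_mult] continuous_intros c_cont s_cont assms that)
  from hk_integral_diff[OF this[OF assms(1)] this[OF assms(2)]]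
  show ?thesis unfolding V_def by (simp add: right_diff_distrib)
qed

lemma V_sum:
  fixes n :: nat
  assumes "\<And>i. i < n \<Longrightarrow> continuous_on {0..pi} (g i)" "x \<in> {0..pi}"
  shows "V (\<lambda>t. \<Sum>i<n. g i t) x = (\<Sum>i<n. V (g i) x)"
  unfolding V_def
  unfolding sum_distrib_left
  by (rule hk_integral_sum)
    (auto intro!: integrable_initial[OF Q_mult] continuous_intros c_cont s_cont assms)

text \<open>Neumann series: by \<open>V_bound\<close> the term \<open>V ^^ n\<close> applied to
  \<open>f\<close> is dominated by the \<open>n\<close>-th term of \<open>exp (B * L x)\<close>,
  which gives uniform convergence and the bound at once. \<open>V\<close> is continuous under
  uniform convergence, so the limit may be taken inside it.\<close>

lemma solvable:
  assumes f: "continuous_on {0..pi} f" and M: "M \<ge> 0"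
    and fb: "\<And>x. x \<in> {0..pi} \<Longrightarrow> norm (f x) \<le> M * exp (\<tau> * x)"
  obtains u where "continuous_on {0..pi} u" "\<And>x. x \<in> {0..pi} \<Longrightarrow> u x = f x + V u x"
    "\<And>x. x \<in> {0..pi} \<Longrightarrow> norm (u x) \<le> M * exp (\<tau> * x) * exp (B * L x)"
proof -
  define v where "v n = (V ^^ n) f" for n
  have v_simps: "v 0 = f" "\<And>n. v (Suc n) = V (v n)"
    by (auto simp: v_def)
  have vc: "continuous_on {0..pi} (v n)" for n
    by (induction n) (auto simp: v_simps f V_cont)
  have vb: "norm (v n x) \<le> M * B ^ n / fact n * exp (\<tau> * x) * L x ^ n" if "x \<in> {0..pi}" for n x
    using that
  proof (induction n arbitrary: x)
    case (Suc n)
    have "norm (V (v n) x) \<le> B * (M * B ^ n / fact n) * exp (\<tau> * x) * (L x ^ Suc n / real (Suc n))"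
      by (rule V_bound) (use Suc vc M B_nonneg in auto)
    then show ?case by (simp add: v_simps field_simps)
  qed (auto simp: v_simps fb)
  have vb': "norm (v n x) \<le> M * exp (\<tau> * x) * ((B * L x) ^ n / fact n)" if "x \<in> {0..pi}" for n x
    using vb[OF that, of n] by (simp add: power_mult_distrib field_simps)
  have ex: "(\<lambda>n. (B * L x) ^ n / fact n) sums exp (B * L x)" for x
    using exp_converges[of "B * L x"] by (simp add: divide_inverse_commute)
  define u where "u x = (\<Sum>n. v n x)" for x
  have ul: "uniform_limit {0..pi} (\<lambda>n x. \<Sum>i<n. v i x) u sequentially"
    unfolding u_def
  proof (rule Weierstrass_m_test)
    show "summable (\<lambda>n. M * exp (\<tau> * pi) * ((B * L pi) ^ n / fact n))"
      by (intro summable_mult sums_summable[OF ex])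
    fix n x assume x: "x \<in> {0..pi}"
    have "M * exp (\<tau> * x) * ((B * L x) ^ n / fact n) \<le> M * exp (\<tau> * pi) * ((B * L pi) ^ n / fact n)"
      using x M B_nonneg tau_nonneg L_nonneg[OF x] L_mono[OF x]
      by (intro mult_mono divide_right_mono power_mono) (auto intro: mult_left_mono)
    with vb'[OF x, of n] show "norm (v n x) \<le> M * exp (\<tau> * pi) * ((B * L pi) ^ n / fact n)"
      by linarith
  qed
  have uc: "continuous_on {0..pi} u"
    by (rule uniform_limit_theorem[OF _ ul]) (auto intro!: always_eventually continuous_intros vc)
  show ?thesis
  proof
    show "continuous_on {0..pi} u" by (rule uc)
    fix x assume x: "x \<in> {0..pi}"
    have "norm (u x) \<le> (\<Sum>n. M * exp (\<tau> * x) * ((B * L x) ^ n / fact n))"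
      unfolding u_def
      by (rule norm_suminf_le) (intro vb'[OF x] summable_mult sums_summable[OF ex])+
    also have "\<dots> = M * exp (\<tau> * x) * exp (B * L x)"
      by (intro sums_unique[symmetric] sums_mult ex)
    finally show "norm (u x) \<le> M * exp (\<tau> * x) * exp (B * L x)" .
    have lim: "(\<lambda>n. \<Sum>i<n. v i x) \<longlonglongrightarrow> u x"
      by (rule tendsto_uniform_limitI[OF ul x])
    have "(\<lambda>n. V (\<lambda>t. \<Sum>i<n. v i t) x) \<longlonglongrightarrow> V u x"
    proof (rule LIMSEQ_I)
      fix r :: real assume r: "r > 0"
      define e where "e = r / (B * exp (\<tau> * x) * L x + 1)"
      have D: "B * exp (\<tau> * x) * L x \<ge> 0"
        using B_nonneg L_nonneg[OF x] by simp
      then have e: "e > 0" using r by (simp add: e_def add_nonneg_pos)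
      obtain N where N: "\<And>n t. n \<ge> N \<Longrightarrow> t \<in> {0..pi} \<Longrightarrow> dist (\<Sum>i<n. v i t) (u t) < e"
        using uniform_limitD[OF ul e] unfolding eventually_sequentially by blast
      have "norm (V (\<lambda>t. \<Sum>i<n. v i t) x - V u x) < r" if "n \<ge> N" for n
      proof -
        have cs: "continuous_on {0..pi} (\<lambda>t. \<Sum>i<n. v i t)"
          by (intro continuous_intros vc)
        \<comment> \<open>\<open>V_bound\<close> with \<open>n = 0\<close>: a uniform error
          \<open>e\<close> is also an error in the weighted sense, because
          \<open>exp (\<tau> * t)\<close> is at least 1.\<close>
        have "norm (V (\<lambda>t. (\<Sum>i<n. v i t) - u t) x) \<le> B * e * exp (\<tau> * x) * (L x ^ Suc 0 / real (Suc 0))"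
        proof (rule V_bound)
          fix t assume t: "t \<in> {0..pi}"
          have "1 \<le> exp (\<tau> * t)" using t tau_nonneg by simp
          then have "e \<le> e * exp (\<tau> * t)" using e by simp
          then show "norm ((\<Sum>i<n. v i t) - u t) \<le> e * exp (\<tau> * t) * L t ^ 0"
            using N[OF that t] by (simp add: dist_norm)
        qed (use e x cs uc in \<open>auto intro!: continuous_intros\<close>)
        also have "\<dots> = e * (B * exp (\<tau> * x) * L x)" by simp
        also have "\<dots> < e * (B * exp (\<tau> * x) * L x + 1)" using e by simp
        also have "\<dots> = r" using D by (simp add: e_def)
        finally show ?thesis by (simp add: V_diff[OF cs uc x])
      qed
      then show "\<exists>N. \<forall>n\<ge>N. norm (V (\<lambda>t. \<Sum>i<n. v i t) x - V u x) < r" by blast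
    qed
    then have "(\<lambda>n. f x + V (\<lambda>t. \<Sum>i<n. v i t) x) \<longlonglongrightarrow> f x + V u x"
      by (intro tendsto_intros)
    moreover have "f x + V (\<lambda>t. \<Sum>i<n. v i t) x = (\<Sum>i<Suc n. v i x)" for n
      by (simp add: V_sum[OF vc x] v_simps[symmetric] sum.lessThan_Suc_shift del: sum.lessThan_Suc)
    ultimately have "(\<lambda>n. \<Sum>i<Suc n. v i x) \<longlonglongrightarrow> f x + V u x" by simp
    then have "(\<lambda>n. \<Sum>i<n. v i x) \<longlonglongrightarrow> f x + V u x"
      by (rule LIMSEQ_imp_Suc)
    with lim show "u x = f x + V u x" by (rule LIMSEQ_unique)
  qed
qed

lemma free_solution:
  assumes x: "x \<in> {0..pi}"
  shows "((\<lambda>x. \<alpha> * c x + \<beta> * s x) has_vector_derivative \<beta> * c x - z * \<alpha> * s x) (at x within {0..pi})"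
    and "\<beta> * c x - z * \<alpha> * s x = \<beta> + integral {0..x} (\<lambda>t. - z * (\<alpha> * c t + \<beta> * s t))"
proof -
  have "((\<lambda>x. 1 + integral {0..x} (\<lambda>t. - z * s t)) has_vector_derivative 0 + - z * s x) (at x within {0..pi})"
    by (intro has_vector_derivative_add has_vector_derivative_const integral_has_vector_derivative
        continuous_intros s_cont x)
  then have "((\<lambda>x. 1 + integral {0..x} (\<lambda>t. - z * s t)) has_vector_derivative - z * s x) (at x within {0..pi})"
    by simp
  then have dc: "(c has_vector_derivative - z * s x) (at x within {0..pi})"
    by (rule has_vector_derivative_transform[OF x, rotated 1]) (simp_all add: c_int)
  have "((\<lambda>x. integral {0..x} c) has_vector_derivative c x) (at x within {0..pi})"
    by (intro integral_has_vector_derivative c_cont x)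
  then have ds: "(s has_vector_derivative c x) (at x within {0..pi})"
    by (rule has_vector_derivative_transform[OF x, rotated 1]) (simp_all add: s_int)
  show "((\<lambda>x. \<alpha> * c x + \<beta> * s x) has_vector_derivative \<beta> * c x - z * \<alpha> * s x) (at x within {0..pi})"
  proof -
    have "((\<lambda>x. \<alpha> * c x + \<beta> * s x) has_vector_derivative \<alpha> * (- z * s x) + \<beta> * c x) (at x within {0..pi})"
      by (intro has_vector_derivative_add has_vector_derivative_mult_right dc ds)
    then show ?thesis by (simp add: mult.left_commute mult.assoc)
  qed
  have i: "s integrable_on {0..x}" "c integrable_on {0..x}"
    using x by (auto intro!: integrable_continuous_interval intro: continuous_on_subset[OF s_cont] continuous_on_subset[OF c_cont])
  have cx: "c x = 1 - z * integral {0..x} s" using c_int[OF x] by simp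
  have "integral {0..x} (\<lambda>t. - z * (\<alpha> * c t + \<beta> * s t)) = - z * (\<alpha> * integral {0..x} c + \<beta> * integral {0..x} s)"
    unfolding hk_integral_mult_right
    using i by (subst hk_integral_add) (auto intro!: integrable_on_mult_right)
  then show "\<beta> * c x - z * \<alpha> * s x = \<beta> + integral {0..x} (\<lambda>t. - z * (\<alpha> * c t + \<beta> * s t))"
    by (simp add: s_int[OF x, symmetric] cx algebra_simps)
qed

text \<open>Here \<open>V u = s * I - c * J\<close>. As in variation of constants, the derivatives
  of \<open>I\<close> and \<open>J\<close> cancel in the first derivative \<open>w\<close> of
  \<open>V u\<close>; in the second derivative they combine to \<open>Q * u\<close> by the Wronskian
  relation. Both differentiations are carried out in integrated form.\<close>

lemma ivp_solution_of_volterra: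
  assumes uc: "continuous_on {0..pi} u"
    and u: "\<And>x. x \<in> {0..pi} \<Longrightarrow> u x = \<alpha> * c x + \<beta> * s x + V u x"
  shows "\<exists>u'. ivp_solution Q z u u' \<and> u 0 = \<alpha> \<and> u' 0 = \<beta>"
proof -
  define I where "I x = integral {0..x} (\<lambda>t. c t * (Q t * u t))" for x
  define J where "J x = integral {0..x} (\<lambda>t. s t * (Q t * u t))" for x
  have ai: "(\<lambda>t. c t * (Q t * u t)) absolutely_integrable_on {0..pi}"
    and aj: "(\<lambda>t. s t * (Q t * u t)) absolutely_integrable_on {0..pi}"
    by (intro Q_mult uc c_cont s_cont)+
  have Ic: "continuous_on {0..pi} I" and Jc: "continuous_on {0..pi} J"
    unfolding I_def J_def
    by (intro indefinite_integral_continuous_1 set_lebesgue_integral_eq_integral(1)[OF ai]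
        set_lebesgue_integral_eq_integral(1)[OF aj])+
  have zero: "c 0 = 1" "s 0 = 0" "I 0 = 0" "J 0 = 0"
    using c_int[of 0] s_int[of 0] by (auto simp: I_def J_def)
  have c_rel: "\<And>y. y \<in> {0..pi} \<Longrightarrow> c y = c 0 + integral {0..y} (\<lambda>t. - z * s t)"
    and s_rel: "\<And>y. y \<in> {0..pi} \<Longrightarrow> s y = s 0 + integral {0..y} c"
    and I_rel: "\<And>y. y \<in> {0..pi} \<Longrightarrow> I y = I 0 + integral {0..y} (\<lambda>t. c t * (Q t * u t))"
    and J_rel: "\<And>y. y \<in> {0..pi} \<Longrightarrow> J y = J 0 + integral {0..y} (\<lambda>t. s t * (Q t * u t))"
    using c_int s_int by (auto simp: zero I_def J_def)
  have ac: "c absolutely_integrable_on {0..pi}" and as: "(\<lambda>t. - z * s t) absolutely_integrable_on {0..pi}"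
    by (intro absolutely_integrable_continuous_real continuous_intros c_cont s_cont)+
  define w where "w x = c x * I x + z * s x * J x" for x
  have wc: "continuous_on {0..pi} w"
    unfolding w_def by (intro continuous_intros Ic Jc c_cont s_cont)
  have aux: "(\<lambda>t. g t * (c t * (Q t * u t))) integrable_on {0..x}" "(\<lambda>t. g t * (s t * (Q t * u t))) integrable_on {0..x}"
    "g integrable_on {0..x}"
    if "continuous_on {0..pi} g" "x \<in> {0..pi}" for g x
    using that set_lebesgue_integral_eq_integral(1)[OF absolutely_integrable_mult_continuous[OF ai that(1)]]
      set_lebesgue_integral_eq_integral(1)[OF absolutely_integrable_mult_continuous[OF aj that(1)]]
    by (auto intro: integrable_on_subinterval integrable_continuous_interval continuous_on_subset simp: mult.commute)
  have Vw: "V u x = integral {0..x} w" if x: "x \<in> {0..pi}" for x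
  proof -
    have 1: "s x * I x = integral {0..x} (\<lambda>t. c t * I t + s t * (c t * (Q t * u t)))"
      using indefinite_integral_mult[OF ac ai s_rel I_rel x] by (simp add: zero)
    have 2: "c x * J x = integral {0..x} (\<lambda>t. - z * s t * J t + c t * (s t * (Q t * u t)))"
      using indefinite_integral_mult[OF as aj c_rel J_rel x] by (simp add: zero)
    have "V u x = s x * I x - c x * J x"
      using V_split[OF uc x] by (simp add: I_def J_def)
    also have "\<dots> = integral {0..x} (\<lambda>t. (c t * I t + s t * (c t * (Q t * u t))) - (- z * s t * J t + c t * (s t * (Q t * u t))))"
      unfolding 1 2
      by (rule hk_integral_diff[symmetric])
        (intro integrable_add aux x continuous_intros c_cont s_cont Ic Jc)+
    also have "\<dots> = integral {0..x} w"
      by (rule arg_cong[where f = "integral {0..x}"]) (auto simp: w_def algebra_simps)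
    finally show ?thesis .
  qed
  have wz: "w x = integral {0..x} (\<lambda>t. Q t * u t - z * (V u t))" if x: "x \<in> {0..pi}" for x
  proof -
    have 1: "c x * I x = integral {0..x} (\<lambda>t. - z * s t * I t + c t * (c t * (Q t * u t)))"
      using indefinite_integral_mult[OF as ai c_rel I_rel x] by (simp add: zero)
    have 2: "s x * J x = integral {0..x} (\<lambda>t. c t * J t + s t * (s t * (Q t * u t)))"
      using indefinite_integral_mult[OF ac aj s_rel J_rel x] by (simp add: zero)
    have "w x = c x * I x + z * (s x * J x)" by (simp add: w_def)
    also have "\<dots> = integral {0..x} (\<lambda>t. (- z * s t * I t + c t * (c t * (Q t * u t))) + z * (c t * J t + s t * (s t * (Q t * u t))))"
      unfolding 1 2 hk_integral_mult_right[symmetric]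
      by (rule hk_integral_add[symmetric])
        (intro integrable_on_mult_right integrable_add aux x continuous_intros c_cont s_cont Ic Jc)+
    also have "\<dots> = integral {0..x} (\<lambda>t. Q t * u t - z * (V u t))"
    proof (rule hk_integral_cong)
      fix t assume "t \<in> {0..x}"
      then have t: "t \<in> {0..pi}" using x by auto
      have "(- z * s t * I t + c t * (c t * (Q t * u t))) + z * (c t * J t + s t * (s t * (Q t * u t)))
          = (c t * c t + z * (s t * s t)) * (Q t * u t) - z * (s t * I t - c t * J t)"
        by (simp add: algebra_simps)
      then show "(- z * s t * I t + c t * (c t * (Q t * u t))) + z * (c t * J t + s t * (s t * (Q t * u t)))
          = Q t * u t - z * (V u t)"
        using V_split[OF uc t] pythagoras[OF t] by (simp add: I_def J_def)
    qed
    finally show ?thesis .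
  qed
  define u' where "u' x = \<beta> * c x - z * \<alpha> * s x + w x" for x
  have "ivp_solution Q z u u'"
    unfolding ivp_solution_def
  proof (intro conjI ballI)
    fix x :: real assume x: "x \<in> {0..pi}"
    have "((\<lambda>x. \<alpha> * c x + \<beta> * s x + integral {0..x} w) has_vector_derivative u' x) (at x within {0..pi})"
      unfolding u'_def
      by (intro has_vector_derivative_add free_solution(1) x integral_has_vector_derivative wc)
    then show "(u has_vector_derivative u' x) (at x within {0..pi})"
      by (rule has_vector_derivative_transform[OF x, rotated 1]) (simp add: u Vw)
    have Vc: "continuous_on {0..pi} (V u)" by (rule V_cont[OF uc])
    have qi: "(\<lambda>t. Q t * u t) integrable_on {0..x}"
      using integrable_initial[OF absolutely_integrable_mult_continuous[OF Q uc] x] .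
    have fi: "(\<lambda>t. - z * (\<alpha> * c t + \<beta> * s t)) integrable_on {0..x}" "(\<lambda>t. z * V u t) integrable_on {0..x}"
      by (intro aux x continuous_intros c_cont s_cont Vc)+
    have "u' x = \<beta> + (integral {0..x} (\<lambda>t. - z * (\<alpha> * c t + \<beta> * s t)) + integral {0..x} (\<lambda>t. Q t * u t - z * V u t))"
      unfolding u'_def free_solution(2)[OF x] wz[OF x] by simp
    also have "integral {0..x} (\<lambda>t. - z * (\<alpha> * c t + \<beta> * s t)) + integral {0..x} (\<lambda>t. Q t * u t - z * V u t)
        = integral {0..x} (\<lambda>t. - z * (\<alpha> * c t + \<beta> * s t) + (Q t * u t - z * V u t))"
      by (rule hk_integral_add[symmetric]) (intro integrable_diff qi fi)+
    also have "\<dots> = integral {0..x} (\<lambda>t. (Q t - z) * u t)"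
    proof (rule hk_integral_cong)
      fix t assume "t \<in> {0..x}"
      then have "t \<in> {0..pi}" using x by auto
      from u[OF this] have "Q t * u t - z * (\<alpha> * c t + \<beta> * s t + V u t) = (Q t - z) * u t"
        by (simp only: left_diff_distrib)
      moreover have "- z * f + (Q t * u t - z * v) = Q t * u t - z * (f + v)" for f v
        by algebra
      ultimately show "- z * (\<alpha> * c t + \<beta> * s t) + (Q t * u t - z * V u t) = (Q t - z) * u t"
        by (simp only:)
    qed
    finally show "u' x = u' 0 + integral {0..x} (\<lambda>t. (Q t - z) * u t)"
      by (simp add: u'_def zero w_def)
  qed
  moreover have "u 0 = \<alpha>" "u' 0 = \<beta>"
    using u[of 0] by (auto simp: zero u'_def w_def V_def)
  ultimately show ?thesis by blast
qed

lemma ivp_solvable: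
  assumes M: "M \<ge> 0" and fb: "\<And>x. x \<in> {0..pi} \<Longrightarrow> norm (\<alpha> * c x + \<beta> * s x) \<le> M * exp (\<tau> * x)"
  obtains u u' where "ivp_solution Q z u u'" "u 0 = \<alpha>" "u' 0 = \<beta>"
    "\<And>x. x \<in> {0..pi} \<Longrightarrow> u x = \<alpha> * c x + \<beta> * s x + V u x"
    "\<And>x. x \<in> {0..pi} \<Longrightarrow> norm (u x) \<le> M * exp (\<tau> * x) * exp (B * L x)"
proof -
  have "continuous_on {0..pi} (\<lambda>x. \<alpha> * c x + \<beta> * s x)"
    by (intro continuous_intros c_cont s_cont)
  from solvable[OF this M fb] obtain u where u: "continuous_on {0..pi} u"
    "\<And>x. x \<in> {0..pi} \<Longrightarrow> u x = \<alpha> * c x + \<beta> * s x + V u x"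
    "\<And>x. x \<in> {0..pi} \<Longrightarrow> norm (u x) \<le> M * exp (\<tau> * x) * exp (B * L x)"
    by metis
  obtain u' where "ivp_solution Q z u u'" "u 0 = \<alpha>" "u' 0 = \<beta>"
    using ivp_solution_of_volterra[OF u(1,2)] by blast
  from that[OF this u(2,3)] show ?thesis .
qed

end

section \<open>Comparison with the trigonometric solutions of the free equation\<close>

lemma norm_sin_le_exp: "norm (sin w) \<le> exp \<bar>Im w\<bar>" for w :: complex
proof -
  have "norm (sin w) = norm (exp (\<i> * w) - exp (- (\<i> * w))) / 2"
    by (simp add: sin_exp_eq norm_divide norm_mult)
  also have "\<dots> \<le> (norm (exp (\<i> * w)) + norm (exp (- (\<i> * w)))) / 2"
    by (intro divide_right_mono norm_triangle_ineq4) simp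
  also have "\<dots> \<le> (exp \<bar>Im w\<bar> + exp \<bar>Im w\<bar>) / 2"
    by (intro divide_right_mono add_mono) auto
  finally show ?thesis by simp
qed

lemma norm_cos_le_exp: "norm (cos w) \<le> exp \<bar>Im w\<bar>" for w :: complex
proof -
  have "norm (cos w) = norm (exp (\<i> * w) + exp (- (\<i> * w))) / 2"
    by (simp add: cos_exp_eq norm_divide norm_mult)
  also have "\<dots> \<le> (norm (exp (\<i> * w)) + norm (exp (- (\<i> * w)))) / 2"
    by (intro divide_right_mono norm_triangle_ineq) simp
  also have "\<dots> \<le> (exp \<bar>Im w\<bar> + exp \<bar>Im w\<bar>) / 2"
    by (intro divide_right_mono add_mono) auto
  finally show ?thesis by simp
qed

lemma trigonometric_kernel:
  assumes "k \<noteq> 0"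
  shows "sin (k * of_real x) / k * cos (k * of_real t) - cos (k * of_real x) * (sin (k * of_real t) / k)
    = sin (k * of_real (x - t)) / (k::complex)"
  using assms by (simp add: right_diff_distrib sin_diff field_simps)

text \<open>By the subtraction formula the kernel is \<open>sin (k * (x - t)) / k\<close>, so
  \<open>B = 1 / norm k\<close>: every occurrence of the potential in the expansion costs one power
  of \<open>k\<close>.\<close>

lemma volterra_equation_trigonometric:
  assumes Q: "Q absolutely_integrable_on {0..pi}" and k: "k \<noteq> 0"
  shows "volterra_equation Q (\<lambda>x. cos (k * of_real x)) (\<lambda>x. sin (k * of_real x) / k) (k\<^sup>2) \<bar>Im k\<bar> (1 / norm k)"
proof
  fix x :: real assume x: "x \<in> {0..pi}"
  have "((\<lambda>t. - k\<^sup>2 * (sin (k * of_real t) / k)) has_integral cos (k * of_real x) - cos (k * of_real 0)) {0..x}"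
    by (rule fundamental_theorem_of_calculus)
      (use x k in \<open>auto intro!: derivative_eq_intros has_vector_derivative_real_field simp: power2_eq_square\<close>)
  from integral_unique[OF this]
  show "cos (k * of_real x) = 1 + integral {0..x} (\<lambda>t. - k\<^sup>2 * (sin (k * of_real t) / k))"
    by (simp only: of_real_0 mult_zero_right cos_zero) simp
  have "((\<lambda>t. cos (k * of_real t)) has_integral sin (k * of_real x) / k - sin (k * of_real 0) / k) {0..x}"
    by (rule fundamental_theorem_of_calculus)
      (use x k in \<open>auto intro!: derivative_eq_intros has_vector_derivative_real_field\<close>)
  from integral_unique[OF this]
  show "sin (k * of_real x) / k = integral {0..x} (\<lambda>t. cos (k * of_real t))"
    by simp
  show "cos (k * of_real x) * cos (k * of_real x) + k\<^sup>2 * (sin (k * of_real x) / k * (sin (k * of_real x) / k)) = 1"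
    using k sin_cos_squared_add[of "k * of_real x"] by (simp add: power2_eq_square add.commute)
next
  fix x t :: real assume xt: "0 \<le> t" "t \<le> x" "x \<le> pi"
  have "norm (sin (k * of_real (x - t)) / k) \<le> exp \<bar>Im (k * of_real (x - t))\<bar> / norm k"
    unfolding norm_divide by (intro divide_right_mono norm_sin_le_exp) simp
  then show "norm (sin (k * of_real x) / k * cos (k * of_real t) - cos (k * of_real x) * (sin (k * of_real t) / k))
      \<le> 1 / norm k * exp (\<bar>Im k\<bar> * (x - t))"
    unfolding trigonometric_kernel[OF k] using xt by (simp add: abs_mult)
qed (use Q k in \<open>auto intro!: continuous_intros\<close>)

lemma ivp_exists_nonzero:
  assumes Q: "Q absolutely_integrable_on {0..pi}" and k: "k \<noteq> 0"
  obtains u u' where "ivp_solution Q (k\<^sup>2) u u'" "u 0 = \<alpha>" "u' 0 = \<beta>"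
    "\<And>x. x \<in> {0..pi} \<Longrightarrow> u x = \<alpha> * cos (k * of_real x) + \<beta> * (sin (k * of_real x) / k)
        + integral {0..x} (\<lambda>t. sin (k * of_real (x - t)) / k * (Q t * u t))"
    "\<And>x. x \<in> {0..pi} \<Longrightarrow> norm (u x) \<le> (norm \<alpha> + norm \<beta> / norm k) * exp (\<bar>Im k\<bar> * x)
        * exp (integral {0..pi} (\<lambda>t. norm (Q t)) / norm k)"
proof -
  interpret volterra_equation Q "\<lambda>x. cos (k * of_real x)" "\<lambda>x. sin (k * of_real x) / k" "k\<^sup>2" "\<bar>Im k\<bar>" "1 / norm k"
    by (rule volterra_equation_trigonometric[OF Q k])
  have f: "norm (\<alpha> * cos (k * of_real x) + \<beta> * (sin (k * of_real x) / k))
      \<le> (norm \<alpha> + norm \<beta> / norm k) * exp (\<bar>Im k\<bar> * x)" if "x \<in> {0..pi}" for x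
  proof -
    have "norm (\<alpha> * cos (k * of_real x) + \<beta> * (sin (k * of_real x) / k))
        \<le> norm \<alpha> * norm (cos (k * of_real x)) + norm \<beta> * (norm (sin (k * of_real x)) / norm k)"
      by (intro order_trans[OF norm_triangle_ineq]) (simp add: norm_mult norm_divide)
    also have "\<dots> \<le> norm \<alpha> * exp \<bar>Im (k * of_real x)\<bar> + norm \<beta> * (exp \<bar>Im (k * of_real x)\<bar> / norm k)"
      by (intro add_mono mult_left_mono divide_right_mono norm_sin_le_exp norm_cos_le_exp) auto
    finally show ?thesis using that by (simp add: abs_mult algebra_simps)
  qed
  have M: "norm \<alpha> + norm \<beta> / norm k \<ge> 0" by simp
  obtain u u' where u: "ivp_solution Q (k\<^sup>2) u u'" "u 0 = \<alpha>" "u' 0 = \<beta>"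
    "\<And>x. x \<in> {0..pi} \<Longrightarrow> u x = \<alpha> * cos (k * of_real x) + \<beta> * (sin (k * of_real x) / k) + V u x"
    "\<And>x. x \<in> {0..pi} \<Longrightarrow> norm (u x) \<le> (norm \<alpha> + norm \<beta> / norm k) * exp (\<bar>Im k\<bar> * x) * exp (1 / norm k * L x)"
    using ivp_solvable[OF M f] by blast
  show ?thesis
  proof (rule that[OF u(1-3)])
    fix x :: real assume x: "x \<in> {0..pi}"
    show "u x = \<alpha> * cos (k * of_real x) + \<beta> * (sin (k * of_real x) / k)
        + integral {0..x} (\<lambda>t. sin (k * of_real (x - t)) / k * (Q t * u t))"
      using u(4)[OF x] unfolding V_def trigonometric_kernel[OF k] .
    have "(norm \<alpha> + norm \<beta> / norm k) * exp (\<bar>Im k\<bar> * x) * exp (1 / norm k * L x) \<le>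
      (norm \<alpha> + norm \<beta> / norm k) * exp (\<bar>Im k\<bar> * x) * exp (L pi / norm k)"
      using L_mono[OF x] by (intro mult_left_mono) (auto intro: divide_right_mono)
    with u(5)[OF x] show "norm (u x) \<le> (norm \<alpha> + norm \<beta> / norm k) * exp (\<bar>Im k\<bar> * x)
        * exp (integral {0..pi} (\<lambda>t. norm (Q t)) / norm k)"
      unfolding L_def by linarith
  qed
qed

section \<open>Existence and uniqueness for every spectral parameter\<close>

lemma ivp_solution_shift: "ivp_solution (\<lambda>t. Q t + w) (z + w) u u' \<longleftrightarrow> ivp_solution Q z u u'"
  by (simp add: ivp_solution_def)

lemma absolutely_integrable_shift:
  "Q absolutely_integrable_on {0..pi} \<Longrightarrow> (\<lambda>t. Q t + w) absolutely_integrable_on {0..pi}" for w :: complex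
  by (rule set_integral_add(1)) (auto intro: absolutely_integrable_continuous_real)

lemma ivp_exists:
  assumes Q: "Q absolutely_integrable_on {0..pi}"
  obtains u u' where "ivp_solution Q z u u'" "u 0 = \<alpha>" "u' 0 = \<beta>"
proof (cases "z = 0")
  case True
  show ?thesis
  proof (rule ivp_exists_nonzero[OF absolutely_integrable_shift[OF Q] one_neq_zero, of 1 \<alpha> \<beta>])
    fix u u' assume "ivp_solution (\<lambda>t. Q t + 1) (1\<^sup>2) u u'" "u 0 = \<alpha>" "u' 0 = \<beta>"
    with that[of u u'] ivp_solution_shift[of Q 1 0 u u'] True show ?thesis by simp
  qed
next
  case False
  then have "csqrt z \<noteq> 0" by simp
  then show ?thesis
  proof (rule ivp_exists_nonzero[OF Q, of _ \<alpha> \<beta>])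
    fix u u' assume "ivp_solution Q ((csqrt z)\<^sup>2) u u'" "u 0 = \<alpha>" "u' 0 = \<beta>"
    with that[of u u'] show ?thesis by simp
  qed
qed

text \<open>Variation of constants with equal parameters expresses a solution through its initial
  data and one fixed fundamental system, so existence of that system already yields
  uniqueness.\<close>

lemma ivp_solution_unique:
  assumes Q: "Q absolutely_integrable_on {0..pi}" and "ivp_solution Q z u u'" "ivp_solution Q z v v'"
    and "u 0 = v 0" "u' 0 = v' 0" "x \<in> {0..pi}"
  shows "u x = v x"
proof -
  obtain c c' where c: "ivp_solution Q z c c'" "c 0 = 1" "c' 0 = 0"
    by (rule ivp_exists[OF Q])
  obtain s s' where s: "ivp_solution Q z s s'" "s 0 = 0" "s' 0 = 1"
    by (rule ivp_exists[OF Q])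
  have W: "c 0 * s' 0 - c' 0 * s 0 = 1" using c s by simp
  from ivp_solution_variation[OF Q assms(2) c(1) s(1) W assms(6)]
    ivp_solution_variation[OF Q assms(3) c(1) s(1) W assms(6)] assms(4,5)
  show ?thesis by simp
qed

lemma ivp_integral_equation:
  assumes Q: "Q absolutely_integrable_on {0..pi}" and k: "k \<noteq> 0"
    and u: "ivp_solution Q (k\<^sup>2) u u'" and x: "x \<in> {0..pi}"
  shows "u x = u 0 * cos (k * of_real x) + u' 0 * (sin (k * of_real x) / k)
        + integral {0..x} (\<lambda>t. sin (k * of_real (x - t)) / k * (Q t * u t))"
    and "norm (u x) \<le> (norm (u 0) + norm (u' 0) / norm k) * exp (\<bar>Im k\<bar> * x)
        * exp (integral {0..pi} (\<lambda>t. norm (Q t)) / norm k)"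
proof -
  have "u x = u 0 * cos (k * of_real x) + u' 0 * (sin (k * of_real x) / k)
        + integral {0..x} (\<lambda>t. sin (k * of_real (x - t)) / k * (Q t * u t)) \<and>
      norm (u x) \<le> (norm (u 0) + norm (u' 0) / norm k) * exp (\<bar>Im k\<bar> * x)
        * exp (integral {0..pi} (\<lambda>t. norm (Q t)) / norm k)"
  proof (rule ivp_exists_nonzero[OF Q k, where \<alpha> = "u 0" and \<beta> = "u' 0"])
    fix v v' assume v: "ivp_solution Q (k\<^sup>2) v v'" "v 0 = u 0" "v' 0 = u' 0"
      and eq: "\<And>x. x \<in> {0..pi} \<Longrightarrow> v x = u 0 * cos (k * of_real x) + u' 0 * (sin (k * of_real x) / k)
          + integral {0..x} (\<lambda>t. sin (k * of_real (x - t)) / k * (Q t * v t))"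
      and bd: "\<And>x. x \<in> {0..pi} \<Longrightarrow> norm (v x) \<le> (norm (u 0) + norm (u' 0) / norm k) * exp (\<bar>Im k\<bar> * x)
          * exp (integral {0..pi} (\<lambda>t. norm (Q t)) / norm k)"
    have uv: "v t = u t" if "t \<in> {0..pi}" for t
      by (rule ivp_solution_unique[OF Q v(1) u v(2,3) that])
    have "integral {0..x} (\<lambda>t. sin (k * of_real (x - t)) / k * (Q t * v t)) =
        integral {0..x} (\<lambda>t. sin (k * of_real (x - t)) / k * (Q t * u t))"
      by (rule hk_integral_cong) (use x uv in auto)
    with eq[OF x] bd[OF x] uv[OF x] show ?thesis by simp
  qed
  then show "u x = u 0 * cos (k * of_real x) + u' 0 * (sin (k * of_real x) / k)
        + integral {0..x} (\<lambda>t. sin (k * of_real (x - t)) / k * (Q t * u t))"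
    "norm (u x) \<le> (norm (u 0) + norm (u' 0) / norm k) * exp (\<bar>Im k\<bar> * x)
        * exp (integral {0..pi} (\<lambda>t. norm (Q t)) / norm k)"
    by blast+
qed

section \<open>Dependence on the spectral parameter\<close>

text \<open>The choice is worded as in \<open>sine_type_solution\<close>, so that \<open>sn\<close>
  below coincides with it as a function, arbitrary values outside \<open>{0..pi}\<close>
  included.\<close>

definition sol :: "(real \<Rightarrow> complex) \<Rightarrow> complex \<Rightarrow> complex \<Rightarrow> complex \<Rightarrow> real \<Rightarrow> complex" where
  "sol Q \<alpha> \<beta> z = (SOME u. \<exists>u'. ivp_solution Q z u u' \<and> u 0 = \<alpha> \<and> u' 0 = \<beta>)"

definition sol' :: "(real \<Rightarrow> complex) \<Rightarrow> complex \<Rightarrow> complex \<Rightarrow> complex \<Rightarrow> real \<Rightarrow> complex" where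
  "sol' Q \<alpha> \<beta> z = (SOME u'. ivp_solution Q z (sol Q \<alpha> \<beta> z) u' \<and> sol Q \<alpha> \<beta> z 0 = \<alpha> \<and> u' 0 = \<beta>)"

lemma sol:
  assumes "Q absolutely_integrable_on {0..pi}"
  shows "ivp_solution Q z (sol Q \<alpha> \<beta> z) (sol' Q \<alpha> \<beta> z)" "sol Q \<alpha> \<beta> z 0 = \<alpha>" "sol' Q \<alpha> \<beta> z 0 = \<beta>"
proof -
  have "\<exists>u u'. ivp_solution Q z u u' \<and> u 0 = \<alpha> \<and> u' 0 = \<beta>"
    using ivp_exists[OF assms] by metis
  from someI_ex[OF this, folded sol_def]
  have "\<exists>u'. ivp_solution Q z (sol Q \<alpha> \<beta> z) u' \<and> sol Q \<alpha> \<beta> z 0 = \<alpha> \<and> u' 0 = \<beta>" .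
  from someI_ex[OF this, folded sol'_def]
  show "ivp_solution Q z (sol Q \<alpha> \<beta> z) (sol' Q \<alpha> \<beta> z)" "sol Q \<alpha> \<beta> z 0 = \<alpha>" "sol' Q \<alpha> \<beta> z 0 = \<beta>"
    by auto
qed

lemma sol_unique:
  assumes "Q absolutely_integrable_on {0..pi}" "ivp_solution Q z u u'" "x \<in> {0..pi}"
  shows "u x = sol Q (u 0) (u' 0) z x"
  by (rule ivp_solution_unique[OF assms(1,2) sol(1)[OF assms(1)] _ _ assms(3)]) (simp_all add: sol[OF assms(1)])

lemma sol_continuous:
  "Q absolutely_integrable_on {0..pi} \<Longrightarrow> continuous_on {0..pi} (sol Q \<alpha> \<beta> z)"
  by (rule ivp_solution_continuous[OF sol(1)])

lemma norm_integral_initial_le: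
  fixes f :: "real \<Rightarrow> complex"
  assumes "continuous_on {0..pi} f" "\<And>t. t \<in> {0..pi} \<Longrightarrow> norm (f t) \<le> K" "x \<in> {0..pi}" "K \<ge> 0"
  shows "norm (integral {0..x} f) \<le> K * pi"
proof -
  have "norm (integral {0..x} f) \<le> K * (x - 0)"
    by (rule integral_bound) (use assms in \<open>auto intro: continuous_on_subset\<close>)
  also have "\<dots> \<le> K * pi" using assms by (intro mult_left_mono) auto
  finally show ?thesis .
qed

lemma sol_locally_bounded:
  assumes Q: "Q absolutely_integrable_on {0..pi}"
  shows "\<exists>K\<ge>0. \<forall>z\<in>ball w 1. \<forall>x\<in>{0..pi}. norm (sol Q \<alpha> \<beta> z x) \<le> K"
proof -
  \<comment> \<open>The shift by \<open>r\<close> keeps \<open>k\<^sup>2 = z + r\<close> at distance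
    at least 1 from 0 for all \<open>z\<close> in the ball, so that dividing by \<open>k\<close>
    does no harm.\<close>
  define r where "r = norm w + 2"
  define R where "R t = Q t + of_real r" for t
  define N where "N = integral {0..pi} (\<lambda>t. norm (R t))"
  have R: "R absolutely_integrable_on {0..pi}"
    unfolding R_def by (rule absolutely_integrable_shift[OF Q])
  have N: "N \<ge> 0"
    unfolding N_def
    by (rule hk_integral_nonneg) (use R in \<open>auto simp: absolutely_integrable_on_def\<close>)
  define K where "K = (norm \<alpha> + norm \<beta>) * exp ((norm w + 1 + r) * pi) * exp N"
  have "norm (sol Q \<alpha> \<beta> z x) \<le> K" if z: "z \<in> ball w 1" and x: "x \<in> {0..pi}" for z x
  proof -
    define k where "k = csqrt (z + of_real r)"
    have k2: "k\<^sup>2 = z + of_real r" by (simp add: k_def)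
    have zw: "norm z \<le> norm w + 1" and "norm z \<ge> 0"
      using z norm_triangle_ineq2[of z w] by (auto simp: dist_norm norm_minus_commute)
    have "r \<ge> 2" by (simp add: r_def)
    have up: "norm (k\<^sup>2) \<le> norm w + 1 + r"
      unfolding k2 using zw \<open>r \<ge> 2\<close> norm_triangle_ineq[of z "of_real r"] by simp
    have lo: "norm (k\<^sup>2) \<ge> 1"
    proof -
      have "r - norm z \<le> norm (k\<^sup>2)"
        using norm_triangle_ineq2[of "of_real r" "- z"] \<open>r \<ge> 2\<close> by (simp add: k2 add.commute)
      then show ?thesis using zw r_def by linarith
    qed
    have k1: "norm k \<ge> 1"
      by (rule power2_le_imp_le) (use lo in \<open>auto simp: norm_power\<close>)
    have "norm k * 1 \<le> norm k * norm k" using k1 by (intro mult_left_mono) auto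
    then have "norm k \<le> norm (k\<^sup>2)"
      by (simp add: norm_mult power2_eq_square)
    then have kle: "norm k \<le> norm w + 1 + r"
      using up by linarith
    have k0: "k \<noteq> 0" using k1 by auto
    have s: "ivp_solution R (k\<^sup>2) (sol Q \<alpha> \<beta> z) (sol' Q \<alpha> \<beta> z)"
      unfolding k2 R_def ivp_solution_shift by (rule sol(1)[OF Q])
    have "norm (sol Q \<alpha> \<beta> z x) \<le> (norm \<alpha> + norm \<beta> / norm k) * exp (\<bar>Im k\<bar> * x) * exp (N / norm k)"
      using ivp_integral_equation(2)[OF R k0 s x] unfolding sol(2,3)[OF Q] N_def .
    also have "\<dots> \<le> K"
      unfolding K_def
    proof (intro mult_mono)
      show "norm \<alpha> + norm \<beta> / norm k \<le> norm \<alpha> + norm \<beta>"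
        using k0 k1 divide_left_mono[of 1 "norm k" "norm \<beta>"] by simp
      have "\<bar>Im k\<bar> * x \<le> (norm w + 1 + r) * pi"
        using x kle abs_Im_le_cmod[of k] by (intro mult_mono) auto
      then show "exp (\<bar>Im k\<bar> * x) \<le> exp ((norm w + 1 + r) * pi)" by simp
      show "exp (N / norm k) \<le> exp N"
        using k0 k1 N divide_left_mono[of 1 "norm k" N] by simp
    qed auto
    finally show ?thesis .
  qed
  moreover have "K \<ge> 0" by (simp add: K_def)
  ultimately show ?thesis by blast
qed

text \<open>Variation of constants at \<open>w\<close>, applied to the solutions for
  \<open>z\<close> and for \<open>w\<close>: the initial data agree and their contributions cancel.
  The difference quotient in the parameter is thereby an explicit expression, and differentiability
  reduces to continuity of two integrals.\<close>

lemma sol_diff_eq: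
  assumes Q: "Q absolutely_integrable_on {0..pi}" and x: "x \<in> {0..pi}"
  shows "sol Q \<alpha> \<beta> z x - sol Q \<alpha> \<beta> w x = (z - w) *
    (sol Q 1 0 w x * integral {0..x} (\<lambda>t. sol Q \<alpha> \<beta> z t * sol Q 0 1 w t)
      - sol Q 0 1 w x * integral {0..x} (\<lambda>t. sol Q \<alpha> \<beta> z t * sol Q 1 0 w t))"
proof -
  have W: "sol Q 1 0 w 0 * sol' Q 0 1 w 0 - sol' Q 1 0 w 0 * sol Q 0 1 w 0 = 1"
    by (simp add: sol[OF Q])
  from ivp_solution_variation[OF Q sol(1)[OF Q] sol(1)[OF Q] sol(1)[OF Q] W x, of \<alpha> \<beta> z]
    ivp_solution_variation[OF Q sol(1)[OF Q] sol(1)[OF Q] sol(1)[OF Q] W x, of \<alpha> \<beta> w]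
  show ?thesis by (simp add: sol(2,3)[OF Q])
qed

text \<open>Local boundedness inserted into \<open>sol_diff_eq\<close>. The constant is uniform in
  \<open>x\<close>, as is required for passing to the limit under the integrals there.\<close>

lemma sol_locally_lipschitz:
  assumes Q: "Q absolutely_integrable_on {0..pi}"
  shows "\<exists>C\<ge>0. \<forall>z\<in>ball w 1. \<forall>x\<in>{0..pi}. norm (sol Q \<alpha> \<beta> z x - sol Q \<alpha> \<beta> w x) \<le> C * norm (z - w)"
proof -
  obtain K where K: "K \<ge> 0" "\<And>z x. z \<in> ball w 1 \<Longrightarrow> x \<in> {0..pi} \<Longrightarrow> norm (sol Q \<alpha> \<beta> z x) \<le> K"
    using sol_locally_bounded[OF Q, of w \<alpha> \<beta>] by blast
  obtain A where A: "A \<ge> 0" "\<And>z x. z \<in> ball w 1 \<Longrightarrow> x \<in> {0..pi} \<Longrightarrow> norm (sol Q 1 0 z x) \<le> A"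
    using sol_locally_bounded[OF Q, of w 1 0] by blast
  obtain B where B: "B \<ge> 0" "\<And>z x. z \<in> ball w 1 \<Longrightarrow> x \<in> {0..pi} \<Longrightarrow> norm (sol Q 0 1 z x) \<le> B"
    using sol_locally_bounded[OF Q, of w 0 1] by blast
  have ww: "w \<in> ball w 1" by simp
  have "norm (sol Q \<alpha> \<beta> z x - sol Q \<alpha> \<beta> w x) \<le> (A * (K * B * pi) + B * (K * A * pi)) * norm (z - w)"
    if z: "z \<in> ball w 1" and x: "x \<in> {0..pi}" for z x
  proof -
    have i1: "norm (integral {0..x} (\<lambda>t. sol Q \<alpha> \<beta> z t * sol Q 0 1 w t)) \<le> K * B * pi"
      using K B z ww
      by (intro norm_integral_initial_le x continuous_on_mult sol_continuous Q) (auto simp: norm_mult intro!: mult_mono)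
    have i2: "norm (integral {0..x} (\<lambda>t. sol Q \<alpha> \<beta> z t * sol Q 1 0 w t)) \<le> K * A * pi"
      using K A z ww
      by (intro norm_integral_initial_le x continuous_on_mult sol_continuous Q) (auto simp: norm_mult intro!: mult_mono)
    have "norm (sol Q 1 0 w x * integral {0..x} (\<lambda>t. sol Q \<alpha> \<beta> z t * sol Q 0 1 w t)
      - sol Q 0 1 w x * integral {0..x} (\<lambda>t. sol Q \<alpha> \<beta> z t * sol Q 1 0 w t)) \<le> A * (K * B * pi) + B * (K * A * pi)"
      by (rule order_trans[OF norm_triangle_ineq4], unfold norm_mult)
        (intro add_mono mult_mono i1 i2 A(2)[OF ww x] B(2)[OF ww x] A(1) B(1) norm_ge_zero)
    then show ?thesis
      unfolding sol_diff_eq[OF Q x] norm_mult by (simp add: mult.commute[of "norm (z - w)"] mult_right_mono)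
  qed
  moreover have "A * (K * B * pi) + B * (K * A * pi) \<ge> 0" using A(1) B(1) K(1) by simp
  ultimately show ?thesis by blast
qed

lemma sol_integral_tendsto:
  assumes Q: "Q absolutely_integrable_on {0..pi}" and x: "x \<in> {0..pi}" and g: "continuous_on {0..pi} g"
  shows "((\<lambda>z. integral {0..x} (\<lambda>t. sol Q \<alpha> \<beta> z t * g t)) \<longlongrightarrow> integral {0..x} (\<lambda>t. sol Q \<alpha> \<beta> w t * g t)) (at w)"
proof -
  obtain C where C: "C \<ge> 0" "\<And>z x. z \<in> ball w 1 \<Longrightarrow> x \<in> {0..pi} \<Longrightarrow>
      norm (sol Q \<alpha> \<beta> z x - sol Q \<alpha> \<beta> w x) \<le> C * norm (z - w)"
    using sol_locally_lipschitz[OF Q, of w \<alpha> \<beta>] by blast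
  have "bounded (g ` {0..pi})"
    by (intro compact_imp_bounded compact_continuous_image g compact_Icc)
  then obtain G where G: "G > 0" "\<And>t. t \<in> {0..pi} \<Longrightarrow> norm (g t) \<le> G"
    unfolding bounded_pos by auto
  have "((\<lambda>z. integral {0..x} (\<lambda>t. sol Q \<alpha> \<beta> z t * g t) - integral {0..x} (\<lambda>t. sol Q \<alpha> \<beta> w t * g t)) \<longlongrightarrow> 0) (at w)"
  proof (rule Lim_null_comparison)
    show "((\<lambda>z. C * norm (z - w) * G * pi) \<longlongrightarrow> 0) (at w)"
      by (auto intro!: tendsto_eq_intros)
    have "norm (integral {0..x} (\<lambda>t. sol Q \<alpha> \<beta> z t * g t) - integral {0..x} (\<lambda>t. sol Q \<alpha> \<beta> w t * g t))
        \<le> C * norm (z - w) * G * pi" if z: "z \<in> ball w 1" for z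
    proof -
      have I: "(\<lambda>t. sol Q \<alpha> \<beta> v t * g t) integrable_on {0..x}" for v
        by (rule integrable_continuous_interval)
          (use x in \<open>auto intro!: continuous_on_mult intro: continuous_on_subset[OF sol_continuous[OF Q]] continuous_on_subset[OF g]\<close>)
      have "integral {0..x} (\<lambda>t. sol Q \<alpha> \<beta> z t * g t) - integral {0..x} (\<lambda>t. sol Q \<alpha> \<beta> w t * g t)
         = integral {0..x} (\<lambda>t. (sol Q \<alpha> \<beta> z t - sol Q \<alpha> \<beta> w t) * g t)"
        unfolding left_diff_distrib by (rule hk_integral_diff[OF I I, symmetric])
      also have "norm \<dots> \<le> (C * norm (z - w) * G) * pi"
        using C z G
        by (intro norm_integral_initial_le x continuous_on_mult continuous_on_diff sol_continuous Q g)
          (auto simp: norm_mult intro!: mult_mono)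
      finally show ?thesis .
    qed
    then show "\<forall>\<^sub>F z in at w. norm (integral {0..x} (\<lambda>t. sol Q \<alpha> \<beta> z t * g t) - integral {0..x} (\<lambda>t. sol Q \<alpha> \<beta> w t * g t))
        \<le> C * norm (z - w) * G * pi"
      by (intro eventually_mono[OF eventually_at_ball[of 1 w UNIV]]) auto
  qed
  then show ?thesis by (subst Lim_null)
qed

lemma sol_has_field_derivative:
  assumes Q: "Q absolutely_integrable_on {0..pi}" and x: "x \<in> {0..pi}"
  shows "((\<lambda>z. sol Q \<alpha> \<beta> z x) has_field_derivative
    sol Q 1 0 w x * integral {0..x} (\<lambda>t. sol Q \<alpha> \<beta> w t * sol Q 0 1 w t)
      - sol Q 0 1 w x * integral {0..x} (\<lambda>t. sol Q \<alpha> \<beta> w t * sol Q 1 0 w t)) (at w)"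
  unfolding has_field_derivative_iff
proof (rule Lim_transform_eventually)
  show "((\<lambda>z. sol Q 1 0 w x * integral {0..x} (\<lambda>t. sol Q \<alpha> \<beta> z t * sol Q 0 1 w t)
      - sol Q 0 1 w x * integral {0..x} (\<lambda>t. sol Q \<alpha> \<beta> z t * sol Q 1 0 w t)) \<longlongrightarrow>
    sol Q 1 0 w x * integral {0..x} (\<lambda>t. sol Q \<alpha> \<beta> w t * sol Q 0 1 w t)
      - sol Q 0 1 w x * integral {0..x} (\<lambda>t. sol Q \<alpha> \<beta> w t * sol Q 1 0 w t)) (at w)"
    by (intro tendsto_intros sol_integral_tendsto Q x sol_continuous)
  show "\<forall>\<^sub>F z in at w. sol Q 1 0 w x * integral {0..x} (\<lambda>t. sol Q \<alpha> \<beta> z t * sol Q 0 1 w t)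
      - sol Q 0 1 w x * integral {0..x} (\<lambda>t. sol Q \<alpha> \<beta> z t * sol Q 1 0 w t) =
      (sol Q \<alpha> \<beta> z x - sol Q \<alpha> \<beta> w x) / (z - w)"
    unfolding sol_diff_eq[OF Q x] by (rule eventually_at_filter[THEN iffD2]) simp
qed

lemma sol_holomorphic:
  assumes "Q absolutely_integrable_on {0..pi}" "x \<in> {0..pi}"
  shows "(\<lambda>z. sol Q \<alpha> \<beta> z x) holomorphic_on A"
  using sol_has_field_derivative[OF assms] holomorphic_onI field_differentiable_def
    field_differentiable_at_within by meson

section \<open>Entire functions with interlacing zeros\<close>

lemma entire_divide_root:
  assumes "F holomorphic_on UNIV" "F w = 0"
  obtains g where "g holomorphic_on UNIV" "\<And>z. F z = (z - w) * g z"
proof -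
  have "(\<lambda>z. if z = w then deriv F w else (F z - F w) / (z - w)) holomorphic_on UNIV"
    by (rule pole_theorem_open_0[of "\<lambda>z. F z - F w" UNIV w])
      (use assms in \<open>auto intro!: holomorphic_intros\<close>)
  then show ?thesis
    by (rule that) (use assms in auto)
qed

lemma entire_divide_roots:
  assumes "finite I" "inj_on c I" "F holomorphic_on UNIV" "\<And>i. i \<in> I \<Longrightarrow> F (c i) = 0"
  shows "\<exists>g. g holomorphic_on UNIV \<and> (\<forall>z. F z = (\<Prod>i\<in>I. z - c i) * g z)"
  using assms(1,2,4)
proof (induction I rule: finite_induct)
  case empty
  then show ?case using assms(3) by auto
next
  case (insert j I)
  then obtain g where g: "g holomorphic_on UNIV" "\<And>z. F z = (\<Prod>i\<in>I. z - c i) * g z"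
    by auto
  have "(\<Prod>i\<in>I. c j - c i) * g (c j) = 0" using g(2)[of "c j"] insert.prems(2)[of j] by simp
  moreover have "(\<Prod>i\<in>I. c j - c i) \<noteq> 0" using insert.hyps insert.prems(1) by auto
  ultimately have "g (c j) = 0" by simp
  then obtain h where "h holomorphic_on UNIV" "\<And>z. g z = (z - c j) * h z"
    using entire_divide_root[OF g(1)] by blast
  then show ?case
    using g insert.hyps by (intro exI[of _ h]) (auto simp: mult_ac)
qed

text \<open>Replacing \<open>t\<close> by \<open>max t (Re z)\<close> makes the distance to \<open>z\<close> monotone in \<open>t\<close>, so that
  the quotients over disjoint intervals telescope. On the circle the total variation stays bounded,
  even near the positive real axis, because the points lie inside the disc.\<close>
lemma prod_dist_interlacing_le:
  fixes z :: complex and a b t :: "nat \<Rightarrow> real"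
  assumes R: "norm z = R" "R > 0"
    and ba: "\<And>n. n \<in> {1..N} \<Longrightarrow> b n < a n" and aR: "\<And>n. n \<in> {1..N} \<Longrightarrow> a n < R"
    and ab: "\<And>n. 1 \<le> n \<Longrightarrow> n < N \<Longrightarrow> a n < b (Suc n)"
    and b1: "\<bar>b 1\<bar> \<le> R / 2"
    and t: "\<And>n. n \<in> {1..N} \<Longrightarrow> t n = a n \<or> t n = b n"
  shows "(\<Prod>n\<in>{1..N}. norm (z - of_real (a n))) \<le> 4 * (\<Prod>n\<in>{1..N}. norm (z - of_real (t n)))"
proof -
  have cm: "norm (z - of_real u) = sqrt ((u - Re z)\<^sup>2 + (Im z)\<^sup>2)" for u
    by (simp add: cmod_def power2_commute)
  have Rz: "(Re z)\<^sup>2 + (Im z)\<^sup>2 = R\<^sup>2"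
    using R(1) cmod_power2[of z] by simp
  have bge: "b 1 \<le> b n" if "n \<in> {1..N}" for n
  proof -
    have "n \<ge> 1" using that by auto
    then show ?thesis using that
    proof (induction n rule: dec_induct)
      case (step m)
      have "b m < a m" "a m < b (Suc m)" using step.prems step.hyps by (auto intro: ba ab)
      then show ?case using step by auto
    qed simp
  qed
  consider "N = 0" | "z = of_real R" | "N \<ge> 1" "z \<noteq> of_real R" by linarith
  then show ?thesis
  proof cases
    \<comment> \<open>At \<open>z = R\<close> the modified distance used below would vanish at every
      \<open>b n\<close>; there each factor is compared directly.\<close>
    case 2
    have "(\<Prod>n\<in>{1..N}. norm (z - of_real (a n))) \<le> (\<Prod>n\<in>{1..N}. norm (z - of_real (t n)))"
    proof (rule prod_mono, intro conjI norm_ge_zero)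
      fix n assume n: "n \<in> {1..N}"
      have "t n \<le> a n" using t[OF n] ba[OF n] by auto
      then show "norm (z - of_real (a n)) \<le> norm (z - of_real (t n))"
        using aR[OF n] unfolding 2 of_real_diff[symmetric] norm_of_real by simp
    qed
    moreover have "0 \<le> (\<Prod>n\<in>{1..N}. norm (z - of_real (t n)))" by (intro prod_nonneg) auto
    ultimately show ?thesis by linarith
  next
    case 3
    define p where "p u = norm (z - of_real (max u (Re z)))" for u
    have p_sqrt: "p u = sqrt ((max u (Re z) - Re z)\<^sup>2 + (Im z)\<^sup>2)" for u
      unfolding p_def by (rule cm)
    have p_mono: "p u \<le> p v" if "u \<le> v" for u v
      unfolding p_sqrt using that by (intro real_sqrt_le_mono add_right_mono power_mono) auto
    have p_pos: "p (b n) > 0" if n: "n \<in> {1..N}" for n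
    proof (rule ccontr)
      assume "\<not> p (b n) > 0"
      then have "z = of_real (max (b n) (Re z))" by (simp add: p_def)
      then have "Im z = 0" "Re z = max (b n) (Re z)" by (metis Im_complex_of_real, metis Re_complex_of_real)
      then have "Re z \<ge> b n" "(Re z)\<^sup>2 = R\<^sup>2" using Rz by auto
      then have "Re z = R \<or> Re z = - R" by (simp add: power2_eq_iff)
      moreover have "Re z \<noteq> - R" using \<open>Re z \<ge> b n\<close> bge[OF n] b1 R(2) by linarith
      ultimately show False using \<open>Im z = 0\<close> 3(2) complex_eqI[of z "of_real R"] by auto
    qed
    have local: "norm (z - of_real (a n)) \<le> norm (z - of_real (t n)) * (p (a n) / p (b n))" if n: "n \<in> {1..N}" for n
    proof (cases "t n = a n")
      case True
      have "p (a n) / p (b n) \<ge> 1" using p_mono[of "b n" "a n"] ba[OF n] p_pos[OF n] by simp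
      then show ?thesis unfolding True by (metis mult.right_neutral mult_left_mono norm_ge_zero)
    next
      case False
      then have tb: "t n = b n" using t[OF n] by auto
      \<comment> \<open>If \<open>a n\<close> is not to the right of \<open>Re z\<close>, it is
        nearer to \<open>z\<close> than \<open>b n\<close> is, while \<open>p\<close> takes the same
        value at both. Otherwise \<open>p\<close> is the true distance at \<open>a n\<close> and at
        most the true distance at \<open>b n\<close>.\<close>
      have "norm (z - of_real (a n)) * p (b n) \<le> norm (z - of_real (b n)) * p (a n)"
      proof (cases "a n \<le> Re z")
        case True
        then have "p (b n) = p (a n)" using ba[OF n] by (simp add: p_def max_def)
        moreover have "norm (z - of_real (a n)) \<le> norm (z - of_real (b n))"
          unfolding cm using True ba[OF n]
          by (intro real_sqrt_le_mono add_mono order_refl) (simp add: power2_le_iff_abs_le abs_le_iff power2_commute[of _ "Re z"] power_mono)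
        ultimately show ?thesis by (simp add: mult_right_mono p_def)
      next
        case False
        then have "p (a n) = norm (z - of_real (a n))" by (simp add: p_def max_def)
        moreover have "p (b n) \<le> norm (z - of_real (b n))"
          unfolding p_sqrt cm by (intro real_sqrt_le_mono add_mono order_refl) (auto simp: max_def)
        ultimately show ?thesis by (metis mult.commute mult_left_mono norm_ge_zero)
      qed
      then show ?thesis using p_pos[OF n] by (simp add: tb pos_le_divide_eq)
    qed
    \<comment> \<open>By interlacing \<open>p (a m) \<le> p (b (Suc m))\<close>, so each denominator
      absorbs the preceding numerator.\<close>
    have tele: "(\<Prod>n\<in>{1..m}. p (a n) / p (b n)) \<le> p (a m) / p (b 1)" if "1 \<le> m" "m \<le> N" for m
      using that
    proof (induction m rule: dec_induct)
      case (step m)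
      then have IH: "(\<Prod>n\<in>{1..m}. p (a n) / p (b n)) \<le> p (a m) / p (b 1)" by simp
      have pb: "p (b 1) > 0" "p (b (Suc m)) > 0" using step.prems by (auto intro!: p_pos)
      have "a m < b (Suc m)" using step by (intro ab) auto
      then have "p (a m) \<le> p (b (Suc m))" by (intro p_mono) auto
      then have "p (a m) / p (b 1) \<le> p (b (Suc m)) / p (b 1)" using pb by (simp add: divide_right_mono)
      with IH have "(\<Prod>n\<in>{1..m}. p (a n) / p (b n)) \<le> p (b (Suc m)) / p (b 1)" by linarith
      then have "(\<Prod>n\<in>{1..m}. p (a n) / p (b n)) * (p (a (Suc m)) / p (b (Suc m))) \<le>
          p (b (Suc m)) / p (b 1) * (p (a (Suc m)) / p (b (Suc m)))"
        using pb by (intro mult_right_mono) (auto simp: p_def)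
      then show ?case using pb by (simp add: field_simps)
    qed simp
    have N: "N \<in> {1..N}" "1 \<in> {1..N}" using 3 by auto
    \<comment> \<open>Origin of the 4: left of \<open>b 1\<close> it is the quotient of
      \<open>2 * R\<close> and \<open>R / 2\<close>. Otherwise \<open>Re z \<ge> - R / 2\<close>
      means \<open>R - Re z \<le> 3 * (R + Re z)\<close>, and multiplying by \<open>R - Re z\<close>
      bounds its square by \<open>3 * (Im z)\<^sup>2\<close>, which even gives the factor 2.\<close>
    have last: "p (a N) \<le> 4 * p (b 1)"
    proof (cases "Re z < b 1")
      case True
      have "p (b 1) \<ge> R - R / 2"
        using norm_triangle_ineq2[of z "of_real (b 1)"] True R b1 by (simp add: p_def max_def)
      moreover have "p (a N) \<le> 2 * R"
      proof -
        have bN: "b 1 < a N" using bge[OF N(1)] ba[OF N(1)] by linarith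
        have "\<bar>a N\<bar> \<le> R" using aR[OF N(1)] bN b1 R(2) by linarith
        then show ?thesis
          using norm_triangle_ineq4[of z "of_real (a N)"] True bN R by (simp add: p_def max_def)
      qed
      ultimately show ?thesis by linarith
    next
      case False
      have pb: "p (b 1) = \<bar>Im z\<bar>" using False by (simp add: p_sqrt max_def)
      have rez: "Re z \<le> R" "Re z \<ge> - R / 2" using abs_Re_le_cmod[of z] R False b1 by auto
      have "(max (a N) (Re z) - Re z)\<^sup>2 \<le> (R - Re z)\<^sup>2"
        using aR[OF N(1)] rez by (intro power_mono) auto
      also have "\<dots> = (R - Re z) * (R - Re z)" by (rule power2_eq_square)
      also have "\<dots> \<le> (R - Re z) * (3 * (R + Re z))" using rez by (intro mult_left_mono) auto
      also have "\<dots> = 3 * (Im z)\<^sup>2" using Rz by (simp add: algebra_simps power2_eq_square)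
      finally have "p (a N) \<le> sqrt (4 * (Im z)\<^sup>2)"
        unfolding p_sqrt by (intro real_sqrt_le_mono) simp
      then have "p (a N) \<le> 2 * \<bar>Im z\<bar>" by (simp add: real_sqrt_mult)
      then show ?thesis unfolding pb by linarith
    qed
    have P: "0 \<le> (\<Prod>n\<in>{1..N}. norm (z - of_real (t n)))" by (intro prod_nonneg) auto
    have "(\<Prod>n\<in>{1..N}. norm (z - of_real (a n))) \<le> (\<Prod>n\<in>{1..N}. norm (z - of_real (t n)) * (p (a n) / p (b n)))"
      by (intro prod_mono conjI norm_ge_zero local)
    also have "\<dots> = (\<Prod>n\<in>{1..N}. norm (z - of_real (t n))) * (\<Prod>n\<in>{1..N}. p (a n) / p (b n))"
      by (rule prod.distrib)
    also have "\<dots> \<le> (\<Prod>n\<in>{1..N}. norm (z - of_real (t n))) * 4"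
    proof (rule mult_left_mono[OF _ P])
      have "p (a N) / p (b 1) \<le> 4" using last p_pos[OF N(2)] by (simp add: divide_le_eq)
      with tele[of N] 3 show "(\<Prod>n\<in>{1..N}. p (a n) / p (b n)) \<le> 4" by linarith
    qed
    finally show ?thesis by simp
  qed simp
qed

text \<open>Dividing \<open>F\<close> by the product of its known zeros and \<open>S\<close> by the product of its own zeros in the
  disc gives a holomorphic quotient, which is small on the circle and, to the left of all the
  zeros, at least as large as \<open>F / S\<close>. The extra factor \<open>z - R\<close> tolerates a quotient \<open>F / S\<close>
  that is merely bounded near the positive real axis.\<close>
lemma entire_eq_0_of_interlacing_zeros:
  fixes a b :: "nat \<Rightarrow> real" and S F :: "complex \<Rightarrow> complex"
  assumes S: "S holomorphic_on UNIV" and F: "F holomorphic_on UNIV"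
    and zeros: "\<And>z. S z = 0 \<longleftrightarrow> (\<exists>n\<ge>1. z = of_real (a n))"
    and simple: "\<And>n. n \<ge> 1 \<Longrightarrow> deriv S (of_real (a n)) \<noteq> 0"
    and ba: "\<And>n. n \<ge> 1 \<Longrightarrow> b n < a n" and ab: "\<And>n. n \<ge> 1 \<Longrightarrow> a n < b (Suc n)"
    and FA: "\<And>n. n \<ge> 1 \<Longrightarrow> n \<in> A \<Longrightarrow> F (of_real (a n)) = 0"
    and FB: "\<And>n. n \<ge> 1 \<Longrightarrow> n \<notin> A \<Longrightarrow> F (of_real (b n)) = 0"
    and growth: "\<And>\<epsilon> R\<^sub>0. \<epsilon> > 0 \<Longrightarrow> \<exists>R\<ge>R\<^sub>0. \<forall>z. norm z = R \<longrightarrow>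
      S z \<noteq> 0 \<and> norm (F z) * norm (z - of_real R) \<le> \<epsilon> * R * norm (S z)"
  shows "F z = 0"
proof -
  define t where "t n = (if n \<in> A then a n else b n)" for n
  have tb: "b n \<le> t n" "t n \<le> a n" if "n \<ge> 1" for n
    using ba[OF that] by (auto simp: t_def)
  have a_less: "a m < a n" if "1 \<le> m" "m < n" for m n
  proof -
    have "Suc m \<le> n" using that by simp
    then show ?thesis
    proof (induction n rule: dec_induct)
      case base then show ?case using ab[of m] ba[of "Suc m"] that by fastforce
    next
      case (step i) then show ?case using ab[of i] ba[of "Suc i"] that by fastforce
    qed
  qed
  have t_less: "t m < t n" if "1 \<le> m" "m < n" for m n
  proof -
    have "Suc m \<le> n" using that by simp
    then show ?thesis
    proof (induction n rule: dec_induct)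
      case base then show ?case using ab[of m] tb[of "Suc m"] tb[of m] that by fastforce
    next
      case (step i) then show ?case using ab[of i] tb[of "Suc i"] tb[of i] that by fastforce
    qed
  qed
  have b_ge: "b 1 \<le> b n" if "n \<ge> 1" for n
    using that
  proof (induction n rule: dec_induct)
    case (step m) then show ?case using ab[of m] ba[of m] by linarith
  qed simp
  have S_nonconst: "\<not> S constant_on UNIV"
  proof
    assume "S constant_on UNIV"
    then obtain c where "\<And>z. S z = c" by (auto simp: constant_on_def)
    moreover have "S (of_real (a 1)) = 0" using zeros by blast
    ultimately have "S \<i> = 0" by metis
    then obtain n where "\<i> = of_real (a n)" using zeros by blast
    then have "Im \<i> = 0" by (metis Im_complex_of_real)
    then show False by simp
  qed
  have left: "F (of_real w) = 0" if w: "w < b 1" for w :: real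
  proof -
    have "norm (F (of_real w)) \<le> 0 + e" if e: "e > 0" for e
    proof -
      \<comment> \<open>The 8 combines the 4 of \<open>prod_dist_interlacing_le\<close> with the 2
        from \<open>\<bar>w - R\<bar> \<ge> R / 2\<close>; the added 1 keeps the denominator
        positive.\<close>
      define \<epsilon> where "\<epsilon> = e / (8 * (norm (S (of_real w)) + 1))"
      have \<epsilon>: "\<epsilon> > 0" using e by (simp add: \<epsilon>_def add_nonneg_pos)
      obtain R where R: "R \<ge> 2 * \<bar>b 1\<bar> + 2 * \<bar>w\<bar> + 1"
        and RS: "\<And>z. norm z = R \<Longrightarrow> S z \<noteq> 0"
        and RF: "\<And>z. norm z = R \<Longrightarrow> norm (F z) * norm (z - of_real R) \<le> \<epsilon> * R * norm (S z)"
        using growth[OF \<epsilon>] by blast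
      have Rpos: "R > 0" "\<bar>b 1\<bar> \<le> R / 2" "\<bar>w\<bar> \<le> R / 2" using R by linarith+
      define M where "M = {n. n \<ge> 1 \<and> a n < R}"
      have "finite M"
      proof (rule inj_on_finite)
        show "inj_on (\<lambda>n. complex_of_real (a n)) M"
          by (rule inj_onI) (metis (mono_tags, lifting) M_def a_less less_irrefl linorder_neqE_nat mem_Collect_eq of_real_eq_iff)
        show "(\<lambda>n. complex_of_real (a n)) ` M \<subseteq> {z \<in> cball 0 R. S z = 0}"
        proof clarify
          fix n assume n: "n \<in> M"
          then have "- R < a n" using b_ge[of n] ba[of n] Rpos by (auto simp: M_def)
          then show "complex_of_real (a n) \<in> cball 0 R \<and> S (of_real (a n)) = 0"
            using n zeros by (auto simp: M_def dist_norm)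
        qed
        show "finite {z \<in> cball 0 R. S z = 0}"
          by (rule holomorphic_compact_finite_zeros[OF S]) (auto simp: S_nonconst)
      qed
      \<comment> \<open>The inserted 0 covers a disc without zeros of \<open>S\<close>, for which
        \<open>{1..N}\<close> is empty. As \<open>a\<close> increases, \<open>{1..N}\<close> is
        exactly \<open>M\<close>.\<close>
      define N where "N = Max (insert 0 M)"
      have N1: "a n < R" if "n \<in> {1..N}" for n
      proof -
        have "N \<in> insert 0 M" unfolding N_def using \<open>finite M\<close> by (intro Max_in) auto
        then have "a N < R" using that by (auto simp: M_def)
        moreover have "a n \<le> a N" using a_less[of n N] that by (cases "n = N") auto
        ultimately show ?thesis by linarith
      qed
      have N2: "n \<in> {1..N}" if "n \<ge> 1" "a n < R" for n
        using that \<open>finite M\<close> unfolding N_def M_def by auto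
      define c where "c = (\<lambda>n. complex_of_real (a n))"
      define d where "d = (\<lambda>n. complex_of_real (t n))"
      have inj: "inj_on c {1..N}" "inj_on d {1..N}"
        unfolding c_def d_def
        by (rule inj_onI, metis a_less atLeastAtMost_iff less_irrefl linorder_neqE_nat of_real_eq_iff)
          (rule inj_onI, metis t_less atLeastAtMost_iff less_irrefl linorder_neqE_nat of_real_eq_iff)
      have roots_S: "S (c n) = 0" if "n \<in> {1..N}" for n using zeros that by (auto simp: c_def)
      have "\<exists>g. g holomorphic_on UNIV \<and> (\<forall>z. S z = (\<Prod>n\<in>{1..N}. z - c n) * g z)"
        by (rule entire_divide_roots[OF finite_atLeastAtMost inj(1) S roots_S])
      then obtain h where h_hol: "h holomorphic_on UNIV" and h_eq: "\<forall>z. S z = (\<Prod>n\<in>{1..N}. z - c n) * h z"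
        by (elim exE conjE)
      note h = h_hol h_eq[rule_format]
      have roots_F: "F (d n) = 0" if "n \<in> {1..N}" for n using FA FB that by (auto simp: d_def t_def)
      have "\<exists>g. g holomorphic_on UNIV \<and> (\<forall>z. F z = (\<Prod>n\<in>{1..N}. z - d n) * g z)"
        by (rule entire_divide_roots[OF finite_atLeastAtMost inj(2) F roots_F])
      then obtain g where g_hol: "g holomorphic_on UNIV" and g_eq: "\<forall>z. F z = (\<Prod>n\<in>{1..N}. z - d n) * g z"
        by (elim exE conjE)
      note g = g_hol g_eq[rule_format]
      \<comment> \<open>A zero of \<open>h\<close> in the disc is a zero of \<open>S\<close>, hence
        one of the roots already divided out. \<open>S\<close> would then have a double root,
        against \<open>simple\<close>.\<close>
      have h_nz: "h z \<noteq> 0" if z: "z \<in> cball 0 R" for z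
      proof
        assume hz: "h z = 0"
        then have "S z = 0" using h(2) by simp
        then obtain m where m: "m \<ge> 1" "z = of_real (a m)" using zeros by blast
        have "norm z \<noteq> R" using RS \<open>S z = 0\<close> by blast
        then have "a m < R" using z m by auto
        then have mN: "m \<in> {1..N}" using N2 m by blast
        have quot: "S x - S z = (x - z) * ((\<Prod>n\<in>{1..N} - {m}. x - c n) * h x)" for x
        proof -
          have "(\<Prod>n\<in>{1..N}. x - c n) = (x - z) * (\<Prod>n\<in>{1..N} - {m}. x - c n)"
            unfolding prod.remove[OF finite_atLeastAtMost mN] by (simp only: m(2) c_def)
          then show ?thesis unfolding \<open>S z = 0\<close> h(2)[of x] by (simp only: mult.assoc diff_zero)
        qed
        have lim: "(\<lambda>x. (\<Prod>n\<in>{1..N} - {m}. x - c n) * h x) \<midarrow>z\<rightarrow> (\<Prod>n\<in>{1..N} - {m}. z - c n) * h z"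
        proof -
          have "continuous_on UNIV (\<lambda>x. (\<Prod>n\<in>{1..N} - {m}. x - c n) * h x)"
            by (intro continuous_intros holomorphic_on_imp_continuous_on h(1))
          then show ?thesis by (simp add: continuous_on_eq_continuous_at isCont_def)
        qed
        have "(S has_field_derivative 0) (at z)"
          unfolding has_field_derivative_iff
        proof (rule Lim_transform_eventually)
          show "(\<lambda>x. (\<Prod>n\<in>{1..N} - {m}. x - c n) * h x) \<midarrow>z\<rightarrow> 0"
            using lim by (simp only: hz mult_zero_right)
          show "\<forall>\<^sub>F x in at z. (\<Prod>n\<in>{1..N} - {m}. x - c n) * h x = (S x - S z) / (x - z)"
            unfolding quot eventually_at_filter by (rule always_eventually) simp
        qed
        then have "deriv S z = 0" by (rule DERIV_imp_deriv)
        then show False using simple m by blast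
      qed
      have circle: "norm (g z * (z - of_real R) / h z) \<le> 4 * \<epsilon> * R" if z: "norm z = R" for z
      proof -
        have pos: "(\<Prod>n\<in>{1..N}. norm (z - d n)) > 0"
        proof (intro prod_pos)
          fix n assume n: "n \<in> {1..N}"
          have "t n < R" "- R < t n" using tb[of n] N1[OF n] b_ge[of n] n Rpos by auto
          then have "norm (d n) < R" by (auto simp: d_def)
          then show "norm (z - d n) > 0" using z by auto
        qed
        have "(\<Prod>n\<in>{1..N}. norm (z - c n)) \<le> 4 * (\<Prod>n\<in>{1..N}. norm (z - d n))"
          unfolding c_def d_def
          by (rule prod_dist_interlacing_le[OF z Rpos(1), where b = b])
            (use N1 ba ab Rpos in \<open>auto simp: t_def\<close>)
        then have le: "norm (S z) \<le> 4 * (\<Prod>n\<in>{1..N}. norm (z - d n)) * norm (h z)"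
          by (simp add: h(2) norm_mult prod_norm[symmetric] mult_right_mono)
        have "(\<Prod>n\<in>{1..N}. norm (z - d n)) * (norm (g z) * norm (z - of_real R)) = norm (F z) * norm (z - of_real R)"
          by (simp add: g(2) norm_mult prod_norm[symmetric])
        also have "\<dots> \<le> \<epsilon> * R * norm (S z)" by (rule RF[OF z])
        also have "\<dots> \<le> \<epsilon> * R * (4 * (\<Prod>n\<in>{1..N}. norm (z - d n)) * norm (h z))"
          using le \<epsilon> Rpos by (intro mult_left_mono) auto
        also have "\<dots> = (\<Prod>n\<in>{1..N}. norm (z - d n)) * (4 * \<epsilon> * R * norm (h z))" by simp
        finally have "norm (g z) * norm (z - of_real R) \<le> 4 * \<epsilon> * R * norm (h z)"
          using pos by simp
        moreover have "norm (h z) > 0" using h_nz[of z] z by simp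
        ultimately show ?thesis by (simp add: norm_divide norm_mult divide_le_eq)
      qed
      have "norm (g (of_real w) * (of_real w - of_real R) / h (of_real w)) \<le> 4 * \<epsilon> * R"
      proof (rule maximum_modulus_frontier[where S = "cball 0 R" and f = "\<lambda>z. g z * (z - of_real R) / h z"])
        show "(\<lambda>z. g z * (z - of_real R) / h z) holomorphic_on interior (cball 0 R)"
          by (intro holomorphic_intros holomorphic_on_subset[OF g(1)] holomorphic_on_subset[OF h(1)])
            (use h_nz in \<open>auto simp: dist_norm less_imp_le\<close>)
        show "continuous_on (closure (cball 0 R)) (\<lambda>z. g z * (z - of_real R) / h z)"
          by (intro continuous_intros holomorphic_on_imp_continuous_on holomorphic_on_subset[OF g(1)] holomorphic_on_subset[OF h(1)])
            (use h_nz in auto)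
      qed (use circle Rpos in \<open>auto simp: frontier_cball dist_norm\<close>)
      moreover have hw: "norm (h (of_real w)) > 0" using h_nz[of "of_real w"] Rpos by auto
      ultimately have gw: "norm (g (of_real w)) * \<bar>w - R\<bar> \<le> 4 * \<epsilon> * R * norm (h (of_real w))"
        unfolding of_real_diff[symmetric] by (simp add: norm_divide norm_mult divide_le_eq del: of_real_diff)
      have "R / 2 \<le> \<bar>w - R\<bar>" using Rpos by linarith
      then have "norm (g (of_real w)) * (R / 2) \<le> norm (g (of_real w)) * \<bar>w - R\<bar>"
        by (rule mult_left_mono) simp
      with gw have "norm (g (of_real w)) * R \<le> (8 * \<epsilon> * norm (h (of_real w))) * R" by (simp add: mult_ac)
      then have gw': "norm (g (of_real w)) \<le> 8 * \<epsilon> * norm (h (of_real w))" using Rpos by simp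
      have "norm (F (of_real w)) = (\<Prod>n\<in>{1..N}. norm (of_real w - d n)) * norm (g (of_real w))"
        by (simp add: g(2) norm_mult prod_norm[symmetric])
      also have "\<dots> \<le> (\<Prod>n\<in>{1..N}. norm (of_real w - c n)) * (8 * \<epsilon> * norm (h (of_real w)))"
      proof (intro mult_mono gw' prod_mono conjI norm_ge_zero prod_nonneg)
        fix n assume n: "n \<in> {1..N}"
        then have "w < t n" "t n \<le> a n" using tb[of n] b_ge[of n] w by auto
        then show "norm (of_real w - d n) \<le> norm (of_real w - c n)"
          unfolding c_def d_def of_real_diff[symmetric] norm_of_real by simp
      qed
      also have "\<dots> = 8 * \<epsilon> * norm (S (of_real w))"
        by (simp add: h(2) norm_mult prod_norm[symmetric])
      also have "\<dots> \<le> 8 * \<epsilon> * (norm (S (of_real w)) + 1)" using \<epsilon> by (intro mult_left_mono) auto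
      also have "\<dots> = e"
      proof -
        have "norm (S (of_real w)) + 1 \<noteq> 0" using norm_ge_zero[of "S (of_real w)"] by linarith
        moreover have "8 * (e / (8 * y)) * y = e" if "y \<noteq> 0" for y :: real using that by simp
        ultimately show ?thesis unfolding \<epsilon>_def by blast
      qed
      finally show ?thesis by simp
    qed
    then have "norm (F (of_real w)) \<le> 0" by (rule field_le_epsilon)
    then show ?thesis by simp
  qed
  show ?thesis
  proof (rule analytic_continuation[OF F, of "of_real ` {..<b 1}" "of_real (b 1 - 1)"])
    show "complex_of_real (b 1 - 1) islimpt of_real ` {..<b 1}"
    proof (rule islimpt_approachable[THEN iffD2], intro allI impI)
      fix e :: real assume e: "e > 0"
      have "complex_of_real (b 1 - 1 - e / 2) \<in> of_real ` {..<b 1}" using e by (intro imageI) auto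
      then show "\<exists>x'\<in>of_real ` {..<b 1}. x' \<noteq> complex_of_real (b 1 - 1) \<and> dist x' (of_real (b 1 - 1)) < e"
        using e by (intro bexI[of _ "complex_of_real (b 1 - 1 - e / 2)"]) (auto simp: dist_of_real dist_real_def simp del: of_real_diff)
    qed
  qed (use left in auto)
qed

section \<open>Asymptotics for large spectral parameter\<close>

abbreviation "cs Q \<equiv> sol Q 1 0"
abbreviation "sn Q \<equiv> sol Q 0 1"

definition pnorm :: "(real \<Rightarrow> complex) \<Rightarrow> real" where
  "pnorm Q = integral {0..pi} (\<lambda>t. norm (Q t))"

lemma norm_integrable_initial:
  fixes Q :: "real \<Rightarrow> complex"
  assumes "Q absolutely_integrable_on {0..pi}" "x \<in> {0..pi}"
  shows "(\<lambda>t. norm (Q t)) integrable_on {0..x}"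
  by (rule integrable_on_subinterval[of _ "{0..pi}"])
    (use assms in \<open>auto simp: absolutely_integrable_on_def\<close>)

lemma pnorm_nonneg: "Q absolutely_integrable_on {0..pi} \<Longrightarrow> pnorm Q \<ge> 0"
  unfolding pnorm_def
  by (rule hk_integral_nonneg) (auto simp: absolutely_integrable_on_def)

lemma norm_kernel_integral_le:
  assumes Q: "Q absolutely_integrable_on {0..pi}" and u: "continuous_on {0..pi} u"
    and b: "\<And>t. t \<in> {0..pi} \<Longrightarrow> norm (u t) \<le> C * exp (\<bar>Im k\<bar> * t)" and C: "C \<ge> 0" and x: "x \<in> {0..pi}"
  shows "norm (integral {0..x} (\<lambda>t. sin (k * of_real (x - t)) / k * (Q t * u t))) \<le> C * pnorm Q * exp (\<bar>Im k\<bar> * x) / norm k"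
proof -
  have "norm (integral {0..x} (\<lambda>t. sin (k * of_real (x - t)) / k * (Q t * u t)))
    \<le> integral {0..x} (\<lambda>t. (C * exp (\<bar>Im k\<bar> * x) / norm k) * norm (Q t))"
  proof (rule hk_integral_norm_bound_integral)
    have "(\<lambda>t. Q t * (sin (k * of_real (x - t)) / k * u t)) absolutely_integrable_on {0..pi}"
      unfolding divide_inverse by (intro absolutely_integrable_mult_continuous Q continuous_intros u)
    from set_lebesgue_integral_eq_integral(1)[OF this]
    have "(\<lambda>t. Q t * (sin (k * of_real (x - t)) / k * u t)) integrable_on {0..x}"
      by (rule integrable_on_subinterval) (use x in auto)
    then show "(\<lambda>t. sin (k * of_real (x - t)) / k * (Q t * u t)) integrable_on {0..x}"
      by (simp only: mult.left_commute)
    show "(\<lambda>t. (C * exp (\<bar>Im k\<bar> * x) / norm k) * norm (Q t)) integrable_on {0..x}"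
      by (intro integrable_on_mult_right norm_integrable_initial Q x)
    fix t assume t: "t \<in> {0..x}"
    have "norm (sin (k * of_real (x - t))) \<le> exp (\<bar>Im k\<bar> * (x - t))"
      using norm_sin_le_exp[of "k * of_real (x - t)"] t by (simp add: abs_mult)
    then have "norm (sin (k * of_real (x - t))) * norm (u t) \<le> exp (\<bar>Im k\<bar> * (x - t)) * (C * exp (\<bar>Im k\<bar> * t))"
      using t x by (intro mult_mono b) auto
    also have "\<dots> = C * exp (\<bar>Im k\<bar> * x)"
      by (simp add: exp_add[symmetric] algebra_simps)
    finally have "norm (sin (k * of_real (x - t))) * norm (u t) / norm k * norm (Q t)
        \<le> C * exp (\<bar>Im k\<bar> * x) / norm k * norm (Q t)"
      by (intro mult_right_mono divide_right_mono) auto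
    then show "norm (sin (k * of_real (x - t)) / k * (Q t * u t)) \<le> (C * exp (\<bar>Im k\<bar> * x) / norm k) * norm (Q t)"
      by (simp add: norm_mult norm_divide mult_ac)
  qed
  also have "\<dots> = (C * exp (\<bar>Im k\<bar> * x) / norm k) * integral {0..x} (\<lambda>t. norm (Q t))"
    by simp
  also have "\<dots> \<le> (C * exp (\<bar>Im k\<bar> * x) / norm k) * pnorm Q"
    unfolding pnorm_def using x C
    by (intro mult_left_mono hk_integral_subset_le norm_integrable_initial Q) auto
  finally show ?thesis by (simp add: mult_ac)
qed

lemma sol_bound:
  assumes Q: "Q absolutely_integrable_on {0..pi}" and k: "norm k \<ge> 1" and x: "x \<in> {0..pi}"
  shows "norm (cs Q (k\<^sup>2) x) \<le> exp (pnorm Q) * exp (\<bar>Im k\<bar> * x)"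
    and "norm (sn Q (k\<^sup>2) x) \<le> exp (pnorm Q) * exp (\<bar>Im k\<bar> * x) / norm k"
proof -
  have k0: "k \<noteq> 0" using k by auto
  have e: "exp (pnorm Q / norm k) \<le> exp (pnorm Q)"
    using k k0 pnorm_nonneg[OF Q] divide_left_mono[of 1 "norm k" "pnorm Q"] by simp
  have "norm (cs Q (k\<^sup>2) x) \<le> exp (\<bar>Im k\<bar> * x) * exp (pnorm Q / norm k)"
    using ivp_integral_equation(2)[OF Q k0 sol(1)[OF Q, of "k\<^sup>2" 1 0] x] unfolding sol(2,3)[OF Q] pnorm_def by simp
  also have "\<dots> \<le> exp (\<bar>Im k\<bar> * x) * exp (pnorm Q)" by (intro mult_left_mono e) auto
  finally show "norm (cs Q (k\<^sup>2) x) \<le> exp (pnorm Q) * exp (\<bar>Im k\<bar> * x)" by (simp add: mult_ac)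
  have "norm (sn Q (k\<^sup>2) x) \<le> 1 / norm k * exp (\<bar>Im k\<bar> * x) * exp (pnorm Q / norm k)"
    using ivp_integral_equation(2)[OF Q k0 sol(1)[OF Q, of "k\<^sup>2" 0 1] x] unfolding sol(2,3)[OF Q] pnorm_def by simp
  also have "\<dots> \<le> 1 / norm k * exp (\<bar>Im k\<bar> * x) * exp (pnorm Q)" by (intro mult_left_mono e) auto
  finally show "norm (sn Q (k\<^sup>2) x) \<le> exp (pnorm Q) * exp (\<bar>Im k\<bar> * x) / norm k" by (simp add: mult_ac)
qed

text \<open>The error is exactly one application of the integral operator to the solution, so the a
  priori bound gains a factor \<open>pnorm Q / norm k\<close>.\<close>

lemma sol_first_order:
  assumes Q: "Q absolutely_integrable_on {0..pi}" and k: "norm k \<ge> 1" and x: "x \<in> {0..pi}"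
  shows "norm (cs Q (k\<^sup>2) x - cos (k * of_real x)) \<le> exp (pnorm Q) * pnorm Q / norm k * exp (\<bar>Im k\<bar> * x)"
    and "norm (sn Q (k\<^sup>2) x - sin (k * of_real x) / k) \<le> exp (pnorm Q) * pnorm Q / (norm k)\<^sup>2 * exp (\<bar>Im k\<bar> * x)"
proof -
  have k0: "k \<noteq> 0" using k by auto
  have c: "cs Q (k\<^sup>2) x - cos (k * of_real x) =
      integral {0..x} (\<lambda>t. sin (k * of_real (x - t)) / k * (Q t * cs Q (k\<^sup>2) t))"
    using ivp_integral_equation(1)[OF Q k0 sol(1)[OF Q, of "k\<^sup>2" 1 0] x] unfolding sol(2,3)[OF Q]
    by (simp add: diff_eq_eq add.commute)
  have s: "sn Q (k\<^sup>2) x - sin (k * of_real x) / k =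
      integral {0..x} (\<lambda>t. sin (k * of_real (x - t)) / k * (Q t * sn Q (k\<^sup>2) t))"
    using ivp_integral_equation(1)[OF Q k0 sol(1)[OF Q, of "k\<^sup>2" 0 1] x] unfolding sol(2,3)[OF Q]
    by (simp add: diff_eq_eq add.commute)
  show "norm (cs Q (k\<^sup>2) x - cos (k * of_real x)) \<le> exp (pnorm Q) * pnorm Q / norm k * exp (\<bar>Im k\<bar> * x)"
    unfolding c
    using norm_kernel_integral_le[OF Q sol_continuous[OF Q] sol_bound(1)[OF Q k] exp_ge_zero x]
    by (simp add: mult_ac)
  have "norm (sn Q (k\<^sup>2) t) \<le> (exp (pnorm Q) / norm k) * exp (\<bar>Im k\<bar> * t)" if "t \<in> {0..pi}" for t
    using sol_bound(2)[OF Q k that] by (simp add: mult_ac)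
  from norm_kernel_integral_le[OF Q sol_continuous[OF Q] this _ x]
  show "norm (sn Q (k\<^sup>2) x - sin (k * of_real x) / k) \<le> exp (pnorm Q) * pnorm Q / (norm k)\<^sup>2 * exp (\<bar>Im k\<bar> * x)"
    unfolding s by (simp add: mult_ac power2_eq_square)
qed

lemma oscillation_integrable:
  fixes Q g :: "real \<Rightarrow> complex"
  assumes "Q absolutely_integrable_on {0..pi}" "continuous_on {0..pi} g"
  shows "(\<lambda>t. g t * Q t) integrable_on {0..pi}"
  using set_lebesgue_integral_eq_integral(1)[OF absolutely_integrable_mult_continuous[OF assms]]
  by (simp only: mult.commute)

text \<open>The first-order error allowed for \<open>cs\<close> is of the same order as
  \<open>sn\<close> itself, so one more term of the Volterra series is computed. Product formulas
  split it into a multiple of the integral of \<open>Q\<close> and an oscillating integral; the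
  remainder is the kernel applied to the first-order error.\<close>

lemma sol_second_order:
  assumes Q: "Q absolutely_integrable_on {0..pi}" and k: "norm k \<ge> 1"
  shows "norm (cs Q (k\<^sup>2) pi - cos (k * of_real pi)
      - (sin (k * of_real pi) * integral {0..pi} Q + integral {0..pi} (\<lambda>t. sin (k * of_real (pi - 2 * t)) * Q t)) / (2 * k))
    \<le> exp (pnorm Q) * (pnorm Q)\<^sup>2 / (norm k)\<^sup>2 * exp (\<bar>Im k\<bar> * pi)" (is ?C)
    and "norm (sn Q (k\<^sup>2) pi - sin (k * of_real pi) / k
      - (integral {0..pi} (\<lambda>t. cos (k * of_real (pi - 2 * t)) * Q t) - cos (k * of_real pi) * integral {0..pi} Q) / (2 * k\<^sup>2))
    \<le> exp (pnorm Q) * (pnorm Q)\<^sup>2 / (norm k)^3 * exp (\<bar>Im k\<bar> * pi)" (is ?S)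
proof -
  have k0: "k \<noteq> 0" using k by auto
  have p: "pi \<in> {0..pi}" by simp
  have Qi: "Q integrable_on {0..pi}" by (rule set_lebesgue_integral_eq_integral(1)[OF Q])
  have ker: "(\<lambda>t. sin (k * of_real (pi - t)) / k * (Q t * g t)) integrable_on {0..pi}"
    if "continuous_on {0..pi} g" for g
  proof -
    have "(\<lambda>t. (sin (k * of_real (pi - t)) / k * g t) * Q t) integrable_on {0..pi}"
      by (rule oscillation_integrable[OF Q]) (use k0 that in \<open>auto intro!: continuous_intros\<close>)
    then show ?thesis by (simp only: mult_ac)
  qed
  have cc: "continuous_on {0..pi} (\<lambda>t. cos (k * of_real t))" and cs: "continuous_on {0..pi} (\<lambda>t. sin (k * of_real t) / k)"
    using k0 by (auto intro!: continuous_intros)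
  have trig: "sin (k * of_real (pi - t)) * cos (k * of_real t) = (sin (k * of_real pi) + sin (k * of_real (pi - 2 * t))) / 2"
    "sin (k * of_real (pi - t)) * sin (k * of_real t) = (cos (k * of_real (pi - 2 * t)) - cos (k * of_real pi)) / 2" for t
  proof -
    have e: "k * of_real pi = k * of_real (pi - t) + k * of_real t"
      "k * of_real (pi - 2 * t) = k * of_real (pi - t) - k * of_real t"
      by (simp_all add: algebra_simps)
    show "sin (k * of_real (pi - t)) * cos (k * of_real t) = (sin (k * of_real pi) + sin (k * of_real (pi - 2 * t))) / 2"
      unfolding e sin_add sin_diff by simp
    show "sin (k * of_real (pi - t)) * sin (k * of_real t) = (cos (k * of_real (pi - 2 * t)) - cos (k * of_real pi)) / 2"
      unfolding e cos_add cos_diff by simp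
  qed
  have osc: "(\<lambda>t. sin (k * of_real (pi - 2 * t)) * Q t) integrable_on {0..pi}"
    "(\<lambda>t. cos (k * of_real (pi - 2 * t)) * Q t) integrable_on {0..pi}"
    by (intro oscillation_integrable Q continuous_intros)+
  have main_c: "integral {0..pi} (\<lambda>t. sin (k * of_real (pi - t)) / k * (Q t * cos (k * of_real t)))
     = (sin (k * of_real pi) * integral {0..pi} Q + integral {0..pi} (\<lambda>t. sin (k * of_real (pi - 2 * t)) * Q t)) / (2 * k)"
  proof -
    have gen: "a / k * (q * b) = inverse (2 * k) * ((2 * (a * b)) * q)" for a b q :: complex
      using k0 by (simp add: field_simps)
    have eq: "sin (k * of_real (pi - t)) / k * (Q t * cos (k * of_real t)) =
        inverse (2 * k) * (sin (k * of_real pi) * Q t + sin (k * of_real (pi - 2 * t)) * Q t)" for t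
      unfolding gen trig by (simp add: distrib_right)
    have "integral {0..pi} (\<lambda>t. sin (k * of_real pi) * Q t + sin (k * of_real (pi - 2 * t)) * Q t) =
        sin (k * of_real pi) * integral {0..pi} Q + integral {0..pi} (\<lambda>t. sin (k * of_real (pi - 2 * t)) * Q t)"
      using hk_integral_add[OF integrable_on_mult_right[OF Qi] osc(1)]
      by (simp only: hk_integral_mult_right)
    then show ?thesis
      unfolding eq hk_integral_mult_right by (simp only: divide_inverse mult.commute)
  qed
  have main_s: "integral {0..pi} (\<lambda>t. sin (k * of_real (pi - t)) / k * (Q t * (sin (k * of_real t) / k)))
     = (integral {0..pi} (\<lambda>t. cos (k * of_real (pi - 2 * t)) * Q t) - cos (k * of_real pi) * integral {0..pi} Q) / (2 * k\<^sup>2)"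
  proof -
    have gen: "a / k * (q * (b / k)) = inverse (2 * k\<^sup>2) * ((2 * (a * b)) * q)" for a b q :: complex
      using k0 by (simp add: field_simps power2_eq_square)
    have eq: "sin (k * of_real (pi - t)) / k * (Q t * (sin (k * of_real t) / k)) =
        inverse (2 * k\<^sup>2) * (cos (k * of_real (pi - 2 * t)) * Q t - cos (k * of_real pi) * Q t)" for t
      unfolding gen trig by (simp add: left_diff_distrib)
    have "integral {0..pi} (\<lambda>t. cos (k * of_real (pi - 2 * t)) * Q t - cos (k * of_real pi) * Q t) =
        integral {0..pi} (\<lambda>t. cos (k * of_real (pi - 2 * t)) * Q t) - cos (k * of_real pi) * integral {0..pi} Q"
      using hk_integral_diff[OF osc(2) integrable_on_mult_right[OF Qi]]
      by (simp only: hk_integral_mult_right)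
    then show ?thesis
      unfolding eq hk_integral_mult_right by (simp only: divide_inverse mult.commute)
  qed
  have "cs Q (k\<^sup>2) pi - cos (k * of_real pi) - integral {0..pi} (\<lambda>t. sin (k * of_real (pi - t)) / k * (Q t * cos (k * of_real t)))
    = integral {0..pi} (\<lambda>t. sin (k * of_real (pi - t)) / k * (Q t * cs Q (k\<^sup>2) t))
      - integral {0..pi} (\<lambda>t. sin (k * of_real (pi - t)) / k * (Q t * cos (k * of_real t)))"
    using ivp_integral_equation(1)[OF Q k0 sol(1)[OF Q, of "k\<^sup>2" 1 0] p] unfolding sol(2,3)[OF Q] by simp
  also have "\<dots> = integral {0..pi} (\<lambda>t. sin (k * of_real (pi - t)) / k * (Q t * (cs Q (k\<^sup>2) t - cos (k * of_real t))))"
    using hk_integral_diff[OF ker[OF sol_continuous[OF Q]] ker[OF cc]]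
    by (simp only: right_diff_distrib)
  also have "norm \<dots> \<le> (exp (pnorm Q) * pnorm Q / norm k) * pnorm Q * exp (\<bar>Im k\<bar> * pi) / norm k"
    using pnorm_nonneg[OF Q]
    by (intro norm_kernel_integral_le Q continuous_on_diff sol_continuous cc sol_first_order(1) k p) auto
  finally show ?C unfolding main_c by (simp add: power2_eq_square mult_ac)
  have "sn Q (k\<^sup>2) pi - sin (k * of_real pi) / k - integral {0..pi} (\<lambda>t. sin (k * of_real (pi - t)) / k * (Q t * (sin (k * of_real t) / k)))
    = integral {0..pi} (\<lambda>t. sin (k * of_real (pi - t)) / k * (Q t * sn Q (k\<^sup>2) t))
      - integral {0..pi} (\<lambda>t. sin (k * of_real (pi - t)) / k * (Q t * (sin (k * of_real t) / k)))"
    using ivp_integral_equation(1)[OF Q k0 sol(1)[OF Q, of "k\<^sup>2" 0 1] p] unfolding sol(2,3)[OF Q] by simp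
  also have "\<dots> = integral {0..pi} (\<lambda>t. sin (k * of_real (pi - t)) / k * (Q t * (sn Q (k\<^sup>2) t - sin (k * of_real t) / k)))"
    using hk_integral_diff[OF ker[OF sol_continuous[OF Q]] ker[OF cs]]
    by (simp only: right_diff_distrib)
  also have "norm \<dots> \<le> (exp (pnorm Q) * pnorm Q / (norm k)\<^sup>2) * pnorm Q * exp (\<bar>Im k\<bar> * pi) / norm k"
    using pnorm_nonneg[OF Q]
    by (intro norm_kernel_integral_le Q continuous_on_diff sol_continuous cs sol_first_order(2) k p) auto
  finally show ?S unfolding main_s by (simp add: power2_eq_square power3_eq_cube mult_ac)
qed

text \<open>For \<open>\<bar>Im k\<bar> = y\<close>, sine and cosine of
  \<open>k * (pi - 2 * t)\<close> are bounded by \<open>exp (y * \<bar>pi - 2 * t\<bar>)\<close>.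
  The weight is this bound divided by \<open>exp (y * pi)\<close>; inside the interval it tends to 0
  as \<open>y\<close> grows.\<close>

definition decay :: "(real \<Rightarrow> complex) \<Rightarrow> real \<Rightarrow> real" where
  "decay Q y = integral {0..pi} (\<lambda>t. norm (Q t) * exp (- y * (pi - \<bar>pi - 2 * t\<bar>)))"

lemma decay_integrable:
  fixes Q :: "real \<Rightarrow> complex"
  assumes "Q absolutely_integrable_on {0..pi}"
  shows "(\<lambda>t. norm (Q t) * exp (- y * (pi - \<bar>pi - 2 * t\<bar>))) integrable_on {0..pi}"
proof (rule set_lebesgue_integral_eq_integral(1), rule absolutely_integrable_mult_continuous)
  show "(\<lambda>t. norm (Q t)) absolutely_integrable_on {0..pi}"
    using assms by (rule absolutely_integrable_norm[unfolded o_def])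
qed (intro continuous_intros)

lemma decay_nonneg:
  assumes "Q absolutely_integrable_on {0..pi}"
  shows "0 \<le> decay Q y"
  unfolding decay_def
  by (rule hk_integral_nonneg[OF decay_integrable[OF assms]]) simp

lemma decay_antimono:
  assumes "Q absolutely_integrable_on {0..pi}" "x \<le> y"
  shows "decay Q y \<le> decay Q x"
  unfolding decay_def
proof (rule hk_integral_le[OF decay_integrable[OF assms(1)] decay_integrable[OF assms(1)]])
  fix t assume "t \<in> {0..pi}"
  then have "0 \<le> pi - \<bar>pi - 2 * t\<bar>" by auto
  then have "x * (pi - \<bar>pi - 2 * t\<bar>) \<le> y * (pi - \<bar>pi - 2 * t\<bar>)"
    using assms(2) by (rule mult_right_mono[rotated])
  then show "norm (Q t) * exp (- y * (pi - \<bar>pi - 2 * t\<bar>)) \<le> norm (Q t) * exp (- x * (pi - \<bar>pi - 2 * t\<bar>))"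
    by (intro mult_left_mono) auto
qed

lemma decay_le_pnorm:
  assumes "Q absolutely_integrable_on {0..pi}" "0 \<le> y"
  shows "decay Q y \<le> pnorm Q"
  using decay_antimono[OF assms] by (simp add: decay_def pnorm_def)

lemma decay_small:
  assumes Q: "Q absolutely_integrable_on {0..pi}" and e: "e > 0"
  shows "\<exists>Y\<ge>0. \<forall>y\<ge>Y. decay Q y \<le> e"
proof -
  \<comment> \<open>At the two endpoints the weight is 1 for every \<open>n\<close>, so the
    pointwise limit is not 0 there; its integral still vanishes.\<close>
  let ?g = "\<lambda>t. if t \<in> {0, pi} then norm (Q t) else 0"
  have "(\<lambda>n. integral {0..pi} (\<lambda>t. norm (Q t) * exp (- real n * (pi - \<bar>pi - 2 * t\<bar>)))) \<longlonglongrightarrow> integral {0..pi} ?g"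
  proof (rule dominated_convergence(2)[where h = "\<lambda>t. norm (Q t)"])
    show "(\<lambda>t. norm (Q t)) integrable_on {0..pi}"
      using norm_integrable_initial[OF Q, of pi] by simp
    fix n :: nat and t assume t: "t \<in> {0..pi}"
    have "- real n * (pi - \<bar>pi - 2 * t\<bar>) \<le> 0"
      using t by (intro mult_nonpos_nonneg) auto
    then have "norm (Q t) * exp (- real n * (pi - \<bar>pi - 2 * t\<bar>)) \<le> norm (Q t) * 1"
      by (intro mult_left_mono) auto
    then show "norm (norm (Q t) * exp (- real n * (pi - \<bar>pi - 2 * t\<bar>))) \<le> norm (Q t)"
      by simp
  next
    fix t assume t: "t \<in> {0..pi}"
    show "(\<lambda>n. norm (Q t) * exp (- real n * (pi - \<bar>pi - 2 * t\<bar>))) \<longlonglongrightarrow> ?g t"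
    proof (cases "t \<in> {0, pi}")
      case True
      then have "pi - \<bar>pi - 2 * t\<bar> = 0" by auto
      then show ?thesis using True by simp
    next
      case False
      then have "pi - \<bar>pi - 2 * t\<bar> > 0" using t by auto
      then have "exp (- (pi - \<bar>pi - 2 * t\<bar>)) < 1" by simp
      then have "(\<lambda>n. exp (- (pi - \<bar>pi - 2 * t\<bar>)) ^ n) \<longlonglongrightarrow> 0"
        by (intro LIMSEQ_realpow_zero) simp_all
      then have "(\<lambda>n. norm (Q t) * exp (- (pi - \<bar>pi - 2 * t\<bar>)) ^ n) \<longlonglongrightarrow> norm (Q t) * 0"
        by (rule tendsto_mult_left)
      moreover have "exp (- (pi - \<bar>pi - 2 * t\<bar>)) ^ n = exp (- real n * (pi - \<bar>pi - 2 * t\<bar>))" for n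
        by (simp only: exp_of_nat_mult[symmetric] mult_minus_left mult_minus_right)
      ultimately show ?thesis using False by simp
    qed
  qed (rule decay_integrable[OF Q])
  moreover have "integral {0..pi} ?g = integral {0..pi} (\<lambda>t. 0)"
    by (rule integral_spike[of "{0, pi}"]) auto
  ultimately have "(\<lambda>n. decay Q (real n)) \<longlonglongrightarrow> 0"
    by (simp add: decay_def)
  then obtain n where "decay Q (real n) < e"
    using order_tendstoD(2)[OF _ e, of "\<lambda>n. decay Q (real n)" sequentially]
    by (metis eventually_False_sequentially eventually_mono not_less)
  then show ?thesis
    using decay_antimono[OF Q, of "real n"] by (intro exI[of _ "real n"]) (auto intro: order_trans less_imp_le)
qed

lemma norm_oscillation_le:
  assumes Q: "Q absolutely_integrable_on {0..pi}"
  shows "norm (integral {0..pi} (\<lambda>t. sin (k * of_real (pi - 2 * t)) * Q t)) \<le> decay Q \<bar>Im k\<bar> * exp (\<bar>Im k\<bar> * pi)"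
    and "norm (integral {0..pi} (\<lambda>t. cos (k * of_real (pi - 2 * t)) * Q t)) \<le> decay Q \<bar>Im k\<bar> * exp (\<bar>Im k\<bar> * pi)"
proof -
  have gen: "norm (integral {0..pi} (\<lambda>t. g t * Q t)) \<le> decay Q \<bar>Im k\<bar> * exp (\<bar>Im k\<bar> * pi)"
    if g: "continuous_on {0..pi} g" and b: "\<And>t. norm (g t) \<le> exp \<bar>Im (k * of_real (pi - 2 * t))\<bar>" for g
  proof -
    have "norm (integral {0..pi} (\<lambda>t. g t * Q t)) \<le>
      integral {0..pi} (\<lambda>t. exp (\<bar>Im k\<bar> * pi) * (norm (Q t) * exp (- \<bar>Im k\<bar> * (pi - \<bar>pi - 2 * t\<bar>))))"
    proof (rule hk_integral_norm_bound_integral)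
      show "(\<lambda>t. g t * Q t) integrable_on {0..pi}" by (rule oscillation_integrable[OF Q g])
      show "(\<lambda>t. exp (\<bar>Im k\<bar> * pi) * (norm (Q t) * exp (- \<bar>Im k\<bar> * (pi - \<bar>pi - 2 * t\<bar>)))) integrable_on {0..pi}"
        by (rule integrable_on_mult_right[OF decay_integrable[OF Q]])
      fix t :: real
      have "\<bar>Im (k * of_real (pi - 2 * t))\<bar> = \<bar>Im k\<bar> * pi + - \<bar>Im k\<bar> * (pi - \<bar>pi - 2 * t\<bar>)"
      proof -
        have "\<bar>Im (k * of_real x)\<bar> = \<bar>Im k\<bar> * \<bar>x\<bar>" for x by (simp add: abs_mult)
        moreover have "a * b = a * pi + - a * (pi - b)" for a b :: real by (simp add: algebra_simps)
        ultimately show ?thesis by metis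
      qed
      then have "norm (g t) \<le> exp (\<bar>Im k\<bar> * pi) * exp (- \<bar>Im k\<bar> * (pi - \<bar>pi - 2 * t\<bar>))"
        using b[of t] by (simp only: exp_add)
      then have "norm (g t) * norm (Q t) \<le> exp (\<bar>Im k\<bar> * pi) * exp (- \<bar>Im k\<bar> * (pi - \<bar>pi - 2 * t\<bar>)) * norm (Q t)"
        by (rule mult_right_mono) simp
      then show "norm (g t * Q t) \<le> exp (\<bar>Im k\<bar> * pi) * (norm (Q t) * exp (- \<bar>Im k\<bar> * (pi - \<bar>pi - 2 * t\<bar>)))"
        unfolding norm_mult by (simp only: mult.assoc mult.commute[of "exp (- \<bar>Im k\<bar> * (pi - \<bar>pi - 2 * t\<bar>))"])
    qed
    also have "\<dots> = exp (\<bar>Im k\<bar> * pi) * decay Q \<bar>Im k\<bar>"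
      unfolding decay_def by (rule hk_integral_mult_right)
    finally show ?thesis by (simp only: mult.commute)
  qed
  show "norm (integral {0..pi} (\<lambda>t. sin (k * of_real (pi - 2 * t)) * Q t)) \<le> decay Q \<bar>Im k\<bar> * exp (\<bar>Im k\<bar> * pi)"
    by (rule gen) (intro continuous_intros, rule norm_sin_le_exp)
  show "norm (integral {0..pi} (\<lambda>t. cos (k * of_real (pi - 2 * t)) * Q t)) \<le> decay Q \<bar>Im k\<bar> * exp (\<bar>Im k\<bar> * pi)"
    by (rule gen) (intro continuous_intros, rule norm_cos_le_exp)
qed

text \<open>The zeros of \<open>sin (k * pi)\<close> are the integers, and the radius
  \<open>n + 1 / 2\<close> stays away from them. The squared modulus is explicit, and the only term
  that can reduce it is \<open>cos (2 * Re k * pi)\<close>.\<close>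

lemma norm_sin_on_circle:
  assumes k: "norm k = real n + 1 / 2" and n: "n \<ge> 1"
  shows "exp (\<bar>Im k\<bar> * pi) / 4 \<le> norm (sin (k * of_real pi))"
proof -
  define E where "E = exp (\<bar>Im k\<bar> * pi)"
  have E: "E \<ge> 1" by (simp add: E_def)
  have E2: "exp (2 * (\<bar>Im k\<bar> * pi)) = E\<^sup>2"
    unfolding E_def by (simp add: exp_double)
  have sum: "exp (2 * (Im k * pi)) + inverse (exp (2 * (Im k * pi))) = E\<^sup>2 + inverse (E\<^sup>2)"
    unfolding E2[symmetric] by (cases "Im k \<ge> 0") (auto simp: exp_minus abs_if)
  have sq: "(norm (sin (k * of_real pi)))\<^sup>2 = (E\<^sup>2 + inverse (E\<^sup>2) - 2 * cos (2 * (Re k * pi))) / 4"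
    using norm_sin_squared[of "k * of_real pi"] sum by simp
  have "E\<^sup>2 / 16 \<le> (E\<^sup>2 + inverse (E\<^sup>2) - 2 * cos (2 * (Re k * pi))) / 4"
  \<comment> \<open>For \<open>\<bar>Im k\<bar> \<ge> 1 / 2\<close> one has
    \<open>E\<^sup>2 \<ge> 1 + pi\<close>, which outweighs the cosine. Otherwise
    \<open>\<bar>Re k\<bar>\<close> lies between \<open>n + 1 / 4\<close> and
    \<open>n + 1 / 2\<close>, where the cosine is at most 0.\<close>
  proof (cases "\<bar>Im k\<bar> \<ge> 1 / 2")
    case True
    have "pi \<le> 2 * (\<bar>Im k\<bar> * pi)" using True by simp
    then have "1 + pi \<le> E\<^sup>2"
      unfolding E2[symmetric] using exp_ge_add_one_self[of "2 * (\<bar>Im k\<bar> * pi)"] by linarith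
    then have "E\<^sup>2 \<ge> 4" using pi_gt3 by linarith
    moreover have "inverse (E\<^sup>2) \<ge> 0" by simp
    moreover have "cos (2 * (Re k * pi)) \<le> 1" by simp
    moreover have "u / 16 \<le> (u + i - 2 * c) / 4" if "u \<ge> 4" "i \<ge> 0" "c \<le> 1" for u i c :: real
      using that by (simp add: field_simps)
    ultimately show ?thesis by blast
  next
    case False
    define r where "r = \<bar>Re k\<bar>"
    have "r\<^sup>2 + (Im k)\<^sup>2 = (real n + 1 / 2)\<^sup>2"
      using cmod_power2[of k] k by (simp add: r_def)
    moreover have "(Im k)\<^sup>2 \<le> (1 / 2)\<^sup>2"
      using False by (simp add: abs_le_square_iff[symmetric])
    ultimately have "(real n + 1 / 2)\<^sup>2 - 1 / 4 \<le> r\<^sup>2" by (simp add: power2_eq_square)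
    \<comment> \<open>The difference of the two sides is \<open>n / 2 - 1 / 16\<close>, so
      \<open>n \<ge> 1\<close> enters here.\<close>
    moreover have "(real n + 1 / 4)\<^sup>2 \<le> (real n + 1 / 2)\<^sup>2 - 1 / 4"
      using n by (simp add: power2_eq_square algebra_simps)
    ultimately have "(real n + 1 / 4)\<^sup>2 \<le> r\<^sup>2" by linarith
    then have lo: "real n + 1 / 4 \<le> r" by (rule power2_le_imp_le) (simp add: r_def)
    have up: "r \<le> real n + 1 / 2" using abs_Re_le_cmod[of k] k by (simp add: r_def)
    have "pi * (1 / 2) \<le> pi * (2 * (r - real n))" "pi * (2 * (r - real n)) \<le> pi * 1"
      using lo up by (intro mult_left_mono; simp)+
    then have "cos (pi * (2 * (r - real n))) \<le> cos (pi / 2)"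
      by (intro cos_monotone_0_pi_le) auto
    also have "pi * (2 * (r - real n)) = 2 * (r * pi) - 2 * real n * pi" by (simp add: algebra_simps)
    also have "cos \<dots> = cos (2 * (r * pi))"
      unfolding cos_diff by (simp add: cos_2npi sin_2npi)
    also have "\<dots> = cos (2 * (Re k * pi))"
      by (cases "Re k \<ge> 0") (auto simp: r_def abs_if)
    finally have "cos (2 * (Re k * pi)) \<le> 0" by simp
    moreover have "inverse (E\<^sup>2) \<ge> 0" "E\<^sup>2 \<ge> 0" by simp_all
    moreover have "u / 16 \<le> (u + i - 2 * c) / 4" if "u \<ge> 0" "i \<ge> 0" "c \<le> 0" for u i c :: real
      using that by (simp add: field_simps)
    ultimately show ?thesis by blast
  qed
  then have "(E / 4)\<^sup>2 \<le> (norm (sin (k * of_real pi)))\<^sup>2"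
    unfolding sq by (simp add: power_divide)
  then show ?thesis unfolding E_def by (rule power2_le_imp_le) simp
qed

text \<open>The size condition on \<open>k\<close> makes the first-order error at most half of the
  lower bound for \<open>sin (k * pi) / k\<close>, which turns the 4 into an 8.\<close>

lemma sn_lower_bound:
  assumes Q: "Q absolutely_integrable_on {0..pi}"
    and k: "norm k = real n + 1 / 2" "n \<ge> 1" "8 * exp (pnorm Q) * pnorm Q \<le> norm k"
  shows "exp (\<bar>Im k\<bar> * pi) / (8 * norm k) \<le> norm (sn Q (k\<^sup>2) pi)"
proof -
  have k1: "norm k \<ge> 1" using k by simp
  then have k0: "norm k > 0" by linarith
  have "exp (\<bar>Im k\<bar> * pi) / (4 * norm k) \<le> norm (sin (k * of_real pi) / k)"
    using divide_right_mono[OF norm_sin_on_circle[OF k(1,2)], of "norm k"] by (simp add: norm_divide)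
  also have "\<dots> \<le> norm (sn Q (k\<^sup>2) pi) + norm (sn Q (k\<^sup>2) pi - sin (k * of_real pi) / k)"
    using norm_triangle_ineq2[of "sin (k * of_real pi) / k" "sn Q (k\<^sup>2) pi"] by (simp add: norm_minus_commute)
  also have "norm (sn Q (k\<^sup>2) pi - sin (k * of_real pi) / k) \<le> exp (pnorm Q) * pnorm Q / (norm k)\<^sup>2 * exp (\<bar>Im k\<bar> * pi)"
    using sol_first_order(2)[OF Q k1, of pi] by simp
  also have "\<dots> \<le> exp (\<bar>Im k\<bar> * pi) / (8 * norm k)"
  proof -
    have "exp (pnorm Q) * pnorm Q / (norm k)\<^sup>2 \<le> 1 / (8 * norm k)"
      using k(3) k0 by (simp add: field_simps power2_eq_square)
    then have "exp (pnorm Q) * pnorm Q / (norm k)\<^sup>2 * exp (\<bar>Im k\<bar> * pi) \<le> 1 / (8 * norm k) * exp (\<bar>Im k\<bar> * pi)"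
      by (rule mult_right_mono) simp
    then show ?thesis by simp
  qed
  finally have "exp (\<bar>Im k\<bar> * pi) / (4 * norm k) \<le> norm (sn Q (k\<^sup>2) pi) + exp (\<bar>Im k\<bar> * pi) / (8 * norm k)" by simp
  moreover have "exp (\<bar>Im k\<bar> * pi) / (4 * norm k) = exp (\<bar>Im k\<bar> * pi) / (8 * norm k) + exp (\<bar>Im k\<bar> * pi) / (8 * norm k)"
    by (simp add: field_simps)
  ultimately show ?thesis by linarith
qed

text \<open>With \<open>z = k\<^sup>2\<close> and \<open>R = norm z\<close> one has \<open>norm (z - R) = 2 * norm k * \<bar>Im k\<bar>\<close>. Hence it
  suffices that \<^const>\<open>decay\<close> tends to 0 as \<open>\<bar>Im k\<bar>\<close> grows, and no uniform Riemann-Lebesgue lemma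
  is needed near the real axis.\<close>
lemma small_relative_to_sn:
  assumes Q: "Q absolutely_integrable_on {0..pi}" and P: "P absolutely_integrable_on {0..pi}" and K: "K \<ge> 0"
    and F: "\<And>k. norm k \<ge> 1 \<Longrightarrow> norm (F (k\<^sup>2)) \<le> exp (\<bar>Im k\<bar> * pi) / norm k * (decay P \<bar>Im k\<bar> + K / norm k)"
    and e: "e > 0"
  shows "\<exists>R\<ge>R\<^sub>0. \<forall>z. norm z = R \<longrightarrow>
    sn Q z pi \<noteq> 0 \<and> norm (F z) * norm (z - of_real R) \<le> e * R * norm (sn Q z pi)"
proof -
  \<comment> \<open>The 32 is the 8 of \<open>sn_lower_bound\<close>, times 2 from the length
    \<open>2 * norm k * \<bar>Im k\<bar>\<close>, times 2 for the two error terms.\<close>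
  obtain Y where Y: "Y \<ge> 0" "\<And>y. y \<ge> Y \<Longrightarrow> decay P y \<le> e / 32"
    using decay_small[OF P, of "e / 32"] e by auto
  define B where "B = pnorm P"
  have B: "B \<ge> 0" unfolding B_def by (rule pnorm_nonneg[OF P])
  \<comment> \<open>The summands serve the later demands on \<open>X\<close> in turn: the remainder
    \<open>K\<close>, the range of small \<open>y\<close>, the lower bound for \<open>sn\<close>,
    the limit \<open>R\<^sub>0\<close>, and \<open>n \<ge> 1\<close>.\<close>
  obtain n :: nat where n: "32 * K / e + 32 * Y * B / e + 8 * exp (pnorm Q) * pnorm Q + \<bar>R\<^sub>0\<bar> + 1 \<le> real n"
    using real_arch_simple by blast
  define X where "X = real n + 1 / 2"
  have nn: "32 * K / e \<ge> 0" "32 * Y * B / e \<ge> 0" "8 * exp (pnorm Q) * pnorm Q \<ge> 0"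
    using K e Y B pnorm_nonneg[OF Q] by simp_all
  have n1: "n \<ge> 1" using n nn by linarith
  have X: "X \<ge> 1" "32 * K / e \<le> X" "32 * Y * B / e \<le> X" "8 * exp (pnorm Q) * pnorm Q \<le> X" "\<bar>R\<^sub>0\<bar> \<le> X"
    using n nn n1 unfolding X_def by linarith+
  have X': "32 * K \<le> e * X" "32 * Y * B \<le> e * X"
    using X(2,3) e by (simp_all add: divide_le_eq mult.commute)
  have "X * 1 \<le> X * X" using X(1) by (intro mult_left_mono) auto
  then have RX: "R\<^sub>0 \<le> X\<^sup>2" using X(5) unfolding power2_eq_square by linarith
  have "sn Q z pi \<noteq> 0 \<and> norm (F z) * norm (z - of_real (X\<^sup>2)) \<le> e * X\<^sup>2 * norm (sn Q z pi)"
    if z: "norm z = X\<^sup>2" for z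
  proof -
    define k where "k = csqrt z"
    have k2: "k\<^sup>2 = z" by (simp add: k_def)
    have kX: "norm k = X"
      using z X(1) unfolding k2[symmetric] norm_power by (simp add: power2_eq_iff_nonneg)
    define y where "y = \<bar>Im k\<bar>"
    have y: "0 \<le> y" "y \<le> X" using abs_Im_le_cmod[of k] kX by (auto simp: y_def)
    have lower: "exp (y * pi) / (8 * X) \<le> norm (sn Q z pi)"
      using sn_lower_bound[OF Q, of k n] n1 X(4) kX unfolding k2 y_def X_def by simp
    have "norm (z - of_real (X\<^sup>2)) = 2 * X * y"
    proof -
      have "of_real (X\<^sup>2) = k * cnj k"
        using complex_norm_square[of k] kX by simp
      then have "z - of_real (X\<^sup>2) = k * (k - cnj k)"
        unfolding k2[symmetric] by (simp add: power2_eq_square right_diff_distrib)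
      also have "k - cnj k = of_real (2 * Im k) * \<i>"
        by (simp add: complex_diff_cnj)
      finally show ?thesis by (simp add: norm_mult kX y_def)
    qed
    moreover have "norm (F z) \<le> exp (y * pi) / X * (decay P y + K / X)"
      using F[of k] X(1) unfolding k2 kX y_def by blast
    then have "norm (F z) * (2 * X * y) \<le> exp (y * pi) / X * (decay P y + K / X) * (2 * X * y)"
      by (rule mult_right_mono) (use X(1) y in simp)
    ultimately have "norm (F z) * norm (z - of_real (X\<^sup>2)) \<le> exp (y * pi) / X * (decay P y + K / X) * (2 * X * y)"
      by (simp only:)
    also have "\<dots> = 2 * exp (y * pi) * (y * decay P y + y * (K / X))"
      using X(1) by (simp add: field_simps)
    also have "\<dots> \<le> 2 * exp (y * pi) * (e * X / 32 + e * X / 32)"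
    proof (intro mult_left_mono add_mono)
      have "y / X \<le> 1" using y X(1) by simp
      then have "y / X * K \<le> 1 * K" using K by (rule mult_right_mono)
      then have "y * (K / X) \<le> K" by simp
      then show "y * (K / X) \<le> e * X / 32" using X' by linarith
      show "y * decay P y \<le> e * X / 32"
      \<comment> \<open>For large \<open>y\<close> the decay is small and \<open>y \<le> X\<close>.
        For small \<open>y\<close> the decay is only bounded, but the factor \<open>y\<close> is
        then at most \<open>Y\<close> and \<open>X\<close> has been chosen large against it.\<close>
      proof (cases "y \<ge> Y")
        case True
        then have "y * decay P y \<le> X * (e / 32)"
          using y Y decay_nonneg[OF P] e X(1) by (intro mult_mono) auto
        then show ?thesis by (simp add: mult.commute)
      next
        case False
        then have "y * decay P y \<le> Y * B"
          unfolding B_def using y Y decay_nonneg[OF P] decay_le_pnorm[OF P] by (intro mult_mono) auto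
        then show ?thesis using X' by linarith
      qed
    qed auto
    also have "\<dots> = e * X\<^sup>2 * (exp (y * pi) / (8 * X))"
      using X(1) by (simp add: field_simps power2_eq_square)
    also have "\<dots> \<le> e * X\<^sup>2 * norm (sn Q z pi)"
      using lower e by (intro mult_left_mono) auto
    finally have main: "norm (F z) * norm (z - of_real (X\<^sup>2)) \<le> e * X\<^sup>2 * norm (sn Q z pi)" .
    have "exp (y * pi) / (8 * X) > 0" using X(1) by simp
    with lower have "sn Q z pi \<noteq> 0" by auto
    with main show ?thesis by blast
  qed
  with RX show ?thesis by blast
qed

text \<open>The free term is common to both functions, so only first-order errors remain; compared
  with \<open>sn\<close> they are smaller by one power of \<open>k\<close>.\<close>

lemma sn_diff_bound:
  assumes Q: "Q absolutely_integrable_on {0..pi}" and P: "P absolutely_integrable_on {0..pi}" and k: "norm k \<ge> 1"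
  shows "norm (sn Q (k\<^sup>2) pi - sn P (k\<^sup>2) pi) \<le>
    exp (\<bar>Im k\<bar> * pi) / norm k * ((exp (pnorm Q) * pnorm Q + exp (pnorm P) * pnorm P) / norm k)"
proof -
  have p: "pi \<in> {0..pi}" by simp
  have "norm (sn Q (k\<^sup>2) pi - sn P (k\<^sup>2) pi) \<le> norm (sn Q (k\<^sup>2) pi - sin (k * of_real pi) / k)
      + norm (sn P (k\<^sup>2) pi - sin (k * of_real pi) / k)"
    using norm_triangle_ineq4[of "sn Q (k\<^sup>2) pi - sin (k * of_real pi) / k" "sn P (k\<^sup>2) pi - sin (k * of_real pi) / k"]
    by simp
  also have "\<dots> \<le> exp (pnorm Q) * pnorm Q / (norm k)\<^sup>2 * exp (\<bar>Im k\<bar> * pi)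
      + exp (pnorm P) * pnorm P / (norm k)\<^sup>2 * exp (\<bar>Im k\<bar> * pi)"
    by (intro add_mono sol_first_order(2) Q P k p)
  also have "\<dots> = exp (\<bar>Im k\<bar> * pi) / norm k * ((exp (pnorm Q) * pnorm Q + exp (pnorm P) * pnorm P) / norm k)"
    by (simp add: add_divide_distrib distrib_left power2_eq_square mult.commute)
  finally show ?thesis .
qed

lemma integral_diff_potentials:
  fixes Q P g :: "real \<Rightarrow> complex"
  assumes Q: "Q absolutely_integrable_on {0..pi}" and P: "P absolutely_integrable_on {0..pi}"
    and g: "continuous_on {0..pi} g"
  shows "integral {0..pi} (\<lambda>t. g t * (Q t - P t)) = integral {0..pi} (\<lambda>t. g t * Q t) - integral {0..pi} (\<lambda>t. g t * P t)"
  using hk_integral_diff[OF oscillation_integrable[OF Q g] oscillation_integrable[OF P g]]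
  by (simp only: right_diff_distrib)

text \<open>Equality of the means removes the term with \<open>sin (k * pi)\<close>, the obstacle to
  smallness relative to \<open>sn\<close>. The other second-order term is an oscillating integral of
  \<open>Q - P\<close>, measured by \<open>decay\<close>.\<close>

lemma cs_diff_bound:
  assumes Q: "Q absolutely_integrable_on {0..pi}" and P: "P absolutely_integrable_on {0..pi}"
    and mean: "integral {0..pi} Q = integral {0..pi} P" and k: "norm k \<ge> 1"
  shows "norm (cs Q (k\<^sup>2) pi - cs P (k\<^sup>2) pi) \<le> exp (\<bar>Im k\<bar> * pi) / norm k *
    (decay (\<lambda>t. Q t - P t) \<bar>Im k\<bar> + (exp (pnorm Q) * (pnorm Q)\<^sup>2 + exp (pnorm P) * (pnorm P)\<^sup>2) / norm k)"
proof -
  have D: "(\<lambda>t. Q t - P t) absolutely_integrable_on {0..pi}"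
    by (rule set_integral_diff(1)[OF Q P])
  have k0: "norm k > 0" using k by linarith
  let ?T = "exp (\<bar>Im k\<bar> * pi)" and ?O = "\<lambda>Q. integral {0..pi} (\<lambda>t. sin (k * of_real (pi - 2 * t)) * Q t)"
  let ?r = "\<lambda>Q. cs Q (k\<^sup>2) pi - cos (k * of_real pi) - (sin (k * of_real pi) * integral {0..pi} Q + ?O Q) / (2 * k)"
  have "c - d = (c - u - (m + i) / w) - (d - u - (m + j) / w) + (i - j) / w" for c d u m i j w :: complex
    by (simp add: add_divide_distrib diff_divide_distrib)
  then have *: "cs Q (k\<^sup>2) pi - cs P (k\<^sup>2) pi = ?r Q - ?r P + (?O Q - ?O P) / (2 * k)"
    unfolding mean .
  have O: "?O Q - ?O P = ?O (\<lambda>t. Q t - P t)"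
    by (rule integral_diff_potentials[OF Q P, symmetric]) (intro continuous_intros)
  have "norm (cs Q (k\<^sup>2) pi - cs P (k\<^sup>2) pi) \<le> norm (?r Q) + norm (?r P) + norm (?O (\<lambda>t. Q t - P t) / (2 * k))"
    unfolding * O by (rule order_trans[OF norm_triangle_ineq add_right_mono[OF norm_triangle_ineq4]])
  also have "\<dots> \<le> exp (pnorm Q) * (pnorm Q)\<^sup>2 / (norm k)\<^sup>2 * ?T + exp (pnorm P) * (pnorm P)\<^sup>2 / (norm k)\<^sup>2 * ?T
      + decay (\<lambda>t. Q t - P t) \<bar>Im k\<bar> * ?T / norm k"
  proof (intro add_mono sol_second_order(1) Q P k)
    have half: "y / 2 \<le> y" if "0 \<le> y" for y :: real using that by simp
    have "norm (?O (\<lambda>t. Q t - P t) / (2 * k)) \<le> norm (?O (\<lambda>t. Q t - P t)) / norm k"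
    proof -
      have "norm (x / (2 * k)) = norm x / norm k / 2" for x by (simp add: norm_divide norm_mult)
      then show ?thesis by (simp only:) (rule half, simp)
    qed
    also have "\<dots> \<le> decay (\<lambda>t. Q t - P t) \<bar>Im k\<bar> * ?T / norm k"
      by (intro divide_right_mono norm_oscillation_le(1) D) simp
    finally show "norm (?O (\<lambda>t. Q t - P t) / (2 * k)) \<le> decay (\<lambda>t. Q t - P t) \<bar>Im k\<bar> * ?T / norm k" .
  qed
  also have "\<dots> = ?T / norm k * (decay (\<lambda>t. Q t - P t) \<bar>Im k\<bar> + (exp (pnorm Q) * (pnorm Q)\<^sup>2 + exp (pnorm P) * (pnorm P)\<^sup>2) / norm k)"
  proof -
    have "a / x\<^sup>2 * T + b / x\<^sup>2 * T + d * T / x = T / x * (d + (a + b) / x)" if "x > 0" for a b d T x :: real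
      using that by (simp add: field_simps power2_eq_square)
    from this[OF k0] show ?thesis .
  qed
  finally show ?thesis .
qed

lemma cosh_lower_bound: "exp (x * pi) / 2 \<le> norm (cos (\<i> * of_real x * of_real pi))"
proof -
  have "cos (\<i> * of_real x * of_real pi) = of_real ((exp (x * pi) + inverse (exp (x * pi))) / 2)"
    by (simp only: cosh_real of_real_mult mult.assoc)
  then have "norm (cos (\<i> * of_real x * of_real pi)) = \<bar>(exp (x * pi) + inverse (exp (x * pi))) / 2\<bar>"
    by (simp only: norm_of_real)
  moreover have "(exp (x * pi) + inverse (exp (x * pi))) / 2 \<ge> exp (x * pi) / 2" by simp
  ultimately show ?thesis by linarith
qed

text \<open>On the imaginary axis \<open>cos (k * pi)\<close> has the full size
  \<open>exp (x * pi)\<close>, whereas the oscillating integrals and the remainders, multiplied by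
  \<open>2 * k\<^sup>2\<close>, are of smaller order. Comparing the expansions of the two equal
  functions therefore isolates the difference of the means.\<close>

lemma mean_eq_of_sn_eq:
  assumes Q: "Q absolutely_integrable_on {0..pi}" and P: "P absolutely_integrable_on {0..pi}"
    and eq: "\<And>z. sn Q z pi = sn P z pi"
  shows "integral {0..pi} Q = integral {0..pi} P"
proof -
  have D: "(\<lambda>t. Q t - P t) absolutely_integrable_on {0..pi}"
    by (rule set_integral_diff(1)[OF Q P])
  define K where "K = exp (pnorm Q) * (pnorm Q)\<^sup>2 + exp (pnorm P) * (pnorm P)\<^sup>2"
  have K: "K \<ge> 0" by (simp add: K_def)
  define m where "m = norm (integral {0..pi} Q - integral {0..pi} P)"
  have swap: "c = d - a" if "a = d - c" for a c d :: complex
    using that by simp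
  have bound: "m \<le> 2 * decay (\<lambda>t. Q t - P t) x + 4 * K / x" if x: "x \<ge> 1" for x
  proof -
    define k where "k = \<i> * of_real x"
    have k: "norm k = x" "\<bar>Im k\<bar> = x" "norm k \<ge> 1" using x by (auto simp: k_def norm_mult)
    let ?T = "exp (x * pi)" and ?O = "\<lambda>Q. integral {0..pi} (\<lambda>t. cos (k * of_real (pi - 2 * t)) * Q t)"
    let ?r = "\<lambda>Q. sn Q (k\<^sup>2) pi - sin (k * of_real pi) / k - (?O Q - cos (k * of_real pi) * integral {0..pi} Q) / (2 * k\<^sup>2)"
    have rQ: "norm (?r Q) \<le> exp (pnorm Q) * (pnorm Q)\<^sup>2 / x^3 * ?T"
      and rP: "norm (?r P) \<le> exp (pnorm P) * (pnorm P)\<^sup>2 / x^3 * ?T"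
      using sol_second_order(2)[OF Q k(3)] sol_second_order(2)[OF P k(3)] unfolding k(1,2) by auto
    have O: "?O Q - ?O P = ?O (\<lambda>t. Q t - P t)"
      by (rule integral_diff_potentials[OF Q P, symmetric]) (intro continuous_intros)
    have "?r P - ?r Q = (?O Q - ?O P - cos (k * of_real pi) * (integral {0..pi} Q - integral {0..pi} P)) / (2 * k\<^sup>2)"
      by (simp add: eq diff_divide_distrib right_diff_distrib)
    then have "(2 * k\<^sup>2) * (?r P - ?r Q) = ?O Q - ?O P - cos (k * of_real pi) * (integral {0..pi} Q - integral {0..pi} P)"
      using x by (simp add: k_def)
    note this[unfolded O]
    then have "cos (k * of_real pi) * (integral {0..pi} Q - integral {0..pi} P) = ?O (\<lambda>t. Q t - P t) - (2 * k\<^sup>2) * (?r P - ?r Q)"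
      by (rule swap)
    then have "norm (cos (k * of_real pi)) * m = norm (?O (\<lambda>t. Q t - P t) - (2 * k\<^sup>2) * (?r P - ?r Q))"
      unfolding m_def norm_mult[symmetric] by (simp only:)
    also have "\<dots> \<le> norm (?O (\<lambda>t. Q t - P t)) + norm ((2 * k\<^sup>2) * (?r P - ?r Q))"
      by (rule norm_triangle_ineq4)
    also have "\<dots> \<le> norm (?O (\<lambda>t. Q t - P t)) + (2 * x\<^sup>2) * (norm (?r P) + norm (?r Q))"
      unfolding norm_mult norm_power k(1) by (intro add_left_mono mult_mono norm_triangle_ineq4) auto
    also have "\<dots> \<le> decay (\<lambda>t. Q t - P t) x * ?T + (2 * x\<^sup>2) * (exp (pnorm P) * (pnorm P)\<^sup>2 / x^3 * ?T + exp (pnorm Q) * (pnorm Q)\<^sup>2 / x^3 * ?T)"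
      using norm_oscillation_le(2)[OF D, of k] unfolding k(2)
      by (intro add_mono mult_left_mono rQ rP) auto
    also have "\<dots> = ?T / 2 * (2 * decay (\<lambda>t. Q t - P t) x + 4 * K / x)"
      using x by (simp add: K_def field_simps power2_eq_square power3_eq_cube)
    finally have "norm (cos (k * of_real pi)) * m \<le> ?T / 2 * (2 * decay (\<lambda>t. Q t - P t) x + 4 * K / x)" .
    moreover have "?T / 2 * m \<le> norm (cos (k * of_real pi)) * m"
      unfolding k_def m_def by (intro mult_right_mono cosh_lower_bound) auto
    ultimately have "?T / 2 * m \<le> ?T / 2 * (2 * decay (\<lambda>t. Q t - P t) x + 4 * K / x)" by linarith
    then show ?thesis by simp
  qed
  have "m \<le> 0 + e" if e: "e > 0" for e
  proof -
    obtain Y where Y: "\<And>y. y \<ge> Y \<Longrightarrow> decay (\<lambda>t. Q t - P t) y \<le> e / 4"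
      using decay_small[OF D, of "e / 4"] e by auto
    define x where "x = max (max 1 Y) (8 * K / e)"
    have x: "x \<ge> 1" "x \<ge> Y" "8 * K / e \<le> x" by (auto simp: x_def)
    then have "4 * K / x \<le> e / 2" using e K by (simp add: field_simps)
    with bound[OF x(1)] Y[OF x(2)] show ?thesis by linarith
  qed
  then have "m \<le> 0" by (rule field_le_epsilon)
  then show ?thesis by (simp add: m_def)
qed

text \<open>At \<open>z = - (x\<^sup>2)\<close> the free solutions are \<open>cosh\<close> and
  \<open>sinh\<close> divided by \<open>x\<close>, and \<open>x \<ge> 8 * K\<close> keeps the error
  below their size. The signs far to the left decide which of the two spectra starts first.\<close>

lemma sol_positive_at_minus_infinity:
  assumes Q: "Q absolutely_integrable_on {0..pi}"
  shows "\<exists>X. \<forall>x\<ge>X. Re (sn Q (of_real (- (x\<^sup>2))) pi) > 0 \<and> Re (cs Q (of_real (- (x\<^sup>2))) pi) > 0"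
proof -
  define K where "K = exp (pnorm Q) * pnorm Q"
  have "Re (sn Q (of_real (- (x\<^sup>2))) pi) > 0 \<and> Re (cs Q (of_real (- (x\<^sup>2))) pi) > 0"
    if x: "x \<ge> max 1 (8 * K)" for x
  proof -
    define k where "k = \<i> * of_real x"
    have k: "norm k = x" "\<bar>Im k\<bar> = x" "norm k \<ge> 1" using x by (auto simp: k_def norm_mult)
    have k2: "k\<^sup>2 = of_real (- (x\<^sup>2))" by (simp add: k_def power_mult_distrib)
    have p: "pi \<in> {0..pi}" by simp
    let ?T = "exp (x * pi)"
    have x0: "x > 0" using x by simp
    have cosk: "cos (k * of_real pi) = of_real ((?T + inverse ?T) / 2)"
      by (simp only: k_def cosh_real of_real_mult mult.assoc)
    have sink: "sin (k * of_real pi) / k = of_real ((?T - inverse ?T) / (2 * x))"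
    proof -
      have sine: "sin (k * of_real pi) = \<i> * of_real ((?T - inverse ?T) / 2)"
      proof -
        have "of_real ((?T - inverse ?T) / 2) = - \<i> * sin (k * of_real pi)"
          by (simp only: k_def sinh_real of_real_mult mult.assoc)
        then show ?thesis by simp
      qed
      have "\<i> * of_real a / (\<i> * of_real x) = complex_of_real (a / x)" for a by simp
      then show ?thesis unfolding sine unfolding k_def by (simp only: divide_divide_eq_left)
    qed
    have Tge: "?T \<ge> 2"
    proof -
      have "1 * 3 \<le> x * pi" using x pi_gt3 by (intro mult_mono) auto
      then show ?thesis using exp_ge_add_one_self[of "x * pi"] by linarith
    qed
    then have invT: "inverse ?T \<le> 1 / 2" using le_imp_inverse_le[of 2 ?T] by simp
    have KT: "K / x * ?T \<le> ?T / 8"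
      using x x0 mult_right_mono[of "K / x" "1 / 8" ?T] by (simp add: field_simps)
    have "\<bar>Re (cs Q (k\<^sup>2) pi - cos (k * of_real pi))\<bar> \<le> K / x * ?T"
      using order_trans[OF abs_Re_le_cmod sol_first_order(1)[OF Q k(3) p]] unfolding k K_def .
    then have "Re (cos (k * of_real pi)) - ?T / 8 \<le> Re (cs Q (k\<^sup>2) pi)"
      using KT unfolding minus_complex.simps by linarith
    moreover have "Re (cos (k * of_real pi)) = (?T + inverse ?T) / 2"
      unfolding cosk by (rule Re_complex_of_real)
    moreover have "inverse ?T > 0" by simp
    ultimately have "Re (cs Q (k\<^sup>2) pi) > 0" using Tge by argo
    have "\<bar>Re (sn Q (k\<^sup>2) pi - sin (k * of_real pi) / k)\<bar> \<le> K / x\<^sup>2 * ?T"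
      using order_trans[OF abs_Re_le_cmod sol_first_order(2)[OF Q k(3) p]] unfolding k K_def .
    also have "\<dots> = (K / x * ?T) / x" by (simp add: power2_eq_square)
    also have "\<dots> \<le> (?T / 8) / x" using KT x0 by (intro divide_right_mono) auto
    finally have "Re (sin (k * of_real pi) / k) - ?T / 8 / x \<le> Re (sn Q (k\<^sup>2) pi)"
      unfolding minus_complex.simps by linarith
    moreover have "Re (sin (k * of_real pi) / k) = ((?T - inverse ?T) / 2) / x"
      unfolding sink Re_complex_of_real by (simp only: divide_divide_eq_left)
    moreover have "((?T - inverse ?T) / 2) / x - ?T / 8 / x > 0"
    proof -
      have "(?T - inverse ?T) / 2 - ?T / 8 > 0" using Tge invT by argo
      then show ?thesis using x0 by (simp add: diff_divide_distrib[symmetric] del: times_divide_eq_left divide_divide_eq_left)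
    qed
    ultimately have "Re (sn Q (k\<^sup>2) pi) > 0" by linarith
    with \<open>Re (cs Q (k\<^sup>2) pi) > 0\<close> show ?thesis unfolding k2 by blast
  qed
  then show ?thesis by blast
qed

section \<open>The spectra and the point masses\<close>

lemma wronskian_cs_sn:
  assumes "Q absolutely_integrable_on {0..pi}" "x \<in> {0..pi}"
  shows "cs Q z x * sol' Q 0 1 z x - sol' Q 1 0 z x * sn Q z x = 1"
  using wronskian_identity[OF assms(1) sol(1)[OF assms(1), of z 1 0] sol(1)[OF assms(1), of z 0 1] assms(2)]
  by (simp add: sol(2,3)[OF assms(1)])

lemma ivp_solution_expand:
  assumes Q: "Q absolutely_integrable_on {0..pi}" and u: "ivp_solution Q z u u'" and x: "x \<in> {0..pi}"
  shows "u x = u 0 * cs Q z x + u' 0 * sn Q z x"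
proof -
  have "cs Q z 0 * sol' Q 0 1 z 0 - sol' Q 1 0 z 0 * sn Q z 0 = 1"
    by (rule wronskian_cs_sn[OF Q]) simp
  from ivp_solution_variation[OF Q u sol(1)[OF Q] sol(1)[OF Q] this x]
  show ?thesis by (simp add: sol(2,3)[OF Q])
qed

lemma sol_nontrivial:
  assumes Q: "Q absolutely_integrable_on {0..pi}" and nz: "\<alpha> \<noteq> 0 \<or> \<beta> \<noteq> 0"
  shows "\<exists>x\<in>{0..pi}. sol Q \<alpha> \<beta> z x \<noteq> 0"
proof (rule ccontr)
  assume "\<not> ?thesis"
  then have z: "sol Q \<alpha> \<beta> z x = 0" if "x \<in> {0..pi}" for x using that by blast
  have "ivp_solution Q z (\<lambda>_. 0) (\<lambda>_. 0)" by (simp add: ivp_solution_def)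
  from ivp_solution_deriv_unique[OF sol(1)[OF Q] this z, of 0]
  have "\<beta> = 0" by (simp add: sol(3)[OF Q])
  moreover have "\<alpha> = 0" using z[of 0] by (simp add: sol(2)[OF Q])
  ultimately show False using nz by simp
qed

lemma sn_cs_not_both_zero:
  assumes "Q absolutely_integrable_on {0..pi}" "x \<in> {0..pi}" "sn Q z x = 0"
  shows "cs Q z x \<noteq> 0"
  using wronskian_cs_sn[OF assms(1,2), of z] assms(3) by auto

lemma DD_spectrum_eq:
  assumes q: "q absolutely_integrable_on {0..pi}"
  shows "DD_spectrum q = {z. sn (\<lambda>t. of_real (q t)) z pi = 0}"
proof -
  let ?Q = "\<lambda>t. complex_of_real (q t)"
  have Q: "?Q absolutely_integrable_on {0..pi}" by (rule absolutely_integrable_of_real[OF q])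
  have p: "pi \<in> {0..pi}" by simp
  have "sn ?Q z pi = 0" if z: "z \<in> DD_spectrum q" for z
  proof -
    obtain u u' x where u: "ivp_solution ?Q z u u'" "x \<in> {0..pi}" "u x \<noteq> 0" "u 0 = 0" "u pi = 0"
      using z unfolding DD_spectrum_def schroedinger_solution_iff[OF q] by blast
    note ivp_solution_expand[OF Q u(1) p] ivp_solution_expand[OF Q u(1,2)]
    with u(3-5) show ?thesis by auto
  qed
  moreover have "z \<in> DD_spectrum q" if "sn ?Q z pi = 0" for z
    using that sol(1)[OF Q, of z 0 1] sol(2)[OF Q, of 0 1 z] sol_nontrivial[OF Q, of 0 1 z]
    unfolding DD_spectrum_def schroedinger_solution_iff[OF q] mem_Collect_eq
    by (intro exI[of _ "sn ?Q z"] exI[of _ "sol' ?Q 0 1 z"]) simp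
  ultimately show ?thesis by blast
qed

lemma ND_spectrum_eq:
  assumes q: "q absolutely_integrable_on {0..pi}"
  shows "ND_spectrum q = {z. cs (\<lambda>t. of_real (q t)) z pi = 0}"
proof -
  let ?Q = "\<lambda>t. complex_of_real (q t)"
  have Q: "?Q absolutely_integrable_on {0..pi}" by (rule absolutely_integrable_of_real[OF q])
  have p: "pi \<in> {0..pi}" by simp
  have "cs ?Q z pi = 0" if z: "z \<in> ND_spectrum q" for z
  proof -
    obtain u u' x where u: "ivp_solution ?Q z u u'" "x \<in> {0..pi}" "u x \<noteq> 0" "u' 0 = 0" "u pi = 0"
      using z unfolding ND_spectrum_def schroedinger_solution_iff[OF q] by blast
    note ivp_solution_expand[OF Q u(1) p] ivp_solution_expand[OF Q u(1,2)]
    with u(3-5) show ?thesis by auto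
  qed
  moreover have "z \<in> ND_spectrum q" if "cs ?Q z pi = 0" for z
    using that sol(1)[OF Q, of z 1 0] sol(3)[OF Q, of 1 0 z] sol_nontrivial[OF Q, of 1 0 z]
    unfolding ND_spectrum_def schroedinger_solution_iff[OF q] mem_Collect_eq
    by (intro exI[of _ "cs ?Q z"] exI[of _ "sol' ?Q 1 0 z"]) simp
  ultimately show ?thesis by blast
qed

lemma ivp_solution_cnj:
  assumes "ivp_solution Q z u u'"
  shows "ivp_solution (\<lambda>t. cnj (Q t)) (cnj z) (\<lambda>t. cnj (u t)) (\<lambda>t. cnj (u' t))"
  unfolding ivp_solution_def
proof (intro conjI ballI)
  fix x :: real assume x: "x \<in> {0..pi}"
  show "((\<lambda>t. cnj (u t)) has_vector_derivative cnj (u' x)) (at x within {0..pi})"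
    by (rule bounded_linear.has_vector_derivative[OF bounded_linear_cnj ivp_solution_has_vector_derivative[OF assms x]])
  show "cnj (u' x) = cnj (u' 0) + integral {0..x} (\<lambda>t. (cnj (Q t) - cnj z) * cnj (u t))"
    unfolding ivp_solution_deriv_eq[OF assms x] complex_cnj_add hk_integral_cnj by simp
qed

text \<open>Conjugating a solution with real potential, parameter and data gives a solution of the
  same problem, so uniqueness applies.\<close>

lemma sol_real:
  assumes q: "q absolutely_integrable_on {0..pi}" and x: "x \<in> {0..pi}"
  shows "sol (\<lambda>t. of_real (q t)) (of_real \<alpha>) (of_real \<beta>) (of_real w) x =
    of_real (Re (sol (\<lambda>t. of_real (q t)) (of_real \<alpha>) (of_real \<beta>) (of_real w) x))"
proof -
  let ?Q = "\<lambda>t. complex_of_real (q t)"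
  have Q: "?Q absolutely_integrable_on {0..pi}" by (rule absolutely_integrable_of_real[OF q])
  have "ivp_solution ?Q (of_real w) (\<lambda>t. cnj (sol ?Q (of_real \<alpha>) (of_real \<beta>) (of_real w) t))
      (\<lambda>t. cnj (sol' ?Q (of_real \<alpha>) (of_real \<beta>) (of_real w) t))"
    using ivp_solution_cnj[OF sol(1)[OF Q, of "of_real w" "of_real \<alpha>" "of_real \<beta>"]] by simp
  from sol_unique[OF Q this x]
  have "cnj (sol ?Q (of_real \<alpha>) (of_real \<beta>) (of_real w) x) = sol ?Q (of_real \<alpha>) (of_real \<beta>) (of_real w) x"
    by (simp add: sol(2,3)[OF Q])
  then have "sol ?Q (of_real \<alpha>) (of_real \<beta>) (of_real w) x \<in> \<real>"
    by (simp add: Reals_cnj_iff)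
  then show ?thesis by simp
qed

lemma sn_real:
  assumes "q absolutely_integrable_on {0..pi}" "x \<in> {0..pi}"
  shows "sn (\<lambda>t. of_real (q t)) (of_real w) x = of_real (Re (sn (\<lambda>t. of_real (q t)) (of_real w) x))"
  using sol_real[OF assms, of 0 1 w] by simp

lemma cs_real:
  assumes "q absolutely_integrable_on {0..pi}" "x \<in> {0..pi}"
  shows "cs (\<lambda>t. of_real (q t)) (of_real w) x = of_real (Re (cs (\<lambda>t. of_real (q t)) (of_real w) x))"
  using sol_real[OF assms, of 1 0 w] by simp

lemma integral_power2_pos:
  fixes f :: "real \<Rightarrow> real"
  assumes "continuous_on {0..pi} f" "x \<in> {0..pi}" "f x \<noteq> 0"
  shows "integral {0..pi} (\<lambda>t. (f t)\<^sup>2) > 0"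
proof -
  have c: "continuous_on {0..pi} (\<lambda>t. (f t)\<^sup>2)" by (intro continuous_intros assms)
  have "integral {0..pi} (\<lambda>t. (f t)\<^sup>2) \<noteq> 0"
    using integral_eq_0_iff[OF c] assms(2,3) by auto
  moreover have "integral {0..pi} (\<lambda>t. (f t)\<^sup>2) \<ge> 0"
    by (rule hk_integral_nonneg) (auto intro: integrable_continuous_interval c)
  ultimately show ?thesis by linarith
qed

lemma integral_complex_of_real:
  fixes f :: "real \<Rightarrow> real"
  assumes "continuous_on {a..b} f"
  shows "integral {a..b} (\<lambda>t. complex_of_real (f t)) = of_real (integral {a..b} f)"
  using integral_linear[OF integrable_continuous_interval[OF assms] bounded_linear_of_real[where 'a = complex]]
  by (simp add: o_def)

lemma spectral_point_mass_eq:
  assumes q: "q absolutely_integrable_on {0..pi}"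
  shows "spectral_point_mass q w = inverse (integral {0..pi} (\<lambda>t. (Re (sn (\<lambda>t. of_real (q t)) (of_real w) t))\<^sup>2))"
proof -
  have s: "sine_type_solution q (of_real w) = sn (\<lambda>t. of_real (q t)) (of_real w)"
    unfolding sine_type_solution_def sol_def schroedinger_solution_iff[OF q] ..
  have "integral {0..pi} (\<lambda>t. (cmod (sn (\<lambda>t. of_real (q t)) (of_real w) t))\<^sup>2) =
      integral {0..pi} (\<lambda>t. (Re (sn (\<lambda>t. of_real (q t)) (of_real w) t))\<^sup>2)"
  proof (rule hk_integral_cong)
    fix t assume t: "t \<in> {0..pi}"
    have "cmod (sn (\<lambda>t. of_real (q t)) (of_real w) t) = \<bar>Re (sn (\<lambda>t. of_real (q t)) (of_real w) t)\<bar>"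
      by (subst sn_real[OF q t]) (rule norm_of_real)
    then show "(cmod (sn (\<lambda>t. of_real (q t)) (of_real w) t))\<^sup>2 = (Re (sn (\<lambda>t. of_real (q t)) (of_real w) t))\<^sup>2"
      by simp
  qed
  then show ?thesis unfolding spectral_point_mass_def s by simp
qed

text \<open>At a zero of \<open>sn\<close> only one term of the derivative in \<open>z\<close>
  survives, namely \<open>cs\<close> at \<open>pi\<close> times the integral of the squared
  solution, and that integral is the inverse point mass. Both factors are nonzero, so the zeros are
  simple.\<close>

lemma sn_deriv_at_zero:
  assumes q: "q absolutely_integrable_on {0..pi}" and z: "sn (\<lambda>t. of_real (q t)) (of_real w) pi = 0"
  shows "deriv (\<lambda>z. sn (\<lambda>t. of_real (q t)) z pi) (of_real w) * of_real (spectral_point_mass q w)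
      = cs (\<lambda>t. of_real (q t)) (of_real w) pi"
    and "deriv (\<lambda>z. sn (\<lambda>t. of_real (q t)) z pi) (of_real w) \<noteq> 0"
proof -
  let ?Q = "\<lambda>t. complex_of_real (q t)" and ?w = "complex_of_real w"
  have Q: "?Q absolutely_integrable_on {0..pi}" by (rule absolutely_integrable_of_real[OF q])
  have p: "pi \<in> {0..pi}" by simp
  define I where "I = integral {0..pi} (\<lambda>t. (Re (sn ?Q ?w t))\<^sup>2)"
  have cont: "continuous_on {0..pi} (\<lambda>t. Re (sn ?Q ?w t))"
    by (intro continuous_intros sol_continuous Q)
  obtain x where "x \<in> {0..pi}" "sn ?Q ?w x \<noteq> 0"
    using sol_nontrivial[OF Q, of 0 1 ?w] by auto
  then have "x \<in> {0..pi}" "Re (sn ?Q ?w x) \<noteq> 0"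
    using sn_real[OF q, of x w] by auto
  from integral_power2_pos[OF cont this] have I: "I > 0" by (simp add: I_def)
  have "integral {0..pi} (\<lambda>t. sn ?Q ?w t * sn ?Q ?w t) = integral {0..pi} (\<lambda>t. of_real ((Re (sn ?Q ?w t))\<^sup>2))"
  proof (rule hk_integral_cong)
    fix t assume t: "t \<in> {0..pi}"
    have "a * a = of_real ((Re a)\<^sup>2)" if "a = of_real (Re a)" for a
      using that by (metis of_real_mult power2_eq_square)
    from this[OF sn_real[OF q t]] show "sn ?Q ?w t * sn ?Q ?w t = of_real ((Re (sn ?Q ?w t))\<^sup>2)" .
  qed
  also have "\<dots> = of_real I"
    unfolding I_def by (rule integral_complex_of_real) (intro continuous_intros cont)
  finally have "deriv (\<lambda>z. sn ?Q z pi) ?w = cs ?Q ?w pi * of_real I"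
    using DERIV_imp_deriv[OF sol_has_field_derivative[OF Q p, of 0 1 ?w]] z by simp
  moreover have "cs ?Q ?w pi \<noteq> 0" by (rule sn_cs_not_both_zero[OF Q p z])
  moreover have "spectral_point_mass q w = inverse I"
    unfolding I_def by (rule spectral_point_mass_eq[OF q])
  ultimately show "deriv (\<lambda>z. sn ?Q z pi) ?w * of_real (spectral_point_mass q w) = cs ?Q ?w pi"
    "deriv (\<lambda>z. sn ?Q z pi) ?w \<noteq> 0"
    using I by auto
qed

text \<open>Writing \<open>S\<close> and \<open>C\<close> for the values at \<open>pi\<close>, the
  positive quantity is the integral of the square of \<open>v = C * s - S * c\<close>, a real
  solution that vanishes at \<open>pi\<close>. It makes \<open>S / C\<close> strictly increasing
  wherever \<open>C\<close> does not vanish.\<close>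

lemma sn_cs_real_derivatives:
  assumes q: "q absolutely_integrable_on {0..pi}"
  shows "\<exists>f' g'. ((\<lambda>x. Re (sn (\<lambda>t. of_real (q t)) (of_real x) pi)) has_real_derivative f') (at w) \<and>
    ((\<lambda>x. Re (cs (\<lambda>t. of_real (q t)) (of_real x) pi)) has_real_derivative g') (at w) \<and>
    f' * Re (cs (\<lambda>t. of_real (q t)) (of_real w) pi) - g' * Re (sn (\<lambda>t. of_real (q t)) (of_real w) pi) > 0"
proof -
  let ?Q = "\<lambda>t. complex_of_real (q t)" and ?w = "complex_of_real w"
  have Q: "?Q absolutely_integrable_on {0..pi}" by (rule absolutely_integrable_of_real[OF q])
  have p: "pi \<in> {0..pi}" by simp
  define s where "s = sn ?Q ?w"
  define c where "c = cs ?Q ?w"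
  have sc: "continuous_on {0..pi} s" and cc: "continuous_on {0..pi} c"
    unfolding s_def c_def by (intro sol_continuous Q)+
  define D where "D = c pi * integral {0..pi} (\<lambda>t. s t * s t) - s pi * integral {0..pi} (\<lambda>t. s t * c t)"
  define E where "E = c pi * integral {0..pi} (\<lambda>t. c t * s t) - s pi * integral {0..pi} (\<lambda>t. c t * c t)"
  have real_deriv: "((\<lambda>x. Re (F (of_real x))) has_real_derivative Re d) (at w)"
    if "(F has_field_derivative d) (at ?w)" for F d
    unfolding has_real_derivative_iff_has_vector_derivative
    by (rule bounded_linear.has_vector_derivative[OF bounded_linear_Re has_vector_derivative_real_field[OF that]])
  have dD: "((\<lambda>x. Re (sn ?Q (of_real x) pi)) has_real_derivative Re D) (at w)"
    unfolding D_def s_def c_def by (rule real_deriv[OF sol_has_field_derivative[OF Q p]])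
  have dE: "((\<lambda>x. Re (cs ?Q (of_real x) pi)) has_real_derivative Re E) (at w)"
    unfolding E_def s_def c_def by (rule real_deriv[OF sol_has_field_derivative[OF Q p]])
  define v where "v t = Re (c pi) * Re (s t) - Re (s pi) * Re (c t)" for t
  have vc: "continuous_on {0..pi} v"
    unfolding v_def by (intro continuous_intros sc cc)
  have re: "s t = of_real (Re (s t))" "c t = of_real (Re (c t))" if "t \<in> {0..pi}" for t
    using sn_real[OF q that] cs_real[OF q that] unfolding s_def c_def by auto
  have vt: "c pi * s t - s pi * c t = of_real (v t)" if "t \<in> {0..pi}" for t
  proof -
    have "a * b - d * e = of_real (Re a * Re b - Re d * Re e)"
      if "a = of_real (Re a)" "b = of_real (Re b)" "d = of_real (Re d)" "e = of_real (Re e)" for a b d e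
      using that by (metis of_real_diff of_real_mult)
    from this[OF re(2)[OF p] re(1)[OF that] re(1)[OF p] re(2)[OF that]] show ?thesis unfolding v_def .
  qed
  \<comment> \<open>If \<open>S = 0\<close> then \<open>v = C * s\<close> with
    \<open>C \<noteq> 0\<close>; otherwise \<open>v 0 = - S\<close>.\<close>
  obtain x where x: "x \<in> {0..pi}" "v x \<noteq> 0"
  proof (cases "s pi = 0")
    case True
    then have "c pi \<noteq> 0" unfolding s_def c_def by (rule sn_cs_not_both_zero[OF Q p])
    moreover obtain x where x: "x \<in> {0..pi}" "s x \<noteq> 0"
      using sol_nontrivial[OF Q, of 0 1 ?w] unfolding s_def by auto
    ultimately have "of_real (v x) \<noteq> (0::complex)"
      unfolding vt[OF x(1), symmetric] using True by simp
    then show ?thesis using that x by auto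
  next
    case False
    have z: "0 \<in> {0..pi}" by simp
    have "of_real (v 0) \<noteq> (0::complex)"
      unfolding vt[OF z, symmetric] using False by (simp add: s_def c_def sol(2)[OF Q])
    then show ?thesis using that[of 0] by simp
  qed
  have pos: "integral {0..pi} (\<lambda>t. (v t)\<^sup>2) > 0" by (rule integral_power2_pos[OF vc x])
  have i: "(\<lambda>t. c t * s t) integrable_on {0..pi}" "(\<lambda>t. s t * s t) integrable_on {0..pi}" "(\<lambda>t. c t * c t) integrable_on {0..pi}"
    by (auto intro!: integrable_continuous_interval continuous_intros sc cc)
  have "complex_of_real (integral {0..pi} (\<lambda>t. (v t)\<^sup>2)) = integral {0..pi} (\<lambda>t. of_real ((v t)\<^sup>2))"
    by (rule integral_complex_of_real[symmetric]) (intro continuous_intros vc)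
  also have "\<dots> = integral {0..pi} (\<lambda>t. ((c pi)\<^sup>2 * (s t * s t) - 2 * c pi * s pi * (c t * s t)) + (s pi)\<^sup>2 * (c t * c t))"
  proof (rule hk_integral_cong)
    fix t assume t: "t \<in> {0..pi}"
    have "of_real ((v t)\<^sup>2) = (c pi * s t - s pi * c t)\<^sup>2" unfolding vt[OF t] by simp
    then show "of_real ((v t)\<^sup>2) = ((c pi)\<^sup>2 * (s t * s t) - 2 * c pi * s pi * (c t * s t)) + (s pi)\<^sup>2 * (c t * c t)"
      by (simp add: power2_eq_square algebra_simps)
  qed
  also have "\<dots> = (c pi)\<^sup>2 * integral {0..pi} (\<lambda>t. s t * s t) - 2 * c pi * s pi * integral {0..pi} (\<lambda>t. c t * s t) + (s pi)\<^sup>2 * integral {0..pi} (\<lambda>t. c t * c t)"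
    using hk_integral_add[OF integrable_diff[OF integrable_on_mult_right[OF i(2)] integrable_on_mult_right[OF i(1)]] integrable_on_mult_right[OF i(3)]]
      hk_integral_diff[OF integrable_on_mult_right[OF i(2)] integrable_on_mult_right[OF i(1)]]
    by (simp only: hk_integral_mult_right)
  also have "\<dots> = D * c pi - E * s pi"
    unfolding D_def E_def mult.commute[of "s _" "c _"] by (simp add: power2_eq_square algebra_simps)
  also have "\<dots> = D * of_real (Re (c pi)) - E * of_real (Re (s pi))"
    by (simp only: re(1)[OF p, symmetric] re(2)[OF p, symmetric])
  finally have "integral {0..pi} (\<lambda>t. (v t)\<^sup>2) = Re (D * of_real (Re (c pi)) - E * of_real (Re (s pi)))"
    by (metis Re_complex_of_real)
  then have "Re D * Re (c pi) - Re E * Re (s pi) > 0" using pos by simp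
  with dD dE show ?thesis unfolding s_def c_def by blast
qed

section \<open>Sturm separation and interlacing of the two spectra\<close>

lemma quotient_increasing:
  fixes f g :: "real \<Rightarrow> real"
  assumes d: "\<And>x. \<exists>f' g'. (f has_real_derivative f') (at x) \<and> (g has_real_derivative g') (at x) \<and> f' * g x - g' * f x > 0"
    and pr: "p < r" and nz: "\<And>x. p \<le> x \<Longrightarrow> x \<le> r \<Longrightarrow> g x \<noteq> 0"
  shows "f p / g p < f r / g r"
proof (rule DERIV_pos_imp_increasing[OF pr])
  fix x assume x: "p \<le> x" "x \<le> r"
  obtain f' g' where fg: "(f has_real_derivative f') (at x)" "(g has_real_derivative g') (at x)" "f' * g x - g' * f x > 0"
    using d by blast
  have "((\<lambda>x. f x / g x) has_real_derivative (f' * g x - f x * g') / (g x * g x)) (at x)"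
    by (rule DERIV_divide[OF fg(1,2) nz[OF x]])
  moreover have "(f' * g x - f x * g') / (g x * g x) > 0"
    using fg(3) nz[OF x] by (intro divide_pos_pos) (auto simp: mult.commute zero_less_mult_iff linorder_neq_iff)
  ultimately show "\<exists>y. ((\<lambda>x. f x / g x) has_real_derivative y) (at x) \<and> y > 0" by blast
qed

text \<open>The induction also carries that all earlier \<open>a k\<close> lie below
  \<open>b n\<close>. Then an \<open>a k\<close> between \<open>b n\<close> and
  \<open>b (Suc n)\<close> cannot have an index below \<open>n\<close>, which forces
  \<open>a n < b (Suc n)\<close>.\<close>

lemma interlacing_of_separation:
  fixes a b :: "nat \<Rightarrow> real"
  assumes a: "strict_mono_on {1..} a" and b: "strict_mono_on {1..} b"
    and ab: "\<And>m n. m \<ge> 1 \<Longrightarrow> n \<ge> 1 \<Longrightarrow> a m < a n \<Longrightarrow> \<exists>k\<ge>1. a m < b k \<and> b k < a n"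
    and ba: "\<And>m n. m \<ge> 1 \<Longrightarrow> n \<ge> 1 \<Longrightarrow> b m < b n \<Longrightarrow> \<exists>k\<ge>1. b m < a k \<and> a k < b n"
    and first: "\<exists>k\<ge>1. b k < a 1" and disj: "\<And>m n. m \<ge> 1 \<Longrightarrow> n \<ge> 1 \<Longrightarrow> a m \<noteq> b n"
    and n: "n \<ge> 1"
  shows "b n < a n \<and> a n < b (Suc n)"
proof -
  have am: "a i \<le> a j \<longleftrightarrow> i \<le> j" if "i \<ge> 1" "j \<ge> 1" for i j
    using strict_mono_on_leD[OF a] strict_mono_onD[OF a] that by (metis atLeast_iff linorder_not_le)
  have bm: "b i \<le> b j \<longleftrightarrow> i \<le> j" if "i \<ge> 1" "j \<ge> 1" for i j
    using strict_mono_on_leD[OF b] strict_mono_onD[OF b] that by (metis atLeast_iff linorder_not_le)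
  have next_gap: "a n < b (Suc n)" if n: "n \<ge> 1" and lt: "b n < a n" and prev: "\<And>k. 1 \<le> k \<Longrightarrow> k < n \<Longrightarrow> a k < b n" for n
  proof (rule ccontr)
    assume "\<not> a n < b (Suc n)"
    then have less: "b (Suc n) < a n" using disj[of n "Suc n"] n by auto
    have "b n < b (Suc n)" using bm[of "Suc n" n] n by (auto simp: not_le[symmetric])
    then obtain k where k: "k \<ge> 1" "b n < a k" "a k < b (Suc n)" using ba[of n "Suc n"] n by auto
    then have "k < n" using am[of n k] less n by (auto simp: not_le[symmetric])
    with prev[OF k(1)] k(2) show False by simp
  qed
  have "b n < a n \<and> (\<forall>k. 1 \<le> k \<and> k < n \<longrightarrow> a k < b n)"
    using n
  proof (induction n rule: dec_induct)
    case base
    obtain k where k: "k \<ge> 1" "b k < a 1" using first by blast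
    then show ?case using bm[of 1 k] by auto
  next
    case (step n)
    have lt: "a n < b (Suc n)" using step by (intro next_gap) auto
    have "a n < a (Suc n)" using am[of "Suc n" n] step.hyps by (auto simp: not_le[symmetric])
    then obtain k where k: "k \<ge> 1" "a n < b k" "b k < a (Suc n)" using ab[of n "Suc n"] step.hyps by auto
    have "b n < b k" using k step.IH by linarith
    then have "Suc n \<le> k" using bm[of k n] k step.hyps by (auto simp: not_le[symmetric])
    then have "b (Suc n) \<le> b k" using bm[of "Suc n" k] k by auto
    moreover have "a j < b (Suc n)" if "1 \<le> j" "j < Suc n" for j
      using am[of j n] that lt step.hyps by auto
    ultimately show ?case using k by auto
  qed
  with next_gap[OF n] show ?thesis by blast
qed

text \<open>Between two consecutive zeros of \<open>f\<close> without a zero of \<open>g\<close>,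
  the strictly increasing quotient \<open>f / g\<close> would run from 0 to 0; the same holds with
  the roles exchanged.\<close>

lemma spectra_interlace:
  assumes q: "q absolutely_integrable_on {0..pi}"
    and a: "increasing_enumeration a (DD_spectrum q)" and b: "increasing_enumeration b (ND_spectrum q)"
    and n: "n \<ge> 1"
  shows "b n < a n \<and> a n < b (Suc n)"
proof -
  let ?Q = "\<lambda>t. complex_of_real (q t)"
  have Q: "?Q absolutely_integrable_on {0..pi}" by (rule absolutely_integrable_of_real[OF q])
  have p: "pi \<in> {0..pi}" by simp
  define f where "f x = Re (sn ?Q (of_real x) pi)" for x
  define g where "g x = Re (cs ?Q (of_real x) pi)" for x
  have d: "\<exists>f' g'. (f has_real_derivative f') (at x) \<and> (g has_real_derivative g') (at x) \<and> f' * g x - g' * f x > 0" for x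
    using sn_cs_real_derivatives[OF q, of x] unfolding f_def g_def .
  \<comment> \<open>The positivity condition is invariant under replacing the pair
    \<open>(f, g)\<close> by \<open>(g, - f)\<close>, so one monotonicity statement serves both
    directions of separation.\<close>
  have d': "\<exists>g' f'. (g has_real_derivative g') (at x) \<and> ((\<lambda>x. - f x) has_real_derivative f') (at x) \<and> g' * (- f x) - f' * g x > 0" for x
  proof -
    obtain f' g' where "(f has_real_derivative f') (at x)" "(g has_real_derivative g') (at x)" "f' * g x - g' * f x > 0"
      using d by blast
    then show ?thesis by (intro exI[of _ g'] exI[of _ "- f'"]) (auto intro: DERIV_minus)
  qed
  have am: "strict_mono_on {1..} a" and bm: "strict_mono_on {1..} b"
    and az: "{z. sn ?Q z pi = 0} = (\<lambda>n. of_real (a n)) ` {1..}" and bz: "{z. cs ?Q z pi = 0} = (\<lambda>n. of_real (b n)) ` {1..}"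
    using a b unfolding increasing_enumeration_def DD_spectrum_eq[OF q] ND_spectrum_eq[OF q] by auto
  have fz: "f x = 0 \<longleftrightarrow> (\<exists>n\<ge>1. x = a n)" for x
  proof -
    have "f x = 0 \<longleftrightarrow> sn ?Q (of_real x) pi = 0"
      unfolding f_def by (subst (2) sn_real[OF q p]) simp
    also have "\<dots> \<longleftrightarrow> complex_of_real x \<in> (\<lambda>n. of_real (a n)) ` {1..}" unfolding az[symmetric] by simp
    finally show ?thesis by auto
  qed
  have gz: "g x = 0 \<longleftrightarrow> (\<exists>n\<ge>1. x = b n)" for x
  proof -
    have "g x = 0 \<longleftrightarrow> cs ?Q (of_real x) pi = 0"
      unfolding g_def by (subst (2) cs_real[OF q p]) simp
    also have "\<dots> \<longleftrightarrow> complex_of_real x \<in> (\<lambda>n. of_real (b n)) ` {1..}" unfolding bz[symmetric] by simp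
    finally show ?thesis by auto
  qed
  have both: "\<not> (f x = 0 \<and> g x = 0)" for x
    using d[of x] by auto
  show ?thesis
  proof (rule interlacing_of_separation[OF am bm _ _ _ _ n])
    fix i j :: nat assume ij: "i \<ge> 1" "j \<ge> 1"
    show "a i \<noteq> b j" using fz gz both ij by metis
    show "\<exists>k\<ge>1. a i < b k \<and> b k < a j" if less: "a i < a j"
    proof (rule ccontr)
      assume none: "\<not> ?thesis"
      have f0: "f (a i) = 0" "f (a j) = 0" using fz ij by blast+
      have "g x \<noteq> 0" if "a i \<le> x" "x \<le> a j" for x
      proof
        assume g0: "g x = 0"
        then obtain k where k: "k \<ge> 1" "x = b k" using gz by blast
        have "x \<noteq> a i" "x \<noteq> a j" using both[of x] g0 f0 by auto
        then have "a i < b k" "b k < a j" using that k by linarith+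
        then show False using none k by blast
      qed
      from quotient_increasing[OF d less this] f0 show False by simp
    qed
    show "\<exists>k\<ge>1. b i < a k \<and> a k < b j" if less: "b i < b j"
    proof (rule ccontr)
      assume none: "\<not> ?thesis"
      have g0: "g (b i) = 0" "g (b j) = 0" using gz ij by blast+
      have "- f x \<noteq> 0" if "b i \<le> x" "x \<le> b j" for x
      proof
        assume "- f x = 0"
        then have f0: "f x = 0" by simp
        then obtain k where k: "k \<ge> 1" "x = a k" using fz by blast
        have "x \<noteq> b i" "x \<noteq> b j" using both[of x] g0 f0 by auto
        then have "b i < a k" "a k < b j" using that k by linarith+
        then show False using none k by blast
      qed
      from quotient_increasing[OF d' less this] g0 show False by simp
    qed
  next
    \<comment> \<open>If \<open>g\<close> had no zero below \<open>a 1\<close>, then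
      \<open>f / g\<close> would increase from a positive value far to the left to the value 0 at
      \<open>a 1\<close>.\<close>
    show "\<exists>k\<ge>1. b k < a 1"
    proof (rule ccontr)
      assume none: "\<not> ?thesis"
      have f0: "f (a 1) = 0" using fz by blast
      obtain X where X: "\<And>x. x \<ge> X \<Longrightarrow> f (- (x\<^sup>2)) > 0 \<and> g (- (x\<^sup>2)) > 0"
        using sol_positive_at_minus_infinity[OF Q] unfolding f_def g_def by blast
      define x where "x = max X (\<bar>a 1\<bar> + 1)"
      have "\<bar>a 1\<bar> + 1 \<le> x" by (simp add: x_def)
      moreover from this have "x * 1 \<le> x * x" by (intro mult_left_mono) auto
      ultimately have less: "- (x\<^sup>2) < a 1" by (simp add: power2_eq_square)
      have "g y \<noteq> 0" if "- (x\<^sup>2) \<le> y" "y \<le> a 1" for y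
      proof
        assume g0: "g y = 0"
        then obtain k where k: "k \<ge> 1" "y = b k" using gz by blast
        have "y \<noteq> a 1" using both[of y] g0 f0 by auto
        then have "b k < a 1" using that k by linarith
        then show False using none k by blast
      qed
      from quotient_increasing[OF d less this] f0 have "f (- (x\<^sup>2)) / g (- (x\<^sup>2)) < 0" by simp
      moreover have "f (- (x\<^sup>2)) > 0 \<and> g (- (x\<^sup>2)) > 0" by (rule X) (simp add: x_def)
      ultimately show False by (simp add: divide_less_0_iff)
    qed
  qed
qed

section \<open>Uniqueness of the potential\<close>

lemma has_integral_reflect_pi:
  fixes f :: "real \<Rightarrow> 'a::euclidean_space"
  assumes "(f has_integral I) {a..b}"
  shows "((\<lambda>t. f (pi - t)) has_integral I) {pi - b..pi - a}"
proof (cases "a \<le> b")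
  case True
  have "((\<lambda>x. f ((- 1) *\<^sub>R x + pi)) has_integral (1 / (\<bar>- 1\<bar> ^ DIM(real))) *\<^sub>R I) ((\<lambda>x. (1 / - 1) *\<^sub>R x + - ((1 / - 1) *\<^sub>R pi)) ` cbox a b)"
    by (rule has_integral_affinity) (use assms in auto)
  moreover have "(\<lambda>x. (1 / - 1) *\<^sub>R x + - ((1 / - 1) *\<^sub>R pi)) ` cbox a b = {pi - b..pi - a}"
  proof -
    have "(\<lambda>x. (1 / - 1) *\<^sub>R x + - ((1 / - 1) *\<^sub>R pi)) = (\<lambda>x. pi - x)" by auto
    then show ?thesis by simp
  qed
  moreover have "(\<lambda>x. f ((- 1) *\<^sub>R x + pi)) = (\<lambda>t. f (pi - t))" by auto
  ultimately show ?thesis by simp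
next
  case False
  then have "{a..b} = {}" "{pi - b..pi - a} = {}" by auto
  then show ?thesis using assms by (simp add: has_integral_empty_eq)
qed

lemma absolutely_integrable_reflect_pi:
  fixes Q :: "real \<Rightarrow> complex"
  assumes "Q absolutely_integrable_on {0..pi}"
  shows "(\<lambda>t. Q (pi - t)) absolutely_integrable_on {0..pi}"
proof -
  have "(Q has_integral integral {0..pi} Q) {0..pi}"
    "((\<lambda>t. norm (Q t)) has_integral integral {0..pi} (\<lambda>t. norm (Q t))) {0..pi}"
    using assms by (auto simp: absolutely_integrable_on_def)
  from has_integral_reflect_pi[OF this(1)] has_integral_reflect_pi[OF this(2)]
  show ?thesis
    unfolding absolutely_integrable_on_def by (auto simp: has_integral_integrable)
qed

lemma ivp_solution_reflect:
  assumes Q: "Q absolutely_integrable_on {0..pi}" and u: "ivp_solution Q z u u'"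
  shows "ivp_solution (\<lambda>t. Q (pi - t)) z (\<lambda>x. u (pi - x)) (\<lambda>x. - u' (pi - x))"
  unfolding ivp_solution_def
proof (intro conjI ballI)
  fix x :: real assume x: "x \<in> {0..pi}"
  then have px: "pi - x \<in> {0..pi}" by auto
  have "((\<lambda>x. pi - x) has_vector_derivative - 1) (at x within {0..pi})"
    by (auto intro!: derivative_eq_intros)
  moreover have "(u has_vector_derivative u' (pi - x)) (at (pi - x) within (\<lambda>x. pi - x) ` {0..pi})"
    using ivp_solution_has_vector_derivative[OF u px] by simp
  ultimately have "(u \<circ> (\<lambda>x. pi - x) has_vector_derivative - 1 *\<^sub>R u' (pi - x)) (at x within {0..pi})"
    by (rule vector_diff_chain_within)
  then show "((\<lambda>x. u (pi - x)) has_vector_derivative - u' (pi - x)) (at x within {0..pi})"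
    by (simp add: o_def)
  let ?f = "\<lambda>t. (Q t - z) * u t"
  have f: "?f integrable_on {0..pi}"
    by (rule set_lebesgue_integral_eq_integral(1)[OF potential_mult_absolutely_integrable[OF Q ivp_solution_continuous[OF u]]])
  have "?f integrable_on {pi - x..pi}"
    by (rule integrable_on_subinterval[OF f]) (use x in auto)
  then have "(?f has_integral integral {pi - x..pi} ?f) {pi - x..pi}"
    by (rule integrable_integral)
  from has_integral_reflect_pi[OF this]
  have "integral {0..x} (\<lambda>t. ?f (pi - t)) = integral {pi - x..pi} ?f"
    by (simp add: integral_unique)
  moreover have "integral {0..pi - x} ?f + integral {pi - x..pi} ?f = integral {0..pi} ?f"
    by (rule hk_integral_combine) (use px f in auto)
  moreover have "u' (pi - x) = u' 0 + integral {0..pi - x} ?f"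
    by (rule ivp_solution_deriv_eq[OF u px])
  moreover have "u' pi = u' 0 + integral {0..pi} ?f"
    by (rule ivp_solution_deriv_eq[OF u]) simp
  ultimately have "- u' (pi - x) = - u' pi + integral {0..x} (\<lambda>t. ?f (pi - t))"
    by (simp add: algebra_simps)
  then show "- u' (pi - x) = - u' (pi - 0) + integral {0..x} (\<lambda>t. (Q (pi - t) - z) * u (pi - t))"
    by simp
qed

text \<open>The right-hand side is the solution with \<open>u \<pi> = 0\<close>, \<open>u' \<pi> = -1\<close>; the identity shows that it
  decays like \<open>exp (\<bar>Im k\<bar> * (pi - x))\<close> away from the left endpoint.\<close>
lemma sn_reflect:
  assumes Q: "Q absolutely_integrable_on {0..pi}" and x: "x \<in> {0..pi}"
  shows "sn (\<lambda>t. Q (pi - t)) z (pi - x) = sn Q z pi * cs Q z x - cs Q z pi * sn Q z x"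
proof -
  let ?R = "\<lambda>t. Q (pi - t)"
  have R: "?R absolutely_integrable_on {0..pi}" by (rule absolutely_integrable_reflect_pi[OF Q])
  have p: "pi \<in> {0..pi}" by simp
  define u where "u = (\<lambda>x. sn ?R z (pi - x))"
  define u' where "u' = (\<lambda>x. - sol' ?R 0 1 z (pi - x))"
  have u: "ivp_solution Q z u u'"
    using ivp_solution_reflect[OF R sol(1)[OF R, of z 0 1]] unfolding u_def u'_def by simp
  have end_values: "u pi = 0" "u' pi = - 1"
    by (simp_all add: u_def u'_def sol(2,3)[OF R])
  have "u' 0 = - cs Q z pi"
    using wronskian_identity[OF Q sol(1)[OF Q, of z 1 0] u p] by (simp add: sol(2,3)[OF Q] end_values)
  moreover have "u 0 = sn Q z pi"
    using wronskian_identity[OF Q sol(1)[OF Q, of z 0 1] u p] by (simp add: sol(2,3)[OF Q] end_values)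
  ultimately show ?thesis
    using ivp_solution_expand[OF Q u x] by (simp add: u_def)
qed

section \<open>Recovering a potential from its solutions\<close>

lemma ae_zero_of_indefinite_integral_zero:
  fixes f :: "real \<Rightarrow> complex"
  assumes f: "f integrable_on {0..pi}" and zero: "\<And>x. x \<in> {0..pi} \<Longrightarrow> integral {0..x} f = 0"
  shows "\<exists>N. negligible N \<and> (\<forall>x\<in>{0<..<pi} - N. f x = 0)"
proof -
  \<comment> \<open>The Lebesgue differentiation theorem is applied on the whole line, hence the
    extension by 0.\<close>
  define g where "g x = (if x \<in> {0..pi} then f x else 0)" for x
  have "g integrable_on cbox a b" for a b
  proof -
    have "g integrable_on UNIV" unfolding g_def using f by (simp only: integrable_restrict_UNIV)
    then show ?thesis by (rule integrable_on_subcbox) simp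
  qed
  then obtain N where N: "negligible N"
    "\<And>x e. \<lbrakk>x \<notin> N; 0 < e\<rbrakk> \<Longrightarrow> \<exists>d>0. \<forall>h. 0 < h \<and> h < d \<longrightarrow>
        norm (integral (cbox x (x + h *\<^sub>R One)) g /\<^sub>R h ^ DIM(real) - g x) < e"
    by (rule integrable_ccontinuous_explicit) blast
  have "f x = 0" if x: "x \<in> {0<..<pi} - N" for x
  proof -
    have "norm (f x) \<le> 0 + e" if e: "e > 0" for e
    proof -
      obtain d where d: "d > 0" "\<And>h. 0 < h \<Longrightarrow> h < d \<Longrightarrow>
          norm (integral (cbox x (x + h *\<^sub>R One)) g /\<^sub>R h ^ DIM(real) - g x) < e"
        using N(2)[of x e] x e by blast
      \<comment> \<open>The second bound keeps \<open>{x..x + h}\<close> inside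
        \<open>{0..pi}\<close>, where the extension agrees with \<open>f\<close> and the indefinite
        integral is known to vanish.\<close>
      define h where "h = min (d / 2) (pi - x)"
      have h: "0 < h" "h < d" "x + h \<le> pi" using d(1) x by (auto simp: h_def min_def)
      have "integral {0..x} f + integral {x..x + h} f = integral {0..x + h} f"
        by (rule hk_integral_combine)
          (use x h in \<open>auto intro: integrable_on_subinterval[OF f]\<close>)
      then have "integral {x..x + h} f = 0" using zero[of x] zero[of "x + h"] x h by simp
      moreover have "integral {x..x + h} g = integral {x..x + h} f"
        by (rule hk_integral_cong) (use x h in \<open>auto simp: g_def\<close>)
      ultimately have "integral (cbox x (x + h *\<^sub>R One)) g = 0" by simp
      with d(2)[OF h(1,2)] show ?thesis using x by (simp add: g_def)
    qed
    then have "norm (f x) \<le> 0" by (rule field_le_epsilon)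
    then show ?thesis by simp
  qed
  with N(1) show ?thesis by blast
qed

text \<open>Solutions that agree have equal derivatives, so the integrals of
  \<open>(Q - z) * u\<close> and \<open>(P - z) * u\<close> agree up to every \<open>x\<close>. This
  identifies the potentials only where \<open>u\<close> is nonzero, and is therefore used for two
  solutions without common zero.\<close>

lemma ae_potential_mult_eq:
  assumes Q: "Q absolutely_integrable_on {0..pi}" and P: "P absolutely_integrable_on {0..pi}"
    and u: "ivp_solution Q z u u'" and v: "ivp_solution P z v v'"
    and eq: "\<And>x. x \<in> {0..pi} \<Longrightarrow> u x = v x"
  shows "\<exists>N. negligible N \<and> (\<forall>x\<in>{0<..<pi} - N. (Q x - P x) * u x = 0)"
proof -
  have uc: "continuous_on {0..pi} u" by (rule ivp_solution_continuous[OF u])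
  have "\<exists>N. negligible N \<and> (\<forall>x\<in>{0<..<pi} - N. (Q x - z) * u x - (P x - z) * u x = 0)"
  proof (rule ae_zero_of_indefinite_integral_zero)
    have i: "(\<lambda>t. (Q t - z) * u t) integrable_on {0..pi}" "(\<lambda>t. (P t - z) * u t) integrable_on {0..pi}"
      by (intro set_lebesgue_integral_eq_integral(1) potential_mult_absolutely_integrable Q P uc)+
    show "(\<lambda>t. (Q t - z) * u t - (P t - z) * u t) integrable_on {0..pi}"
      by (rule integrable_diff[OF i])
    fix x :: real assume x: "x \<in> {0..pi}"
    have sub: "(\<lambda>t. (Q t - z) * u t) integrable_on {0..x}" "(\<lambda>t. (P t - z) * u t) integrable_on {0..x}"
      using x by (auto intro: integrable_on_subinterval[OF i(1)] integrable_on_subinterval[OF i(2)])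
    have "u' x = v' x" "u' 0 = v' 0"
      by (rule ivp_solution_deriv_unique[OF u v eq]; use x in simp)+
    then have "integral {0..x} (\<lambda>t. (Q t - z) * u t) = integral {0..x} (\<lambda>t. (P t - z) * v t)"
      using ivp_solution_deriv_eq[OF u x] ivp_solution_deriv_eq[OF v x] by simp
    also have "\<dots> = integral {0..x} (\<lambda>t. (P t - z) * u t)"
      by (rule hk_integral_cong) (use x eq in auto)
    finally show "integral {0..x} (\<lambda>t. (Q t - z) * u t - (P t - z) * u t) = 0"
      using hk_integral_diff[OF sub] by simp
  qed
  then show ?thesis by (simp add: left_diff_distrib)
qed

text \<open>If \<open>c / s\<close> agrees for the two potentials, the factor \<open>p\<close> relating the two fundamental systems
  satisfies \<open>p\<^sup>2 = 1\<close>, and continuity forces \<open>p = 1\<close>.\<close>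
lemma fundamental_system_eq_of_proportional:
  assumes Q: "Q absolutely_integrable_on {0..pi}" and P: "P absolutely_integrable_on {0..pi}"
    and ratio: "\<And>x. x \<in> {0..pi} \<Longrightarrow> cs Q z x * sn P z x = sn Q z x * cs P z x"
    and x: "x \<in> {0..pi}"
  shows "sn Q z x = sn P z x" "cs Q z x = cs P z x"
proof -
  define c d s t where "c = cs Q z" and "d = cs P z" and "s = sn Q z" and "t = sn P z"
  define c' d' s' t' where "c' = sol' Q 1 0 z" and "d' = sol' P 1 0 z" and "s' = sol' Q 0 1 z" and "t' = sol' P 0 1 z"
  note defs = c_def d_def s_def t_def c'_def d'_def s'_def t'_def
  have der: "(c has_vector_derivative c' y) (at y within {0..pi})" "(d has_vector_derivative d' y) (at y within {0..pi})"
    "(s has_vector_derivative s' y) (at y within {0..pi})" "(t has_vector_derivative t' y) (at y within {0..pi})"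
    if "y \<in> {0..pi}" for y
    unfolding defs using that by (auto intro: ivp_solution_has_vector_derivative sol(1)[OF Q] sol(1)[OF P])
  \<comment> \<open>The formula is forced: if \<open>c = p * d\<close> and \<open>s = p * t\<close>,
    then \<open>c * t' - s * d'\<close> equals \<open>p\<close> times the Wronskian of
    \<open>d\<close> and \<open>t\<close>. Unlike a quotient, it remains meaningful and continuous
    at zeros.\<close>
  define p where "p y = c y * t' y - s y * d' y" for y
  have rel: "s y = p y * t y" "c y = p y * d y" "t y = p y * s y" "d y = p y * c y" if y: "y \<in> {0..pi}" for y
  proof -
    have W: "c y * s' y - c' y * s y = 1" "d y * t' y - d' y * t y = 1"
      unfolding defs using wronskian_cs_sn[OF Q y] wronskian_cs_sn[OF P y] by auto
    have E: "c y * t y = s y * d y" unfolding defs by (rule ratio[OF y])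
    have 1: "((\<lambda>y. c y * t y) has_vector_derivative (c y * t' y + c' y * t y)) (at y within {0..pi})"
      by (rule has_vector_derivative_mult[OF der(1)[OF y] der(4)[OF y]])
    have "((\<lambda>y. s y * d y) has_vector_derivative (s y * d' y + s' y * d y)) (at y within {0..pi})"
      by (rule has_vector_derivative_mult[OF der(3)[OF y] der(2)[OF y]])
    then have 2: "((\<lambda>y. c y * t y) has_vector_derivative (s y * d' y + s' y * d y)) (at y within {0..pi})"
      by (rule has_vector_derivative_transform[OF y, rotated 1]) (use ratio in \<open>auto simp: defs\<close>)
    \<comment> \<open>Differentiating the ratio identity yields the second form
      \<open>p y = s' y * d y - c' y * t y\<close>, which gives the relations in the opposite
      direction.\<close>
    have E': "c y * t' y + c' y * t y = s y * d' y + s' y * d y"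
      using vector_derivative_unique_within_closed_interval[of 0 pi y _ _ "s y * d' y + s' y * d y"] 1 2 y by simp
    show "s y = p y * t y" "c y = p y * d y" "t y = p y * s y" "d y = p y * c y"
      using W E E' unfolding p_def by algebra+
  qed
  have sq: "p y = 1 \<or> p y = - 1" if y: "y \<in> {0..pi}" for y
  proof -
    have "s y = (p y * p y) * s y" "c y = (p y * p y) * c y"
      using rel[OF y] by (metis mult.assoc)+
    moreover have "s y \<noteq> 0 \<or> c y \<noteq> 0"
      unfolding s_def c_def using sn_cs_not_both_zero[OF Q y] by blast
    ultimately have "p y * p y = 1" by auto
    then have "(p y - 1) * (p y + 1) = 0" by (simp add: algebra_simps)
    then show ?thesis by (auto simp: eq_neg_iff_add_eq_0)
  qed
  have "continuous_on {0..pi} p"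
    unfolding p_def defs
    by (intro continuous_intros sol_continuous ivp_solution_continuous_deriv[OF P sol(1)[OF P]] Q)
  moreover have "finite (p ` {0..pi})"
  proof (rule finite_subset)
    show "p ` {0..pi} \<subseteq> {1, - 1}" using sq by blast
  qed simp
  ultimately have "p constant_on {0..pi}"
    by (intro continuous_finite_range_constant) auto
  then obtain r where r: "\<And>y. y \<in> {0..pi} \<Longrightarrow> p y = r" unfolding constant_on_def by blast
  have "p 0 = 1" by (simp add: p_def defs sol(2,3)[OF Q] sol(2,3)[OF P])
  then have "p x = 1" using r[of 0] r[OF x] by simp
  then show "sn Q z x = sn P z x" "cs Q z x = cs P z x"
    using rel(1,2)[OF x] unfolding s_def t_def c_def d_def by auto
qed

theorem theorem4p2:
  fixes q q' :: "real \<Rightarrow> real" and a b a' b' :: "nat \<Rightarrow> real" and A :: "nat set"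
  assumes "q absolutely_integrable_on {0<..<pi}"
    and "q' absolutely_integrable_on {0<..<pi}"
    and "A \<subseteq> {1..}"
    and "increasing_enumeration a (DD_spectrum q)"
    and "increasing_enumeration b (ND_spectrum q)"
    and "increasing_enumeration a' (DD_spectrum q')"
    and "increasing_enumeration b' (ND_spectrum q')"
    and "\<forall>n\<in>{1..}. a' n = a n"
    and "\<forall>n\<in>{1..} - A. b' n = b n"
    and "\<forall>n\<in>A. spectral_point_mass q' (a' n) = spectral_point_mass q (a n)"
  shows "AE x in lebesgue. x \<in> {0<..<pi} \<longrightarrow> q' x = q x"
proof -
  have q: "q absolutely_integrable_on {0..pi}" and q': "q' absolutely_integrable_on {0..pi}"
    using assms(1,2) by (simp_all add: absolutely_integrable_on_Icc_iff_Ioo)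
  define Q where "Q = (\<lambda>t. complex_of_real (q t))"
  define P where "P = (\<lambda>t. complex_of_real (q' t))"
  have Q: "Q absolutely_integrable_on {0..pi}" and P: "P absolutely_integrable_on {0..pi}"
    unfolding Q_def P_def by (intro absolutely_integrable_of_real q q')+
  have p: "pi \<in> {0..pi}" by simp
  have zQ: "{z. sn Q z pi = 0} = (\<lambda>n. of_real (a n)) ` {1..}"
    and zP: "{z. sn P z pi = 0} = (\<lambda>n. of_real (a' n)) ` {1..}"
    and yQ: "{z. cs Q z pi = 0} = (\<lambda>n. of_real (b n)) ` {1..}"
    and yP: "{z. cs P z pi = 0} = (\<lambda>n. of_real (b' n)) ` {1..}"
    using assms(4-7) unfolding increasing_enumeration_def DD_spectrum_eq[OF q] DD_spectrum_eq[OF q']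
      ND_spectrum_eq[OF q] ND_spectrum_eq[OF q'] Q_def P_def by blast+
  have zeros: "sn Q z pi = 0 \<longleftrightarrow> (\<exists>n\<ge>1. z = of_real (a n))" for z
    using zQ by (auto simp: set_eq_iff)
  have aQ: "sn Q (of_real (a n)) pi = 0" and aP: "sn P (of_real (a n)) pi = 0" if "n \<ge> 1" for n
    using zQ zP assms(8) that by (auto simp: set_eq_iff)
  have bQ: "cs Q (of_real (b n)) pi = 0" if "n \<ge> 1" for n
    using yQ that by (auto simp: set_eq_iff)
  have bP: "cs P (of_real (b n)) pi = 0" if "n \<ge> 1" "n \<notin> A" for n
  proof -
    have "b' n = b n" using assms(9) that by auto
    then have "complex_of_real (b n) \<in> {z. cs P z pi = 0}"
      unfolding yP using that(1) by (intro image_eqI[of _ _ n]) auto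
    then show ?thesis by simp
  qed
  have simple: "deriv (\<lambda>z. sn Q z pi) (of_real (a n)) \<noteq> 0" if "n \<ge> 1" for n
    using sn_deriv_at_zero(2)[OF q, of "a n"] aQ[OF that] unfolding Q_def by blast
  have criterion: "F z = 0"
    if "F holomorphic_on UNIV" "\<And>n. n \<ge> 1 \<Longrightarrow> n \<in> B \<Longrightarrow> F (of_real (a n)) = 0"
      "\<And>n. n \<ge> 1 \<Longrightarrow> n \<notin> B \<Longrightarrow> F (of_real (b n)) = 0"
      "R absolutely_integrable_on {0..pi}" "K \<ge> 0"
      "\<And>k. norm k \<ge> 1 \<Longrightarrow> norm (F (k\<^sup>2)) \<le> exp (\<bar>Im k\<bar> * pi) / norm k * (decay R \<bar>Im k\<bar> + K / norm k)"
    for F z B R K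
    by (rule entire_eq_0_of_interlacing_zeros[OF sol_holomorphic[OF Q p] that(1) zeros simple, where A = B])
      (use spectra_interlace[OF q assms(4,5)] that(2,3) small_relative_to_sn[OF Q that(4-6)] in auto)
  \<comment> \<open>The bounds in the first and third application contain no oscillating integral; a
    nonnegative \<open>decay\<close> is added to bring them into the form of
    \<open>criterion\<close>.\<close>
  have weaken: "exp (\<bar>Im k\<bar> * pi) / norm k * (K / norm k) \<le> exp (\<bar>Im k\<bar> * pi) / norm k * (decay Q \<bar>Im k\<bar> + K / norm k)" for k K
    by (rule mult_left_mono) (auto simp: decay_nonneg[OF Q])
  have sn_eq: "sn Q z pi = sn P z pi" for z
  proof -
    have "sn Q z pi - sn P z pi = 0"
    proof (rule criterion[where B = UNIV and R = Q and F = "\<lambda>z. sn Q z pi - sn P z pi"])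
      show "(\<lambda>z. sn Q z pi - sn P z pi) holomorphic_on UNIV"
        by (intro holomorphic_intros sol_holomorphic Q P p)
      show "exp (pnorm Q) * pnorm Q + exp (pnorm P) * pnorm P \<ge> 0"
        using pnorm_nonneg[OF Q] pnorm_nonneg[OF P] by simp
      show "norm (sn Q (k\<^sup>2) pi - sn P (k\<^sup>2) pi) \<le> exp (\<bar>Im k\<bar> * pi) / norm k *
          (decay Q \<bar>Im k\<bar> + (exp (pnorm Q) * pnorm Q + exp (pnorm P) * pnorm P) / norm k)" if "norm k \<ge> 1" for k
        by (rule order_trans[OF sn_diff_bound[OF Q P that] weaken])
    qed (use aQ aP Q in auto)
    then show ?thesis by simp
  qed
  have mean: "integral {0..pi} Q = integral {0..pi} P" by (rule mean_eq_of_sn_eq[OF Q P sn_eq])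
  have cs_eq: "cs Q z pi = cs P z pi" for z
  proof -
    have "cs Q z pi - cs P z pi = 0"
    proof (rule criterion[where B = A and R = "\<lambda>t. Q t - P t" and F = "\<lambda>z. cs Q z pi - cs P z pi"])
      show "(\<lambda>z. cs Q z pi - cs P z pi) holomorphic_on UNIV"
        by (intro holomorphic_intros sol_holomorphic Q P p)
      show "(\<lambda>t. Q t - P t) absolutely_integrable_on {0..pi}" by (rule set_integral_diff(1)[OF Q P])
      show "exp (pnorm Q) * (pnorm Q)\<^sup>2 + exp (pnorm P) * (pnorm P)\<^sup>2 \<ge> 0" by simp
      fix n :: nat assume n: "n \<ge> 1"
      show "cs Q (of_real (b n)) pi - cs P (of_real (b n)) pi = 0" if "n \<notin> A"
        using bQ[OF n] bP[OF n that] by simp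
      show "cs Q (of_real (a n)) pi - cs P (of_real (a n)) pi = 0" if "n \<in> A"
      proof -
        have "a' n = a n" "spectral_point_mass q' (a' n) = spectral_point_mass q (a n)"
          using assms(8,10) n that by auto
        then show ?thesis
          using sn_deriv_at_zero(1)[OF q, of "a n"] sn_deriv_at_zero(1)[OF q', of "a n"] aQ[OF n] aP[OF n]
          unfolding Q_def[symmetric] P_def[symmetric] sn_eq by simp
      qed
    qed (rule cs_diff_bound[OF Q P mean])
    then show ?thesis by simp
  qed
  \<comment> \<open>The parameter \<open>\<i>\<close> is not real, hence not an eigenvalue, and the
    factor \<open>sn Q \<i> pi\<close> in \<open>F\<close> can be cancelled.\<close>
  have proportional: "cs Q \<i> x * sn P \<i> x = sn Q \<i> x * cs P \<i> x" if x: "x \<in> {0..pi}" for x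
  proof -
    define F where "F z = sn Q z pi * (cs Q z x * sn P z x - sn Q z x * cs P z x)" for z
    let ?RQ = "\<lambda>t. Q (pi - t)" and ?RP = "\<lambda>t. P (pi - t)"
    have RQ: "?RQ absolutely_integrable_on {0..pi}" and RP: "?RP absolutely_integrable_on {0..pi}"
      by (intro absolutely_integrable_reflect_pi Q P)+
    have px: "pi - x \<in> {0..pi}" using x by auto
    \<comment> \<open>As \<open>S = S~\<close> and \<open>C = C~\<close>, the terms with
      \<open>C * s * s~\<close> cancel. Each remaining product pairs growth over the length
      \<open>pi - x\<close> with growth over \<open>x\<close>, a total of
      \<open>exp (\<bar>Im k\<bar> * pi)\<close>, whereas estimating the factors of \<open>F\<close>
      separately would give \<open>exp (\<bar>Im k\<bar> * (pi + 2 * x))\<close>.\<close>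
    have F_eq: "F z = sn ?RQ z (pi - x) * sn P z x - sn Q z x * sn ?RP z (pi - x)" for z
      unfolding F_def sn_reflect[OF Q x] sn_reflect[OF P x] sn_eq[symmetric] cs_eq[symmetric]
      by (simp add: algebra_simps)
    define K where "K = exp (pnorm ?RQ) * exp (pnorm P) + exp (pnorm Q) * exp (pnorm ?RP)"
    have "F \<i> = 0"
    proof (rule criterion[where B = UNIV and R = Q and K = K and F = F])
      show "F holomorphic_on UNIV"
        unfolding F_def by (intro holomorphic_intros sol_holomorphic Q P p x)
      show "K \<ge> 0" by (simp add: K_def)
      fix k :: complex assume k: "norm k \<ge> 1"
      let ?T = "\<lambda>y. exp (\<bar>Im k\<bar> * y)"
      have T: "?T (pi - x) * ?T x = ?T pi" by (simp add: exp_add[symmetric] algebra_simps)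
      have "norm (F (k\<^sup>2)) \<le> norm (sn ?RQ (k\<^sup>2) (pi - x)) * norm (sn P (k\<^sup>2) x) + norm (sn Q (k\<^sup>2) x) * norm (sn ?RP (k\<^sup>2) (pi - x))"
        unfolding F_eq norm_mult[symmetric] by (rule norm_triangle_ineq4)
      also have "\<dots> \<le> (exp (pnorm ?RQ) * ?T (pi - x) / norm k) * (exp (pnorm P) * ?T x / norm k)
          + (exp (pnorm Q) * ?T x / norm k) * (exp (pnorm ?RP) * ?T (pi - x) / norm k)"
        by (intro add_mono mult_mono sol_bound(2) RQ RP Q P k x px) auto
      also have "\<dots> = K * (?T (pi - x) * ?T x) / norm k / norm k"
        by (simp add: K_def add_divide_distrib algebra_simps)
      also have "\<dots> = ?T pi / norm k * (K / norm k)" unfolding T by simp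
      also have "\<dots> \<le> ?T pi / norm k * (decay Q \<bar>Im k\<bar> + K / norm k)" by (rule weaken)
      finally show "norm (F (k\<^sup>2)) \<le> ?T pi / norm k * (decay Q \<bar>Im k\<bar> + K / norm k)" .
    qed (use aQ Q in \<open>auto simp: F_def\<close>)
    moreover have "sn Q \<i> pi \<noteq> 0"
    proof
      assume "sn Q \<i> pi = 0"
      then obtain n where "\<i> = complex_of_real (a n)" using zeros by blast
      then have "Im \<i> = 0" by (metis Im_complex_of_real)
      then show False by simp
    qed
    ultimately show ?thesis by (simp add: F_def)
  qed
  note eq = fundamental_system_eq_of_proportional[OF Q P proportional]
  obtain N where N: "negligible N" "\<forall>x\<in>{0<..<pi} - N. (Q x - P x) * sn Q \<i> x = 0"
    using ae_potential_mult_eq[OF Q P sol(1)[OF Q] sol(1)[OF P] eq(1)] by blast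
  obtain M where M: "negligible M" "\<forall>x\<in>{0<..<pi} - M. (Q x - P x) * cs Q \<i> x = 0"
    using ae_potential_mult_eq[OF Q P sol(1)[OF Q] sol(1)[OF P] eq(2)] by blast
  have "q' x = q x" if x: "x \<in> {0<..<pi}" "x \<notin> N \<union> M" for x
  proof -
    have "sn Q \<i> x \<noteq> 0 \<or> cs Q \<i> x \<noteq> 0"
      using sn_cs_not_both_zero[OF Q, of x \<i>] x by auto
    then have "Q x - P x = 0" using N(2) M(2) x by auto
    then show ?thesis by (simp add: Q_def P_def)
  qed
  then have "{x \<in> space lebesgue. \<not> (x \<in> {0<..<pi} \<longrightarrow> q' x = q x)} \<subseteq> N \<union> M" by blast
  moreover have "N \<union> M \<in> null_sets lebesgue"
    using negligible_Un[OF N(1) M(1)] by (simp add: negligible_iff_null_sets)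
  ultimately show ?thesis by (rule AE_I'[rotated])
qed

end
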